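(* Let $(X_i)_{i\in\mathbb{Z}}$ be a stationary collection of real random variables with mean zero and finite variance, let $\delta>0$, and suppose that $\mathbb{E}|X_0|^{2+\delta}<\infty$. Write $v_n=\mathrm{Var}\left(\sum_{i=1}^nX_i\right)$. Suppose that: 1. $\sum_{j=1}^{\infty}\alpha(j)^{\delta/(2+\delta)}<\infty$, where $\alpha(j)$ are the $\alpha$-mixing coefficients of the process; 2. $v=\sum_{j=-\infty}^{\infty}\mathrm{Cov}(X_0,X_j)>0$; 3. setting $f_N(\tau)=\sup_{n\ge N}\left(\dfrac{n\,J_{\rm st}(V_n^{(\tau)})}{v_n+n\tau}\right)$ for $\tau>0$, there is some $N$ with $\int_0^\infty f_N(\tau)\,d\tau<\infty$. Then, writing $g_n$ for the density of $\left(\sum_{i=1}^nX_i\right)/\sqrt{v_n}$ and $\phi$ for the standard Gaussian density, $$\lim_{n\to\infty}D(g_n\|\phi)=0 .$$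
   Context: For random variables $S,T$ (defined on the same probability space) the $\alpha$-mixing coefficient is $\alpha(S,T)=\sup_{A,B}|\mathbb{P}((S\in A)\cap(T\in B))-\mathbb{P}(S\in A)\mathbb{P}(T\in B)|$, the supremum being over measurable sets $A,B$. Let $\Sigma_a^b$ be the $\sigma$-field generated by $X_a,X_{a+1},\ldots,X_b$ (where $a$ or $b$ can be infinite). For each $t$, $\alpha(t)=\sup\{\alpha(S,T): S \text{ is } \Sigma_{-\infty}^{0}\text{-measurable},\ T \text{ is } \Sigma_{t}^{\infty}\text{-measurable}\}$. For $\tau>0$, let $(Z_i^{(\tau)})_i$ be $N(0,\tau)$ random variables independent of the collection $(X_i)$ and of each other, and set $V_n^{(\tau)}=\left(\sum_{i=1}^n (X_i+Z_i^{(\tau)})\right)/\sqrt{n}$. For a random variable $U$ with smooth density $p$ and variance $\sigma_U^2$, the score function is $\rho(u)=p'(u)/p(u)$, the Fisher information is $J(U)=\mathbb{E}\rho^2(U)$, and the standardised Fisher information is $J_{\rm st}(U)=\sigma_U^2J(U)-1$. $D(f\|\phi)=\int f\log(f/\phi)$ is the relative entropy distance between densities $f$ and $\phi$. *)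

theory Defs
  imports "HOL-Probability.Probability"
begin

definition stationary_process :: "'a measure \<Rightarrow> (int \<Rightarrow> 'a \<Rightarrow> real) \<Rightarrow> bool" where
  "stationary_process M X \<longleftrightarrow>
     (\<forall>k. distr M (\<Pi>\<^sub>M i\<in>UNIV. borel) (\<lambda>\<omega> i. X (i + k) \<omega>)
        = distr M (\<Pi>\<^sub>M i\<in>UNIV. borel) (\<lambda>\<omega> i. X i \<omega>))"

definition generated_sigma :: "'a measure \<Rightarrow> (int \<Rightarrow> 'a \<Rightarrow> real) \<Rightarrow> int set \<Rightarrow> 'a measure" where
  "generated_sigma M X I = sigma (space M) (\<Union>i\<in>I. {X i -` A \<inter> space M | A. A \<in> sets borel})"

definition alpha_coeff :: "'a measure \<Rightarrow> ('a \<Rightarrow> real) \<Rightarrow> ('a \<Rightarrow> real) \<Rightarrow> real" where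
  "alpha_coeff M S T =
     (SUP (A, B) \<in> sets borel \<times> sets borel.
        \<bar>measure M {\<omega> \<in> space M. S \<omega> \<in> A \<and> T \<omega> \<in> B}
          - measure M {\<omega> \<in> space M. S \<omega> \<in> A} * measure M {\<omega> \<in> space M. T \<omega> \<in> B}\<bar>)"

(* All suprema here and in alpha_coeff are of nonempty sets of reals in [0, 1]. *)
definition alpha_mixing :: "'a measure \<Rightarrow> (int \<Rightarrow> 'a \<Rightarrow> real) \<Rightarrow> nat \<Rightarrow> real" where
  "alpha_mixing M X t =
     (SUP (S, T) \<in> borel_measurable (generated_sigma M X {..0})
                   \<times> borel_measurable (generated_sigma M X {int t..}). alpha_coeff M S T)"

abbreviation variance_of :: "'a measure \<Rightarrow> ('a \<Rightarrow> real) \<Rightarrow> real" where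
  "variance_of M U \<equiv> prob_space.variance M U"

definition covariance :: "'a measure \<Rightarrow> ('a \<Rightarrow> real) \<Rightarrow> ('a \<Rightarrow> real) \<Rightarrow> real" where
  "covariance M S T =
     (\<integral>\<omega>. (S \<omega> - (\<integral>\<omega>'. S \<omega>' \<partial>M)) * (T \<omega> - (\<integral>\<omega>'. T \<omega>' \<partial>M)) \<partial>M)"

definition partial_sum :: "(int \<Rightarrow> 'a \<Rightarrow> real) \<Rightarrow> nat \<Rightarrow> 'a \<Rightarrow> real" where
  "partial_sum X n \<omega> = (\<Sum>i=1..n. X (int i) \<omega>)"

definition is_density :: "'a measure \<Rightarrow> ('a \<Rightarrow> real) \<Rightarrow> (real \<Rightarrow> real) \<Rightarrow> bool" where
  "is_density M U p \<longleftrightarrow> (\<forall>x. 0 \<le> p x) \<and> distributed M lborel U (\<lambda>x. ennreal (p x))"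

definition smooth :: "(real \<Rightarrow> real) \<Rightarrow> bool" where
  "smooth p \<longleftrightarrow> (\<forall>k. (deriv ^^ k) p differentiable_on UNIV)"

(* A random variable has at most one smooth density: two of them agree almost everywhere,
   hence everywhere by continuity. *)
definition smooth_density :: "'a measure \<Rightarrow> ('a \<Rightarrow> real) \<Rightarrow> real \<Rightarrow> real" where
  "smooth_density M U = (THE p. is_density M U p \<and> smooth p)"

definition score :: "'a measure \<Rightarrow> ('a \<Rightarrow> real) \<Rightarrow> real \<Rightarrow> real" where
  "score M U u = deriv (smooth_density M U) u / smooth_density M U u"

definition fisher_info :: "'a measure \<Rightarrow> ('a \<Rightarrow> real) \<Rightarrow> ennreal" where
  "fisher_info M U = (\<integral>\<^sup>+\<omega>. ennreal ((score M U (U \<omega>))\<^sup>2) \<partial>M)"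

definition fisher_info_st :: "'a measure \<Rightarrow> ('a \<Rightarrow> real) \<Rightarrow> ereal" where
  "fisher_info_st M U = ereal (variance_of M U) * enn2ereal (fisher_info M U) - 1"

(* The integral of f log (f / h) as positive part minus negative part, so that a divergent
   integral is not read as 0. The negative part is finite when f and h are probability densities
   and h > 0. *)
definition rel_entropy :: "(real \<Rightarrow> real) \<Rightarrow> (real \<Rightarrow> real) \<Rightarrow> ereal" where
  "rel_entropy f h =
     enn2ereal (\<integral>\<^sup>+x. ennreal (f x * ln (f x / h x)) \<partial>lborel)
     - enn2ereal (\<integral>\<^sup>+x. ennreal (- (f x * ln (f x / h x))) \<partial>lborel)"

definition gaussian_noise ::
  "'a measure \<Rightarrow> (int \<Rightarrow> 'a \<Rightarrow> real) \<Rightarrow> real \<Rightarrow> (int \<Rightarrow> 'a \<Rightarrow> real) \<Rightarrow> bool" where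
  "gaussian_noise M X \<tau> Z \<longleftrightarrow>
     (\<forall>i. distributed M lborel (Z i) (\<lambda>x. ennreal (normal_density 0 (sqrt \<tau>) x))) \<and>
     prob_space.indep_vars M (\<lambda>_. borel) Z UNIV \<and>
     prob_space.indep_var M (\<Pi>\<^sub>M i\<in>UNIV. borel) (\<lambda>\<omega> i. X i \<omega>)
                            (\<Pi>\<^sub>M i\<in>UNIV. borel) (\<lambda>\<omega> i. Z i \<omega>)"

definition perturbed_sum ::
  "(int \<Rightarrow> 'a \<Rightarrow> real) \<Rightarrow> (int \<Rightarrow> 'a \<Rightarrow> real) \<Rightarrow> nat \<Rightarrow> 'a \<Rightarrow> real" where
  "perturbed_sum X Z n \<omega> = (\<Sum>i=1..n. X (int i) \<omega> + Z (int i) \<omega>) / sqrt (real n)"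

(* For n \<ge> 1, \<tau> > 0 and Gaussian noise the terms are nonnegative by the Cramer-Rao inequality,
   so converting the supremum to ennreal loses nothing. *)
definition fisher_sup ::
  "'a measure \<Rightarrow> (int \<Rightarrow> 'a \<Rightarrow> real) \<Rightarrow> (real \<Rightarrow> int \<Rightarrow> 'a \<Rightarrow> real) \<Rightarrow> nat \<Rightarrow> real \<Rightarrow> ereal" where
  "fisher_sup M X Z N \<tau> =
     (SUP n\<in>{N..}. ereal (real n) * fisher_info_st M (perturbed_sum X (Z \<tau>) n)
                     / ereal (variance_of M (partial_sum X n) + real n * \<tau>))"

end

theory Submission
  imports Defs "HOL-Computational_Algebra.Polynomial"
begin

text \<open>
  Let \<open>S\<^sub>n\<close> be the partial sums, \<open>U\<^sub>n = S\<^sub>n / sqrt n\<close> and \<open>s\<^sub>n = v\<^sub>n / n\<close>. The \<open>n\<close>-th term of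
  the supremum in the third hypothesis is \<open>h\<^sub>n(\<tau>) = J(U\<^sub>n + N(0,\<tau>)) - 1 / (s\<^sub>n + \<tau>)\<close>.

  The strong mixing condition gives Davydov's covariance inequality, hence \<open>s\<^sub>n\<close> tends to \<open>v\<close>,
  and, by Bernstein's blocks for the truncated variables, \<open>U\<^sub>n\<close> converges in law to \<open>N(0,v)\<close>.
  Convolution with \<open>N(0,\<tau>)\<close> turns this weak convergence into pointwise convergence of densities
  and of their derivatives, and Fatou's lemma yields \<open>limsup J(U\<^sub>n + N(0,\<tau>)) \<le> 1 / (v + \<tau>)\<close>.
  So the positive part of \<open>h\<^sub>n\<close> tends to \<open>0\<close> pointwise, and by dominated convergence so does its
  integral \<open>2 B\<^sub>n\<close>.

  By the de Bruijn identity, the relative entropy of \<open>U\<^sub>n + N(0,\<tau>)\<close> with respect to the Gaussian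
  law of the same variance is at most \<open>B\<^sub>n\<close>, for every \<open>\<tau> > 0\<close>. The Donsker-Varadhan inequality
  for bounded continuous test functions survives the limit \<open>\<tau> \<longlonglongrightarrow> 0\<close>; it forces the law of
  \<open>U\<^sub>n\<close> to be absolutely continuous and, with the truncated log-likelihood ratio as test function,
  bounds its relative entropy by \<open>B\<^sub>n\<close>.
\<close>

section \<open>Mixing coefficients of a stationary process\<close>

text \<open>The law of \<open>U_n\<close> need not have a density a priori, so the entropy bound at
  \<tau> > 0 cannot be moved to \<tau> = 0 through densities. The variational inequality gets around
  this because its left side is linear in the law; it amounts to lower semicontinuity of relative
  entropy, with the existence of the density as a by-product. Fisher information is lower
  semicontinuous too, which is the wrong direction for a bound on its limit superior. At fixed
  \<tau> > 0 the direction is reversed by subtracting it from a majorant whose integral is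
  \<open>1 / \<tau>\<close> for every law.

  The factor 2 in \<open>2 B_n\<close> comes from the heat equation, in which the time derivative is
  half the second space derivative. The Gaussian of variance \<open>s_n + \<tau>\<close> contributes
  exactly \<open>1 / (s_n + \<tau>)\<close> to the de Bruijn identity, so the standardised Fisher
  information of the third hypothesis turns into an entropy bound without loss. For large \<tau> the
  entropy gap disappears, being at most \<open>s_n / (2 \<tau>)\<close>.

  The exponent \<delta> / (2 + \<delta>) of the mixing rate is \<open>1 - 2 / p\<close> with
  \<open>p = 2 + \<delta>\<close>, the power that occurs in Davydov's inequality.\<close>

lemma generated_sigma_space [simp]: "space (generated_sigma M X I) = space M"
  by (simp add: generated_sigma_def space_measure_of_conv)

lemma sets_generated_sigma:
  "sets (generated_sigma M X I)
    = sigma_sets (space M) (\<Union>i\<in>I. {X i -` A \<inter> space M | A. A \<in> sets borel})"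
  unfolding generated_sigma_def by (rule sets_measure_of) auto

lemma measurable_generated_sigma:
  "i \<in> I \<Longrightarrow> X i \<in> borel_measurable (generated_sigma M X I)"
  by (rule measurableI) (auto simp: sets_generated_sigma intro!: sigma_sets.Basic)

lemma sets_generated_sigma_mono:
  "I \<subseteq> J \<Longrightarrow> sets (generated_sigma M X I) \<subseteq> sets (generated_sigma M X J)"
  unfolding sets_generated_sigma by (rule sigma_sets_mono') blast

lemma borel_measurable_generated_sigma_mono:
  assumes "f \<in> measurable (generated_sigma M X I) N" "I \<subseteq> J"
  shows "f \<in> measurable (generated_sigma M X J) N"
  using assms(1) sets_generated_sigma_mono[of I J M X, OF assms(2)]
  unfolding measurable_def by auto

locale stationary_space = prob_space M for M :: "'a measure" +
  fixes X :: "int \<Rightarrow> 'a \<Rightarrow> real"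
  assumes X_meas [measurable]: "\<And>i. X i \<in> borel_measurable M"
    and stat: "stationary_process M X"
begin

lemma measurable_path: "(\<lambda>\<omega> i. X (i + k) \<omega>) \<in> measurable M (\<Pi>\<^sub>M i\<in>UNIV. borel)"
  by (rule measurable_PiM_single') auto

lemma shift_prob:
  assumes A: "A \<in> sets (\<Pi>\<^sub>M i\<in>UNIV. borel)"
  shows "measure M {\<omega> \<in> space M. (\<lambda>i. X (i + k) \<omega>) \<in> A} = measure M {\<omega> \<in> space M. (\<lambda>i. X i \<omega>) \<in> A}"
proof -
  have "measure (distr M (\<Pi>\<^sub>M i\<in>UNIV. borel) (\<lambda>\<omega> i. X (i + k) \<omega>)) A
      = measure (distr M (\<Pi>\<^sub>M i\<in>UNIV. borel) (\<lambda>\<omega> i. X i \<omega>)) A"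
    using stat unfolding stationary_process_def by simp
  then show ?thesis
    using measure_distr[OF measurable_path A, of k] measure_distr[OF measurable_path A, of 0]
    by (simp add: vimage_def Int_def conj_commute)
qed

lemma shift_expectation:
  fixes f :: "(int \<Rightarrow> real) \<Rightarrow> 'b :: {banach, second_countable_topology}"
  assumes f: "f \<in> borel_measurable (\<Pi>\<^sub>M i\<in>UNIV. borel)"
  shows "(\<integral>\<omega>. f (\<lambda>i. X (i + k) \<omega>) \<partial>M) = (\<integral>\<omega>. f (\<lambda>i. X i \<omega>) \<partial>M)"
proof -
  have "(\<integral>x. f x \<partial>distr M (\<Pi>\<^sub>M i\<in>UNIV. borel) (\<lambda>\<omega> i. X (i + k) \<omega>))
      = (\<integral>x. f x \<partial>distr M (\<Pi>\<^sub>M i\<in>UNIV. borel) (\<lambda>\<omega> i. X i \<omega>))"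
    using stat unfolding stationary_process_def by simp
  then show ?thesis
    using integral_distr[OF measurable_path f, of k] integral_distr[OF measurable_path f, of 0]
    by simp
qed

lemma shift_integrable:
  fixes f :: "(int \<Rightarrow> real) \<Rightarrow> 'b :: {banach, second_countable_topology}"
  assumes f: "f \<in> borel_measurable (\<Pi>\<^sub>M i\<in>UNIV. borel)"
  shows "integrable M (\<lambda>\<omega>. f (\<lambda>i. X (i + k) \<omega>)) \<longleftrightarrow> integrable M (\<lambda>\<omega>. f (\<lambda>i. X i \<omega>))"
proof -
  have "integrable (distr M (\<Pi>\<^sub>M i\<in>UNIV. borel) (\<lambda>\<omega> i. X (i + k) \<omega>)) f
     \<longleftrightarrow> integrable (distr M (\<Pi>\<^sub>M i\<in>UNIV. borel) (\<lambda>\<omega> i. X i \<omega>)) f"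
    using stat unfolding stationary_process_def by simp
  then show ?thesis
    using integrable_distr_eq[OF measurable_path f, of k] integrable_distr_eq[OF measurable_path f, of 0]
    by simp
qed

text \<open>Every event of the shifted \<sigma>-field is cut out by a measurable set
  \<open>A\<close> of paths. Induction over the generation of the \<sigma>-field shows that the same
  \<open>A\<close>, read on the unshifted path, cuts out an event of the unshifted field;
  stationarity then equates the two probabilities.\<close>

lemma generated_event_shift:
  assumes "E \<in> sets (generated_sigma M X ((\<lambda>i. i + k) ` I))"
  shows "\<exists>A\<in>sets (\<Pi>\<^sub>M i\<in>UNIV. borel). E = {\<omega> \<in> space M. (\<lambda>i. X (i + k) \<omega>) \<in> A}
      \<and> {\<omega> \<in> space M. (\<lambda>i. X i \<omega>) \<in> A} \<in> sets (generated_sigma M X I)"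
  using assms unfolding sets_generated_sigma
proof (induction rule: sigma_sets.induct)
  case (Basic a)
  then obtain i B where i: "i \<in> I" and B: "B \<in> sets borel" and a: "a = X (i + k) -` B \<inter> space M"
    by auto
  have "{x. x i \<in> B} \<in> sets (\<Pi>\<^sub>M i\<in>(UNIV::int set). borel)"
    using measurable_sets[OF measurable_component_singleton[of i "UNIV::int set" "\<lambda>_. borel"] B]
    by (simp add: vimage_def space_PiM)
  moreover have "{\<omega> \<in> space M. X i \<omega> \<in> B} \<in> sigma_sets (space M) (\<Union>i\<in>I. {X i -` A \<inter> space M | A. A \<in> sets borel})"
    by (rule sigma_sets.Basic) (use i B in auto)
  ultimately show ?case
    by (intro bexI[of _ "{x. x i \<in> B}"]) (auto simp: a)
next
  case Empty
  show ?case by (rule bexI[of _ "{}"]) (auto intro: sigma_sets.Empty)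
next
  case (Compl a)
  then obtain A where A: "A \<in> sets (\<Pi>\<^sub>M i\<in>UNIV. borel)" "a = {\<omega> \<in> space M. (\<lambda>i. X (i + k) \<omega>) \<in> A}"
    "{\<omega> \<in> space M. (\<lambda>i. X i \<omega>) \<in> A} \<in> sigma_sets (space M) (\<Union>i\<in>I. {X i -` A \<inter> space M | A. A \<in> sets borel})"
    by auto
  have "UNIV - A \<in> sets (\<Pi>\<^sub>M i\<in>(UNIV::int set). borel)"
    using sets.compl_sets[OF A(1)] by (simp add: space_PiM PiE_UNIV_domain)
  moreover have "{\<omega> \<in> space M. (\<lambda>i. X i \<omega>) \<in> UNIV - A} = space M - {\<omega> \<in> space M. (\<lambda>i. X i \<omega>) \<in> A}"
    by auto
  ultimately show ?case
    using sigma_sets.Compl[OF A(3)] by (intro bexI[of _ "UNIV - A"]) (auto simp: A(2))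
next
  case (Union a)
  define P where "P n A \<longleftrightarrow> A \<in> sets (\<Pi>\<^sub>M i\<in>UNIV. borel) \<and> a n = {\<omega> \<in> space M. (\<lambda>i. X (i + k) \<omega>) \<in> A}
      \<and> {\<omega> \<in> space M. (\<lambda>i. X i \<omega>) \<in> A} \<in> sigma_sets (space M) (\<Union>i\<in>I. {X i -` A \<inter> space M | A. A \<in> sets borel})"
    for n A
  have "\<forall>n. \<exists>A. P n A"
    using Union unfolding P_def by blast
  then obtain A where P: "\<forall>n. P n (A n)"
    using choice[of P] by blast
  have A: "\<And>n. A n \<in> sets (\<Pi>\<^sub>M i\<in>UNIV. borel)"
    "\<And>n. a n = {\<omega> \<in> space M. (\<lambda>i. X (i + k) \<omega>) \<in> A n}"
    "\<And>n. {\<omega> \<in> space M. (\<lambda>i. X i \<omega>) \<in> A n} \<in> sigma_sets (space M) (\<Union>i\<in>I. {X i -` A \<inter> space M | A. A \<in> sets borel})"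
    using P unfolding P_def by blast+
  have "{\<omega> \<in> space M. (\<lambda>i. X i \<omega>) \<in> (\<Union>n. A n)} = (\<Union>n. {\<omega> \<in> space M. (\<lambda>i. X i \<omega>) \<in> A n})"
    by auto
  then have "{\<omega> \<in> space M. (\<lambda>i. X i \<omega>) \<in> (\<Union>n. A n)}
      \<in> sigma_sets (space M) (\<Union>i\<in>I. {X i -` A \<inter> space M | A. A \<in> sets borel})"
    using sigma_sets.Union[OF A(3)] by simp
  moreover have "(\<Union>n. A n) \<in> sets (\<Pi>\<^sub>M i\<in>UNIV. borel)"
    using A(1) by (intro sets.countable_UN) auto
  moreover have "(\<Union>n. a n) = {\<omega> \<in> space M. (\<lambda>i. X (i + k) \<omega>) \<in> (\<Union>n. A n)}"
    using A(2) by blast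
  ultimately show ?case by blast
qed

text \<open>A supremum of reals is meaningful only over a nonempty bounded set; this supplies the
  nonemptiness for the supremum over pairs of variables.\<close>

lemma borel_measurable_nonempty: "borel_measurable N \<noteq> ({} :: ('b \<Rightarrow> real) set)"
proof -
  have "(\<lambda>_. 0::real) \<in> borel_measurable N" by simp
  then show ?thesis by blast
qed

lemma prob_prod_diff_le_1: "\<bar>measure M A - measure M B * measure M C\<bar> \<le> 1"
proof -
  have "0 \<le> measure M B * measure M C" "measure M B * measure M C \<le> 1"
    by (auto intro: mult_le_one)
  then show ?thesis using prob_le_1[of A] measure_nonneg[of M A] by linarith
qed

lemma bdd_above_alpha_coeff:
  "bdd_above ((\<lambda>(A, B). \<bar>measure M {\<omega> \<in> space M. S \<omega> \<in> A \<and> T \<omega> \<in> B}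
          - measure M {\<omega> \<in> space M. S \<omega> \<in> A} * measure M {\<omega> \<in> space M. T \<omega> \<in> B}\<bar>) ` (sets borel \<times> sets borel))"
  by (rule bdd_aboveI[of _ 1]) (auto simp: prob_prod_diff_le_1)

lemma alpha_coeff_le_1: "alpha_coeff M S T \<le> 1"
  unfolding alpha_coeff_def
  by (rule cSUP_least) (auto simp: prob_prod_diff_le_1)

lemma alpha_mixing_le_1: "alpha_mixing M X t \<le> 1"
  unfolding alpha_mixing_def
  by (rule cSUP_least) (auto simp: alpha_coeff_le_1 borel_measurable_nonempty)

lemma alpha_mixing_mono: "s \<le> t \<Longrightarrow> alpha_mixing M X t \<le> alpha_mixing M X s"
  unfolding alpha_mixing_def
  by (rule cSUP_subset_mono)
    (auto simp: alpha_coeff_le_1 borel_measurable_nonempty intro!: bdd_aboveI[of _ 1]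
       intro: borel_measurable_generated_sigma_mono)

text \<open>The indicators of \<open>E\<close> and \<open>F\<close> are admissible variables in the
  outer supremum, and the Borel set \<open>{1}\<close> recovers the events in the inner one.\<close>

lemma alpha_mixing_events0:
  assumes E: "E \<in> sets (generated_sigma M X {..0})" and F: "F \<in> sets (generated_sigma M X {int t..})"
  shows "\<bar>measure M (E \<inter> F) - measure M E * measure M F\<bar> \<le> alpha_mixing M X t"
proof -
  have sub: "E \<subseteq> space M" "F \<subseteq> space M"
    using sets.sets_into_space[OF E] sets.sets_into_space[OF F] by auto
  let ?S = "indicat_real E" and ?T = "indicat_real F"
  have "\<bar>measure M (E \<inter> F) - measure M E * measure M F\<bar> =
    (\<lambda>(A, B). \<bar>measure M {\<omega> \<in> space M. ?S \<omega> \<in> A \<and> ?T \<omega> \<in> B}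
          - measure M {\<omega> \<in> space M. ?S \<omega> \<in> A} * measure M {\<omega> \<in> space M. ?T \<omega> \<in> B}\<bar>) ({1}, {1})"
  proof -
    have "{\<omega> \<in> space M. ?S \<omega> \<in> {1} \<and> ?T \<omega> \<in> {1}} = E \<inter> F"
      "{\<omega> \<in> space M. ?S \<omega> \<in> {1}} = E" "{\<omega> \<in> space M. ?T \<omega> \<in> {1}} = F"
      using sub by (auto simp: indicator_def)
    then show ?thesis by simp
  qed
  also have "\<dots> \<le> alpha_coeff M ?S ?T"
    unfolding alpha_coeff_def
    by (rule cSUP_upper[OF _ bdd_above_alpha_coeff]) auto
  also have "\<dots> = (\<lambda>(S, T). alpha_coeff M S T) (?S, ?T)" by simp
  also have "\<dots> \<le> alpha_mixing M X t"
    unfolding alpha_mixing_def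
    by (rule cSUP_upper)
      (use E F in \<open>auto simp: alpha_coeff_le_1 intro!: bdd_aboveI[of _ 1]\<close>)
  finally show ?thesis .
qed

text \<open>The coefficient is defined with the past ending at time 0. By
  \<open>generated_event_shift\<close> both events are given by path sets, and stationarity moves
  the splitting time from 0 to \<open>k\<close>.\<close>

lemma alpha_mixing_events:
  assumes E: "E \<in> sets (generated_sigma M X {..k})" and F: "F \<in> sets (generated_sigma M X {k + int t..})"
  shows "\<bar>measure M (E \<inter> F) - measure M E * measure M F\<bar> \<le> alpha_mixing M X t"
proof -
  have im: "(\<lambda>i. i + k) ` {..0} = {..k}" "(\<lambda>i. i + k) ` {int t..} = {k + int t..}"
    by (auto simp: image_iff intro!: bexI[of _ "_ - k"])
  obtain A where A: "A \<in> sets (\<Pi>\<^sub>M i\<in>UNIV. borel)" "E = {\<omega> \<in> space M. (\<lambda>i. X (i + k) \<omega>) \<in> A}"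
      "{\<omega> \<in> space M. (\<lambda>i. X i \<omega>) \<in> A} \<in> sets (generated_sigma M X {..0})"
    using generated_event_shift[of E k "{..0}"] E unfolding im by auto
  obtain B where B: "B \<in> sets (\<Pi>\<^sub>M i\<in>UNIV. borel)" "F = {\<omega> \<in> space M. (\<lambda>i. X (i + k) \<omega>) \<in> B}"
      "{\<omega> \<in> space M. (\<lambda>i. X i \<omega>) \<in> B} \<in> sets (generated_sigma M X {int t..})"
    using generated_event_shift[of F k "{int t..}"] F unfolding im by auto
  have "E \<inter> F = {\<omega> \<in> space M. (\<lambda>i. X (i + k) \<omega>) \<in> A \<inter> B}" using A B by auto
  moreover have "{\<omega> \<in> space M. (\<lambda>i. X i \<omega>) \<in> A} \<inter> {\<omega> \<in> space M. (\<lambda>i. X i \<omega>) \<in> B} =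
      {\<omega> \<in> space M. (\<lambda>i. X i \<omega>) \<in> A \<inter> B}" by auto
  ultimately show ?thesis
    using alpha_mixing_events0[OF A(3) B(3)] shift_prob[OF A(1), of k] shift_prob[OF B(1), of k]
      shift_prob[OF sets.Int[OF A(1) B(1)], of k] A(2) B(2) by simp
qed

end

section \<open>Covariance inequalities\<close>

lemma abs_mult_le_squares: "\<bar>x * y\<bar> \<le> (x\<^sup>2 + y\<^sup>2) / 2" for x y :: real
  using sum_squares_bound[of x y] sum_squares_bound[of "-x" y] by (auto simp: abs_if)

text \<open>Both sides count the heights \<open>k / n\<close> that do not exceed
  \<open>x\<close>.\<close>

lemma floor_level_sum:
  fixes x :: real
  assumes "0 \<le> x" "x \<le> 1"
  shows "(\<Sum>k=1..n. indicator {real k / real n..} x :: real) = of_int \<lfloor>real n * x\<rfloor>"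
proof -
  have nx: "\<lfloor>real n * x\<rfloor> \<le> int n" "0 \<le> \<lfloor>real n * x\<rfloor>"
    using assms mult_left_mono[OF assms(2), of "real n"] by (auto simp: floor_le_iff)
  have iff: "real k / real n \<le> x \<longleftrightarrow> k \<le> nat \<lfloor>real n * x\<rfloor>" if "k \<in> {1..n}" for k
  proof -
    have "real k / real n \<le> x \<longleftrightarrow> real k \<le> real n * x"
      using that by (simp add: divide_le_eq mult.commute)
    also have "\<dots> \<longleftrightarrow> int k \<le> \<lfloor>real n * x\<rfloor>" by (simp add: le_floor_iff)
    also have "\<dots> \<longleftrightarrow> k \<le> nat \<lfloor>real n * x\<rfloor>" using nx by linarith
    finally show ?thesis .
  qed
  have "(\<Sum>k=1..n. indicator {real k / real n..} x :: real) = (\<Sum>k=1..n. if k \<le> nat \<lfloor>real n * x\<rfloor> then 1 else 0)"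
    by (rule sum.cong) (use iff in \<open>auto simp: indicator_def\<close>)
  also have "\<dots> = real (card {k \<in> {1..n}. k \<le> nat \<lfloor>real n * x\<rfloor>})"
    by (simp flip: sum.inter_filter)
  also have "{k \<in> {1..n}. k \<le> nat \<lfloor>real n * x\<rfloor>} = {1..nat \<lfloor>real n * x\<rfloor>}"
    using nx by auto
  finally show ?thesis using nx by simp
qed

context prob_space
begin

lemma integrable_bounded_rv:
  fixes f :: "'a \<Rightarrow> 'b :: {banach, second_countable_topology}"
  shows "f \<in> borel_measurable M \<Longrightarrow> (\<And>x. x \<in> space M \<Longrightarrow> norm (f x) \<le> c) \<Longrightarrow> integrable M f"
  by (rule integrable_const_bound[of f c]) auto

lemma expectation_diff_le:
  fixes f g :: "'a \<Rightarrow> real"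
  assumes "integrable M f" "integrable M g" "\<And>x. x \<in> space M \<Longrightarrow> \<bar>f x - g x\<bar> \<le> e"
  shows "\<bar>expectation f - expectation g\<bar> \<le> e"
proof -
  have "\<bar>expectation f - expectation g\<bar> = \<bar>expectation (\<lambda>x. f x - g x)\<bar>"
    using assms by simp
  also have "\<dots> \<le> expectation (\<lambda>x. \<bar>f x - g x\<bar>)" by (rule integral_abs_bound)
  also have "\<dots> \<le> expectation (\<lambda>x. e)"
    by (rule integral_mono) (use assms in auto)
  finally show ?thesis by (simp add: prob_space)
qed

lemma integrable_mult_of_squares:
  fixes f g :: "'a \<Rightarrow> real"
  assumes [measurable]: "f \<in> borel_measurable M" "g \<in> borel_measurable M"
    and i: "integrable M (\<lambda>x. (f x)\<^sup>2)" "integrable M (\<lambda>x. (g x)\<^sup>2)"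
  shows "integrable M (\<lambda>x. f x * g x)"
  by (rule Bochner_Integration.integrable_bound[where f="\<lambda>x. ((f x)\<^sup>2 + (g x)\<^sup>2) / 2"])
    (use i abs_mult_le_squares in auto)

text \<open>A discrete layer-cake argument: up to an error \<open>1 / n\<close>, a function with values in the unit
  interval is the average of the indicators of its upper level sets at the heights \<open>k / n\<close>.\<close>

lemma cov_unit_interval:
  fixes S T :: "'a \<Rightarrow> real"
  assumes [measurable]: "S \<in> borel_measurable M" "T \<in> borel_measurable M"
    and mix: "\<And>A B. A \<in> sets borel \<Longrightarrow> B \<in> sets borel \<Longrightarrow>
      \<bar>prob {\<omega> \<in> space M. S \<omega> \<in> A \<and> T \<omega> \<in> B} - prob {\<omega> \<in> space M. S \<omega> \<in> A} * prob {\<omega> \<in> space M. T \<omega> \<in> B}\<bar> \<le> \<beta>"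
    and S: "\<And>\<omega>. \<omega> \<in> space M \<Longrightarrow> 0 \<le> S \<omega> \<and> S \<omega> \<le> 1" and T: "\<And>\<omega>. \<omega> \<in> space M \<Longrightarrow> 0 \<le> T \<omega> \<and> T \<omega> \<le> 1"
  shows "\<bar>expectation (\<lambda>\<omega>. S \<omega> * T \<omega>) - expectation S * expectation T\<bar> \<le> \<beta>"
proof (rule field_le_epsilon)
  fix e :: real assume "e > 0"
  \<comment> \<open>Rounding to multiples of \<open>1 / n\<close> changes the mean of the product
    and the product of the means by at most \<open>2 / n\<close> each, so \<open>4 / n < e\<close>
    is enough.\<close>
  obtain n :: nat where n': "4 / e < real n" using reals_Archimedean2 by blast
  have "0 < 4 / e" using \<open>e > 0\<close> by simp
  then have "real n > 0" using n' by linarith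
  then have n: "n > 0" "4 / real n < e"
    using n' \<open>e > 0\<close> by (simp_all add: field_simps)
  define r where "r x = (\<Sum>k=1..n. indicator {real k / real n..} x :: real) / real n" for x :: real
  have r[measurable]: "r \<in> borel_measurable borel" unfolding r_def by measurable
  have rx: "\<bar>r x - x\<bar> \<le> 1 / real n \<and> 0 \<le> r x \<and> r x \<le> 1" if "0 \<le> x" "x \<le> 1" for x
  proof -
    have "r x = of_int \<lfloor>real n * x\<rfloor> / real n" unfolding r_def using floor_level_sum[OF that] by simp
    moreover have "\<bar>of_int \<lfloor>real n * x\<rfloor> / real n - x\<bar> = \<bar>of_int \<lfloor>real n * x\<rfloor> - real n * x\<bar> / real n"
      using n by (simp add: field_simps abs_div_pos flip: abs_divide)
    moreover have "\<bar>of_int \<lfloor>real n * x\<rfloor> - real n * x\<bar> \<le> 1" by linarith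
    moreover have "0 \<le> r x" unfolding r_def by (intro divide_nonneg_nonneg sum_nonneg) auto
    moreover have "r x \<le> 1"
      unfolding r_def using n by (simp add: divide_le_eq order_trans[OF sum_bounded_above[where K=1]])
    ultimately show ?thesis using n by (simp add: divide_right_mono)
  qed
  let ?S = "\<lambda>\<omega>. r (S \<omega>)" and ?T = "\<lambda>\<omega>. r (T \<omega>)"
  let ?IS = "\<lambda>k \<omega>. indicator {real k / real n..} (S \<omega>) :: real"
  let ?IT = "\<lambda>k \<omega>. indicator {real k / real n..} (T \<omega>) :: real"
  have II[simp]: "integrable M (?IS k)" "integrable M (?IT k)" "integrable M (\<lambda>\<omega>. ?IS k \<omega> * ?IT l \<omega>)" for k l
    by (auto intro!: integrable_bounded_rv[where c=1] simp: indicator_def)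
  have pI: "expectation g = prob E" if "E \<in> events" "\<And>\<omega>. \<omega> \<in> space M \<Longrightarrow> g \<omega> = indicator E \<omega>" for g E
    using Bochner_Integration.integral_cong[of M M g "indicator E"] that by simp
  have EI: "\<bar>expectation (\<lambda>\<omega>. ?IS k \<omega> * ?IT l \<omega>) - expectation (?IS k) * expectation (?IT l)\<bar> \<le> \<beta>" for k l
  proof -
    have "expectation (?IS k) = prob {\<omega> \<in> space M. S \<omega> \<in> {real k / real n..}}"
      by (rule pI) (auto simp: indicator_def)
    moreover have "expectation (?IT l) = prob {\<omega> \<in> space M. T \<omega> \<in> {real l / real n..}}"
      by (rule pI) (auto simp: indicator_def)
    moreover have "expectation (\<lambda>\<omega>. ?IS k \<omega> * ?IT l \<omega>) = prob {\<omega> \<in> space M. S \<omega> \<in> {real k / real n..} \<and> T \<omega> \<in> {real l / real n..}}"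
      by (rule pI) (auto simp: indicator_def)
    ultimately show ?thesis using mix[of "{real k / real n..}" "{real l / real n..}"] by simp
  qed
  have ES: "expectation ?S = (\<Sum>k=1..n. expectation (?IS k)) / real n"
    unfolding r_def by simp
  have ET: "expectation ?T = (\<Sum>k=1..n. expectation (?IT k)) / real n"
    unfolding r_def by simp
  have EST: "expectation (\<lambda>\<omega>. ?S \<omega> * ?T \<omega>) = (\<Sum>k=1..n. \<Sum>l=1..n. expectation (\<lambda>\<omega>. ?IS k \<omega> * ?IT l \<omega>)) / (real n)\<^sup>2"
  proof -
    have "(\<lambda>\<omega>. ?S \<omega> * ?T \<omega>) = (\<lambda>\<omega>. (\<Sum>k=1..n. \<Sum>l=1..n. ?IS k \<omega> * ?IT l \<omega>) / (real n)\<^sup>2)"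
      by (simp only: r_def times_divide_times_eq sum_product power2_eq_square)
    then show ?thesis
      by (simp only: integral_divide_zero Bochner_Integration.integral_sum Bochner_Integration.integrable_sum II)
  qed
  \<comment> \<open>Covariance is bilinear, so that of the rounded variables is the average of the
    \<open>n^2\<close> covariances \<open>c k l\<close> of level indicators, each at most
    \<beta>.\<close>
  define c where "c k l = expectation (\<lambda>\<omega>. ?IS k \<omega> * ?IT l \<omega>) - expectation (?IS k) * expectation (?IT l)" for k l
  have c: "\<bar>c k l\<bar> \<le> \<beta>" for k l unfolding c_def by (rule EI)
  have "expectation (\<lambda>\<omega>. ?S \<omega> * ?T \<omega>) - expectation ?S * expectation ?T = (\<Sum>k=1..n. \<Sum>l=1..n. c k l) / (real n)\<^sup>2"
    unfolding ES ET EST c_def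
    by (simp only: times_divide_times_eq sum_product power2_eq_square sum_subtractf diff_divide_distrib)
  also have "\<bar>\<dots>\<bar> = \<bar>\<Sum>k=1..n. \<Sum>l=1..n. c k l\<bar> / (real n)\<^sup>2"
    by simp
  also have "\<dots> \<le> (\<Sum>k=1..n. \<Sum>l=1..n. \<beta>) / (real n)\<^sup>2"
    by (intro divide_right_mono order_trans[OF sum_abs] sum_mono order_trans[OF sum_abs] c) auto
  also have "\<dots> = \<beta>" using n by (simp add: power2_eq_square)
  finally have main: "\<bar>expectation (\<lambda>\<omega>. ?S \<omega> * ?T \<omega>) - expectation ?S * expectation ?T\<bar> \<le> \<beta>" .
  have [simp]: "integrable M S" "integrable M T" "integrable M ?S" "integrable M ?T"
     "integrable M (\<lambda>\<omega>. S \<omega> * T \<omega>)" "integrable M (\<lambda>\<omega>. ?S \<omega> * ?T \<omega>)"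
    using S T rx by (auto intro!: integrable_bounded_rv[where c=1] mult_le_one simp: abs_mult)
  have dS: "\<bar>expectation S - expectation ?S\<bar> \<le> 1 / real n" "\<bar>expectation T - expectation ?T\<bar> \<le> 1 / real n"
    using rx S T by (auto intro!: expectation_diff_le simp: abs_minus_commute)
  have prod: "\<bar>a * b - c * d\<bar> \<le> 2 / real n" if "\<bar>a - c\<bar> \<le> 1 / real n" "\<bar>b - d\<bar> \<le> 1 / real n" "0 \<le> b" "b \<le> 1" "0 \<le> c" "c \<le> 1"
    for a b c d :: real
  proof -
    have "a * b - c * d = (a - c) * b + c * (b - d)" by (simp add: algebra_simps)
    also have "\<bar>\<dots>\<bar> \<le> \<bar>a - c\<bar> * \<bar>b\<bar> + \<bar>c\<bar> * \<bar>b - d\<bar>" by (metis abs_mult abs_triangle_ineq)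
    also have "\<dots> \<le> 1 / real n * 1 + 1 * (1 / real n)"
      by (intro add_mono mult_mono) (use that in auto)
    finally show ?thesis by simp
  qed
  have "\<bar>expectation (\<lambda>\<omega>. S \<omega> * T \<omega>) - expectation (\<lambda>\<omega>. ?S \<omega> * ?T \<omega>)\<bar> \<le> 2 / real n"
    by (rule expectation_diff_le) (use S T rx in \<open>auto intro!: prod simp: abs_minus_commute\<close>)
  moreover have "\<bar>expectation S * expectation T - expectation ?S * expectation ?T\<bar> \<le> 2 / real n"
  proof (rule prod[OF dS])
    show "0 \<le> expectation T" "0 \<le> expectation ?S" using S T rx by (auto intro!: integral_nonneg_AE)
    show "expectation T \<le> 1" using T by (intro integral_le_const) auto
    show "expectation ?S \<le> 1" using S rx by (intro integral_le_const) auto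
  qed
  ultimately show "\<bar>expectation (\<lambda>\<omega>. S \<omega> * T \<omega>) - expectation S * expectation T\<bar> \<le> \<beta> + e"
    using main n(2) by (simp add: field_simps)
qed

text \<open>Affine maps carry both ranges to the unit interval. Undoing them multiplies the
  covariance by the lengths \<open>2 * a\<close> and \<open>2 * b\<close> of the ranges, hence the
  factor 4.\<close>

lemma cov_bounded:
  fixes S T :: "'a \<Rightarrow> real"
  assumes [measurable]: "S \<in> borel_measurable M" "T \<in> borel_measurable M"
    and mix: "\<And>A B. A \<in> sets borel \<Longrightarrow> B \<in> sets borel \<Longrightarrow>
      \<bar>prob {\<omega> \<in> space M. S \<omega> \<in> A \<and> T \<omega> \<in> B} - prob {\<omega> \<in> space M. S \<omega> \<in> A} * prob {\<omega> \<in> space M. T \<omega> \<in> B}\<bar> \<le> \<beta>"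
    and S: "\<And>\<omega>. \<omega> \<in> space M \<Longrightarrow> \<bar>S \<omega>\<bar> \<le> a" and T: "\<And>\<omega>. \<omega> \<in> space M \<Longrightarrow> \<bar>T \<omega>\<bar> \<le> b"
    and ab: "0 < a" "0 < b"
  shows "\<bar>expectation (\<lambda>\<omega>. S \<omega> * T \<omega>) - expectation S * expectation T\<bar> \<le> 4 * \<beta> * a * b"
proof -
  define S' where "S' \<omega> = (S \<omega> + a) / (2 * a)" for \<omega>
  define T' where "T' \<omega> = (T \<omega> + b) / (2 * b)" for \<omega>
  have [measurable]: "S' \<in> borel_measurable M" "T' \<in> borel_measurable M"
    unfolding S'_def T'_def by measurable
  have S01: "0 \<le> S' \<omega> \<and> S' \<omega> \<le> 1" "0 \<le> T' \<omega> \<and> T' \<omega> \<le> 1" if "\<omega> \<in> space M" for \<omega>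
    using S[OF that] T[OF that] ab unfolding S'_def T'_def by (auto simp: field_simps)
  have "\<bar>expectation (\<lambda>\<omega>. S' \<omega> * T' \<omega>) - expectation S' * expectation T'\<bar> \<le> \<beta>"
  proof (rule cov_unit_interval)
    fix A B :: "real set" assume AB[measurable]: "A \<in> sets borel" "B \<in> sets borel"
    let ?A = "(\<lambda>x. (x + a) / (2 * a)) -` A" and ?B = "(\<lambda>x. (x + b) / (2 * b)) -` B"
    have "?A \<in> sets borel" "?B \<in> sets borel"
      using measurable_sets[of "\<lambda>x. (x + a) / (2 * a)" borel borel A]
        measurable_sets[of "\<lambda>x. (x + b) / (2 * b)" borel borel B] AB by auto
    from mix[OF this] show "\<bar>prob {\<omega> \<in> space M. S' \<omega> \<in> A \<and> T' \<omega> \<in> B} - prob {\<omega> \<in> space M. S' \<omega> \<in> A} * prob {\<omega> \<in> space M. T' \<omega> \<in> B}\<bar> \<le> \<beta>"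
      by (simp add: S'_def T'_def)
  qed (use S01 in auto)
  have [simp]: "integrable M S'" "integrable M T'" "integrable M (\<lambda>\<omega>. S' \<omega> * T' \<omega>)"
    using S01 by (auto intro!: integrable_bounded_rv[where c=1] mult_le_one simp: abs_mult)
  have Sd: "S = (\<lambda>\<omega>. 2 * a * S' \<omega> - a)" "T = (\<lambda>\<omega>. 2 * b * T' \<omega> - b)"
    using ab by (auto simp: S'_def T'_def)
  have e12: "expectation S = 2 * a * expectation S' - a" "expectation T = 2 * b * expectation T' - b"
    by (subst Sd, simp add: prob_space)+
  have e3: "expectation (\<lambda>\<omega>. S \<omega> * T \<omega>) = 4 * a * b * expectation (\<lambda>\<omega>. S' \<omega> * T' \<omega>) - 2 * a * b * expectation S' - 2 * a * b * expectation T' + a * b"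
  proof -
    have "(\<lambda>\<omega>. S \<omega> * T \<omega>) = (\<lambda>\<omega>. 4 * a * b * (S' \<omega> * T' \<omega>) - 2 * a * b * S' \<omega> - 2 * a * b * T' \<omega> + a * b)"
      by (subst Sd(1), subst Sd(2)) (auto simp: algebra_simps)
    then show ?thesis by (simp add: prob_space)
  qed
  have "expectation (\<lambda>\<omega>. S \<omega> * T \<omega>) - expectation S * expectation T
     = 4 * a * b * (expectation (\<lambda>\<omega>. S' \<omega> * T' \<omega>) - expectation S' * expectation T')"
    unfolding e12 e3 by (simp add: algebra_simps)
  then have "\<bar>expectation (\<lambda>\<omega>. S \<omega> * T \<omega>) - expectation S * expectation T\<bar>
     = 4 * a * b * \<bar>expectation (\<lambda>\<omega>. S' \<omega> * T' \<omega>) - expectation S' * expectation T'\<bar>"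
    using ab by (simp add: abs_mult)
  also have "\<dots> \<le> 4 * a * b * \<beta>"
    using \<open>\<bar>expectation (\<lambda>\<omega>. S' \<omega> * T' \<omega>) - expectation S' * expectation T'\<bar> \<le> \<beta>\<close> ab
    by (intro mult_left_mono) auto
  finally show ?thesis by (simp add: mult_ac)
qed

text \<open>Both variables are truncated at the level \<open>a\<close> with \<open>a powr p = m / \<beta>\<close>, at which the mixing
  bound \<open>\<beta> * a\<^sup>2\<close> for the bounded parts equals the bound \<open>a powr (2 - p) * m\<close> for the tails.\<close>

lemma davydov:
  fixes S T :: "'a \<Rightarrow> real"
  assumes [measurable]: "S \<in> borel_measurable M" "T \<in> borel_measurable M"
    and mix: "\<And>A B. A \<in> sets borel \<Longrightarrow> B \<in> sets borel \<Longrightarrow>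
      \<bar>prob {\<omega> \<in> space M. S \<omega> \<in> A \<and> T \<omega> \<in> B} - prob {\<omega> \<in> space M. S \<omega> \<in> A} * prob {\<omega> \<in> space M. T \<omega> \<in> B}\<bar> \<le> \<beta>"
    and \<beta>: "0 < \<beta>" and p: "p > 2" and m: "m > 0"
    and iS: "integrable M (\<lambda>\<omega>. \<bar>S \<omega>\<bar> powr p)" and iT: "integrable M (\<lambda>\<omega>. \<bar>T \<omega>\<bar> powr p)"
    and mS: "expectation (\<lambda>\<omega>. \<bar>S \<omega>\<bar> powr p) \<le> m" and mT: "expectation (\<lambda>\<omega>. \<bar>T \<omega>\<bar> powr p) \<le> m"
    and iST: "integrable M (\<lambda>\<omega>. S \<omega> * T \<omega>)" "integrable M S" "integrable M T"
  shows "\<bar>expectation (\<lambda>\<omega>. S \<omega> * T \<omega>) - expectation S * expectation T\<bar> \<le> 10 * (\<beta> powr (1 - 2 / p) * m powr (2 / p))"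
proof -
  define a where "a = (m / \<beta>) powr (1 / p)"
  have a: "a > 0" unfolding a_def using \<beta> m by simp
  define \<kappa> where "\<kappa> = \<beta> * a\<^sup>2"
  have \<kappa>1: "\<kappa> = \<beta> powr (1 - 2 / p) * m powr (2 / p)"
  proof -
    have "a\<^sup>2 = (m / \<beta>) powr (2 / p)"
      unfolding a_def using m \<beta> p by (simp add: powr_powr flip: powr_numeral)
    also have "\<dots> = m powr (2 / p) * \<beta> powr (- (2 / p))"
      using m \<beta> by (simp add: powr_divide powr_minus_divide)
    finally show ?thesis unfolding \<kappa>_def using \<beta> by (simp add: powr_diff powr_minus field_simps)
  qed
  have ap: "a powr p = m / \<beta>" unfolding a_def using p m \<beta> by (simp add: powr_powr)
  have \<kappa>2: "a powr (2 - p) * m = \<kappa>"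
  proof -
    have "a powr (2 - p) = a\<^sup>2 * (\<beta> / m)" using a ap by (simp add: powr_diff)
    then show ?thesis using m unfolding \<kappa>_def by simp
  qed
  have \<kappa>3: "a * (a powr (1 - p) * m) = \<kappa>"
  proof -
    have "a * a powr (1 - p) = a powr (2 - p)"
      using a powr_add[of a 1 "1 - p"] by simp
    then show ?thesis using \<kappa>2 by (metis mult.assoc)
  qed
  define t where "t x = (if \<bar>x\<bar> \<le> a then x else 0)" for x :: real
  have t[measurable]: "t \<in> borel_measurable borel" unfolding t_def by measurable
  have tb: "\<bar>t x\<bar> \<le> a" for x using a by (auto simp: t_def)
  have r1: "\<bar>x - t x\<bar> \<le> a powr (1 - p) * \<bar>x\<bar> powr p" for x
  proof (cases "\<bar>x\<bar> \<le> a")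
    case False
    then have x: "\<bar>x\<bar> > 0" "a \<le> \<bar>x\<bar>" using a by linarith+
    have "\<bar>x\<bar> powr (1 - p) \<le> a powr (1 - p)"
      using a x p by (intro powr_mono2') auto
    then have "\<bar>x\<bar> powr (1 - p) * \<bar>x\<bar> powr p \<le> a powr (1 - p) * \<bar>x\<bar> powr p"
      by (rule mult_right_mono) simp
    moreover have "\<bar>x\<bar> powr (1 - p) * \<bar>x\<bar> powr p = \<bar>x\<bar>" using x by (simp flip: powr_add)
    ultimately show ?thesis using False by (simp add: t_def)
  qed (auto simp: t_def)
  have r2: "(x - t x)\<^sup>2 \<le> a powr (2 - p) * \<bar>x\<bar> powr p" for x
  proof (cases "\<bar>x\<bar> \<le> a")
    case False
    then have x: "\<bar>x\<bar> > 0" "a \<le> \<bar>x\<bar>" using a by linarith+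
    have "\<bar>x\<bar> powr (2 - p) \<le> a powr (2 - p)"
      using a x p by (intro powr_mono2') auto
    then have "\<bar>x\<bar> powr (2 - p) * \<bar>x\<bar> powr p \<le> a powr (2 - p) * \<bar>x\<bar> powr p"
      by (rule mult_right_mono) simp
    moreover have "\<bar>x\<bar> powr (2 - p) * \<bar>x\<bar> powr p = x\<^sup>2" using x by (simp flip: powr_add)
    ultimately show ?thesis using False by (simp add: t_def)
  qed (auto simp: t_def)
  have E: "expectation (\<lambda>\<omega>. \<bar>Y \<omega> - t (Y \<omega>)\<bar>) \<le> a powr (1 - p) * m"
       "expectation (\<lambda>\<omega>. (Y \<omega> - t (Y \<omega>))\<^sup>2) \<le> \<kappa>"
       "integrable M (\<lambda>\<omega>. (Y \<omega> - t (Y \<omega>))\<^sup>2)" "integrable M (\<lambda>\<omega>. Y \<omega> - t (Y \<omega>))" "integrable M (\<lambda>\<omega>. t (Y \<omega>))"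
    if [measurable]: "Y \<in> borel_measurable M" and iY: "integrable M (\<lambda>\<omega>. \<bar>Y \<omega>\<bar> powr p)"
      and mY: "expectation (\<lambda>\<omega>. \<bar>Y \<omega>\<bar> powr p) \<le> m" and "integrable M Y" for Y
  proof -
    show t1: "integrable M (\<lambda>\<omega>. t (Y \<omega>))" by (rule integrable_bounded_rv[where c=a]) (auto simp: tb)
    show t2: "integrable M (\<lambda>\<omega>. Y \<omega> - t (Y \<omega>))" using t1 \<open>integrable M Y\<close> by simp
    show t3: "integrable M (\<lambda>\<omega>. (Y \<omega> - t (Y \<omega>))\<^sup>2)"
      by (rule Bochner_Integration.integrable_bound[OF integrable_mult_right[OF iY, of "a powr (2 - p)"]])
        (use r2 in \<open>auto intro!: AE_I2 order_trans[OF _ abs_ge_self]\<close>)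
    have "expectation (\<lambda>\<omega>. \<bar>Y \<omega> - t (Y \<omega>)\<bar>) \<le> expectation (\<lambda>\<omega>. a powr (1 - p) * \<bar>Y \<omega>\<bar> powr p)"
      by (rule integral_mono) (use t2 iY r1 in auto)
    also have "\<dots> \<le> a powr (1 - p) * m" using mY by (simp add: mult_left_mono)
    finally show "expectation (\<lambda>\<omega>. \<bar>Y \<omega> - t (Y \<omega>)\<bar>) \<le> a powr (1 - p) * m" .
    have "expectation (\<lambda>\<omega>. (Y \<omega> - t (Y \<omega>))\<^sup>2) \<le> expectation (\<lambda>\<omega>. a powr (2 - p) * \<bar>Y \<omega>\<bar> powr p)"
      by (rule integral_mono) (use t3 iY r2 in auto)
    also have "\<dots> \<le> a powr (2 - p) * m" using mY by (simp add: mult_left_mono)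
    finally show "expectation (\<lambda>\<omega>. (Y \<omega> - t (Y \<omega>))\<^sup>2) \<le> \<kappa>" using \<kappa>2 by simp
  qed
  note ES = E[OF assms(1) iS mS iST(2)] and ET = E[OF assms(2) iT mT iST(3)]
  let ?S1 = "\<lambda>\<omega>. t (S \<omega>)" and ?S2 = "\<lambda>\<omega>. S \<omega> - t (S \<omega>)"
  let ?T1 = "\<lambda>\<omega>. t (T \<omega>)" and ?T2 = "\<lambda>\<omega>. T \<omega> - t (T \<omega>)"
  \<comment> \<open>With both variables split at the level \<open>a\<close>, the covariance
    \<open>cv S T\<close> is the sum of four covariances. The bounded pair costs
    \<open>4 * \<kappa>\<close> by mixing and each of the other three pairs
    \<open>2 * \<kappa>\<close>, which gives the constant 10.\<close>
  define cv where "cv f g = expectation (\<lambda>\<omega>. f \<omega> * g \<omega>) - expectation f * expectation g" for f g :: "'a \<Rightarrow> real"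
  have i11: "integrable M (\<lambda>\<omega>. ?S1 \<omega> * ?T1 \<omega>)"
    by (rule integrable_bounded_rv[where c="a * a"]) (use a in \<open>auto simp: abs_mult tb intro!: mult_mono\<close>)
  have i12: "integrable M (\<lambda>\<omega>. ?S1 \<omega> * ?T2 \<omega>)"
    by (rule Bochner_Integration.integrable_bound[OF integrable_mult_right[OF ET(4), of a]])
      (use a in \<open>auto intro!: AE_I2 mult_right_mono simp: abs_mult tb\<close>)
  have i21: "integrable M (\<lambda>\<omega>. ?S2 \<omega> * ?T1 \<omega>)"
    by (rule Bochner_Integration.integrable_bound[OF integrable_mult_right[OF ES(4), of a]])
      (use a in \<open>auto intro!: AE_I2 mult_right_mono simp: abs_mult tb mult.commute[of _ "\<bar>t _\<bar>"]\<close>)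
  have i22: "integrable M (\<lambda>\<omega>. ?S2 \<omega> * ?T2 \<omega>)"
    by (rule integrable_mult_of_squares) (use ES(3) ET(3) in auto)
  have "(\<lambda>\<omega>. S \<omega> * T \<omega>) = (\<lambda>\<omega>. ?S1 \<omega> * ?T1 \<omega> + ?S1 \<omega> * ?T2 \<omega> + ?S2 \<omega> * ?T1 \<omega> + ?S2 \<omega> * ?T2 \<omega>)"
    by (auto simp: algebra_simps)
  then have "expectation (\<lambda>\<omega>. S \<omega> * T \<omega>) = expectation (\<lambda>\<omega>. ?S1 \<omega> * ?T1 \<omega>) + expectation (\<lambda>\<omega>. ?S1 \<omega> * ?T2 \<omega>) + expectation (\<lambda>\<omega>. ?S2 \<omega> * ?T1 \<omega>) + expectation (\<lambda>\<omega>. ?S2 \<omega> * ?T2 \<omega>)"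
    using i11 i12 i21 i22 by (simp only: Bochner_Integration.integral_add Bochner_Integration.integrable_add)
  moreover have "expectation S = expectation ?S1 + expectation ?S2" "expectation T = expectation ?T1 + expectation ?T2"
    using ES(5) ET(5) iST by simp_all
  ultimately have sum: "cv S T = cv ?S1 ?T1 + cv ?S1 ?T2 + cv ?S2 ?T1 + cv ?S2 ?T2"
    unfolding cv_def by (simp only: algebra_simps)
  have c11: "\<bar>cv ?S1 ?T1\<bar> \<le> 4 * \<kappa>"
  proof -
    have "\<bar>cv ?S1 ?T1\<bar> \<le> 4 * \<beta> * a * a"
      unfolding cv_def
    proof (rule cov_bounded)
      fix A B :: "real set" assume AB: "A \<in> sets borel" "B \<in> sets borel"
      have "t -` A \<in> sets borel" "t -` B \<in> sets borel"
        using measurable_sets[OF t AB(1)] measurable_sets[OF t AB(2)] by auto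
      from mix[OF this] show "\<bar>prob {\<omega> \<in> space M. ?S1 \<omega> \<in> A \<and> ?T1 \<omega> \<in> B} - prob {\<omega> \<in> space M. ?S1 \<omega> \<in> A} * prob {\<omega> \<in> space M. ?T1 \<omega> \<in> B}\<bar> \<le> \<beta>"
        by simp
    qed (use a tb in auto)
    then show ?thesis by (simp add: \<kappa>_def power2_eq_square mult_ac)
  qed
  \<comment> \<open>One factor is bounded by \<open>a\<close> and the other is small in mean; the
    mean of the product and the product of the means are then each at most \<kappa>, by
    \<open>\<kappa>3\<close>.\<close>
  have half: "\<bar>cv f g\<bar> \<le> 2 * \<kappa>" if f: "\<And>\<omega>. \<bar>f \<omega>\<bar> \<le> a" and g: "expectation (\<lambda>\<omega>. \<bar>g \<omega>\<bar>) \<le> a powr (1 - p) * m"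
    and i: "integrable M f" "integrable M g" "integrable M (\<lambda>\<omega>. f \<omega> * g \<omega>)" for f g :: "'a \<Rightarrow> real"
  proof -
    have "\<bar>expectation (\<lambda>\<omega>. f \<omega> * g \<omega>)\<bar> \<le> expectation (\<lambda>\<omega>. \<bar>f \<omega> * g \<omega>\<bar>)" by (rule integral_abs_bound)
    also have "\<dots> \<le> expectation (\<lambda>\<omega>. a * \<bar>g \<omega>\<bar>)"
      by (rule integral_mono[OF integrable_abs[OF i(3)]])
        (use i f in \<open>auto simp: abs_mult intro: mult_right_mono\<close>)
    also have "\<dots> \<le> a * (a powr (1 - p) * m)" using g a by simp
    finally have 1: "\<bar>expectation (\<lambda>\<omega>. f \<omega> * g \<omega>)\<bar> \<le> \<kappa>" using \<kappa>3 by simp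
    have "\<bar>expectation f\<bar> \<le> expectation (\<lambda>\<omega>. \<bar>f \<omega>\<bar>)" by (rule integral_abs_bound)
    also have "\<dots> \<le> a" by (rule integral_le_const) (use i f in auto)
    finally have "\<bar>expectation f * expectation g\<bar> \<le> a * (a powr (1 - p) * m)"
      using order_trans[OF integral_abs_bound g] a by (auto simp: abs_mult intro!: mult_mono)
    then show ?thesis using 1 \<kappa>3 unfolding cv_def by linarith
  qed
  have c12: "\<bar>cv ?S1 ?T2\<bar> \<le> 2 * \<kappa>" by (rule half) (use tb ET ES i12 in auto)
  have "\<bar>cv ?T1 ?S2\<bar> \<le> 2 * \<kappa>" by (rule half) (use tb ET ES i21 in \<open>auto simp: mult.commute\<close>)
  then have c21: "\<bar>cv ?S2 ?T1\<bar> \<le> 2 * \<kappa>" unfolding cv_def by (simp add: mult.commute)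
  \<comment> \<open>Both tails have second moment at most \<kappa>. This bounds the mean of the
    product by the arithmetic-geometric inequality, and the product of the means because variances
    are nonnegative.\<close>
  have c22: "\<bar>cv ?S2 ?T2\<bar> \<le> 2 * \<kappa>"
  proof -
    have "\<bar>expectation (\<lambda>\<omega>. ?S2 \<omega> * ?T2 \<omega>)\<bar> \<le> expectation (\<lambda>\<omega>. \<bar>?S2 \<omega> * ?T2 \<omega>\<bar>)" by (rule integral_abs_bound)
    also have "\<dots> \<le> expectation (\<lambda>\<omega>. ((?S2 \<omega>)\<^sup>2 + (?T2 \<omega>)\<^sup>2) / 2)"
      by (rule integral_mono) (use i22 ES(3) ET(3) abs_mult_le_squares in auto)
    also have "\<dots> = (expectation (\<lambda>\<omega>. (?S2 \<omega>)\<^sup>2) + expectation (\<lambda>\<omega>. (?T2 \<omega>)\<^sup>2)) / 2"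
      using ES(3) ET(3) by simp
    also have "\<dots> \<le> \<kappa>" using ES(2) ET(2) by simp
    finally have 1: "\<bar>expectation (\<lambda>\<omega>. ?S2 \<omega> * ?T2 \<omega>)\<bar> \<le> \<kappa>" .
    have sq: "(expectation Y)\<^sup>2 \<le> expectation (\<lambda>\<omega>. (Y \<omega>)\<^sup>2)"
      if "integrable M Y" "integrable M (\<lambda>\<omega>. (Y \<omega>)\<^sup>2)" for Y :: "'a \<Rightarrow> real"
      using variance_eq[OF that] variance_positive[of Y] by simp
    have "\<bar>expectation ?S2 * expectation ?T2\<bar> \<le> ((expectation ?S2)\<^sup>2 + (expectation ?T2)\<^sup>2) / 2" by (rule abs_mult_le_squares)
    also have "\<dots> \<le> (\<kappa> + \<kappa>) / 2"
      by (intro divide_right_mono add_mono order_trans[OF sq[OF ES(4) ES(3)] ES(2)] order_trans[OF sq[OF ET(4) ET(3)] ET(2)]) simp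
    also have "\<dots> = \<kappa>" by simp
    finally show ?thesis using 1 unfolding cv_def by linarith
  qed
  have "\<bar>cv S T\<bar> \<le> 10 * \<kappa>" using sum c11 c12 c21 c22 by linarith
  then show ?thesis unfolding cv_def \<kappa>1 .
qed

end

section \<open>The central limit theorem under strong mixing\<close>

text \<open>A given distance from \<open>i\<close> is attained at most once to the right of
  \<open>i\<close>, with \<open>i\<close> included, and at most once to the left; on each side the
  map to distances is injective.\<close>

lemma sum_abs_diff_le_suminf:
  fixes b :: "nat \<Rightarrow> real"
  assumes "summable b" "\<And>n. 0 \<le> b n" "finite I"
  shows "(\<Sum>j\<in>I. b (nat \<bar>i - j\<bar>)) \<le> 2 * suminf b"
proof -
  have half: "(\<Sum>j\<in>J. b (nat \<bar>i - j\<bar>)) \<le> suminf b"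
    if "finite J" "inj_on (\<lambda>j. nat \<bar>i - j\<bar>) J" for J
  proof -
    have "(\<Sum>j\<in>J. b (nat \<bar>i - j\<bar>)) = sum b ((\<lambda>j. nat \<bar>i - j\<bar>) ` J)"
      using sum.reindex[OF that(2), of b] by (simp add: o_def)
    also have "\<dots> \<le> suminf b"
      using assms that by (intro sum_le_suminf) auto
    finally show ?thesis .
  qed
  have "(\<Sum>j\<in>I. b (nat \<bar>i - j\<bar>)) = (\<Sum>j\<in>I \<inter> {i..}. b (nat \<bar>i - j\<bar>)) + (\<Sum>j\<in>I - {i..}. b (nat \<bar>i - j\<bar>))"
    by (rule sum.Int_Diff[OF assms(3)])
  also have "\<dots> \<le> suminf b + suminf b"
    using assms(3) by (intro add_mono half) (auto simp: inj_on_def)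
  finally show ?thesis by simp
qed

lemma cesaro_mean_tendsto:
  fixes a :: "nat \<Rightarrow> real"
  assumes "a \<longlonglongrightarrow> l"
  shows "(\<lambda>n. (\<Sum>m<n. a m) / real n) \<longlonglongrightarrow> l"
proof (rule LIMSEQ_I)
  fix e :: real assume e: "e > 0"
  obtain N where N: "\<And>n. n \<ge> N \<Longrightarrow> \<bar>a n - l\<bar> < e / 2"
    using LIMSEQ_D[OF assms, of "e / 2"] e by (auto simp: real_norm_def)
  define C where "C = (\<Sum>m<N. \<bar>a m - l\<bar>)"
  obtain N2 :: nat where N2: "2 * C / e < real N2" using reals_Archimedean2 by blast
  show "\<exists>no. \<forall>n\<ge>no. norm ((\<Sum>m<n. a m) / real n - l) < e"
  proof (intro exI allI impI)
    fix n assume n: "n \<ge> Suc (max N N2)"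
    have "real n * e / 2 > C"
    proof -
      have "2 * C / e < real n" using N2 n by linarith
      then show ?thesis using e by (simp add: field_simps)
    qed
    have "(\<Sum>m<n. a m) / real n - l = (\<Sum>m<n. a m - l) / real n"
      using n by (simp add: sum_subtractf field_simps)
    also have "\<bar>\<dots>\<bar> = \<bar>\<Sum>m<n. a m - l\<bar> / real n" by simp
    also have "\<dots> \<le> (\<Sum>m<n. \<bar>a m - l\<bar>) / real n" by (intro divide_right_mono sum_abs) simp
    also have "(\<Sum>m<n. \<bar>a m - l\<bar>) = C + (\<Sum>m\<in>{N..<n}. \<bar>a m - l\<bar>)"
    proof -
      have "{..<n} = {..<N} \<union> {N..<n}" using n by auto
      then show ?thesis unfolding C_def by (simp add: sum.union_disjoint ivl_disj_int)
    qed
    also have "(\<Sum>m\<in>{N..<n}. \<bar>a m - l\<bar>) \<le> (\<Sum>m\<in>{N..<n}. e / 2)"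
      using N by (intro sum_mono) (auto intro: less_imp_le)
    also have "\<dots> \<le> real n * e / 2" using e by (simp add: mult_right_mono)
    finally have "\<bar>(\<Sum>m<n. a m) / real n - l\<bar> \<le> (C + real n * e / 2) / real n"
      using n by (simp add: divide_right_mono)
    also have "\<dots> < e" using \<open>real n * e / 2 > C\<close> n e by (simp add: field_simps)
    finally show "norm ((\<Sum>m<n. a m) / real n - l) < e" by simp
  qed
qed

text \<open>The convention \<open>\<beta> 0 = 1\<close> makes the mixing and covariance bounds valid at lag \<open>0\<close> too.\<close>

locale mixing_space = stationary_space +
  fixes \<beta> :: "nat \<Rightarrow> real" and p :: real
  assumes p: "p > 2"
    and \<beta>_pos: "\<And>t. 0 < \<beta> t" and \<beta>_le_1: "\<And>t. \<beta> t \<le> 1" and \<beta>_0: "\<beta> 0 = 1"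
    and \<beta>_anti: "\<And>s t. s \<le> t \<Longrightarrow> \<beta> t \<le> \<beta> s"
    and \<beta>_mix: "\<And>t. t \<ge> 1 \<Longrightarrow> alpha_mixing M X t \<le> \<beta> t"
    and \<beta>_summable: "summable (\<lambda>j. \<beta> j powr (1 - 2 / p))"
begin

lemma mixing_le:
  assumes S: "S \<in> borel_measurable (generated_sigma M X {..k})"
    and T: "T \<in> borel_measurable (generated_sigma M X {k + int t..})"
    and A: "A \<in> sets borel" and B: "B \<in> sets borel"
  shows "\<bar>prob {\<omega> \<in> space M. S \<omega> \<in> A \<and> T \<omega> \<in> B} - prob {\<omega> \<in> space M. S \<omega> \<in> A} * prob {\<omega> \<in> space M. T \<omega> \<in> B}\<bar> \<le> \<beta> t"
proof (cases "t = 0")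
  case True
  then show ?thesis using prob_prod_diff_le_1 \<beta>_0 by simp
next
  case False
  have "{\<omega> \<in> space M. S \<omega> \<in> A} \<in> sets (generated_sigma M X {..k})"
    using measurable_sets[OF S A] by (simp add: vimage_def Int_def conj_commute)
  moreover have "{\<omega> \<in> space M. T \<omega> \<in> B} \<in> sets (generated_sigma M X {k + int t..})"
    using measurable_sets[OF T B] by (simp add: vimage_def Int_def conj_commute)
  moreover have "{\<omega> \<in> space M. S \<omega> \<in> A \<and> T \<omega> \<in> B} = {\<omega> \<in> space M. S \<omega> \<in> A} \<inter> {\<omega> \<in> space M. T \<omega> \<in> B}"
    by auto
  ultimately have "\<bar>prob {\<omega> \<in> space M. S \<omega> \<in> A \<and> T \<omega> \<in> B} - prob {\<omega> \<in> space M. S \<omega> \<in> A} * prob {\<omega> \<in> space M. T \<omega> \<in> B}\<bar> \<le> alpha_mixing M X t"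
    using alpha_mixing_events[of "{\<omega> \<in> space M. S \<omega> \<in> A}" k "{\<omega> \<in> space M. T \<omega> \<in> B}" t] by presburger
  also have "\<dots> \<le> \<beta> t" using \<beta>_mix[of t] False by simp
  finally show ?thesis .
qed

definition rate_sum :: real where "rate_sum = (\<Sum>j. \<beta> j powr (1 - 2 / p))"

lemma rate_sum_nonneg: "0 \<le> rate_sum"
  unfolding rate_sum_def by (rule suminf_nonneg[OF \<beta>_summable]) simp

text \<open>The covariance estimates are applied to three functions of the process: the identity,
  its truncation and the remainder of the truncation. The number \<open>m\<close> is a positive
  bound, not the moment itself, because the truncation level in Davydov's inequality is computed
  from it and must be positive.\<close>

definition moment_le :: "(real \<Rightarrow> real) \<Rightarrow> real \<Rightarrow> bool" where
  "moment_le f m \<longleftrightarrow> f \<in> borel_measurable borel \<and> 0 < m \<and>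
     integrable M (\<lambda>\<omega>. \<bar>f (X 0 \<omega>)\<bar> powr p) \<and> expectation (\<lambda>\<omega>. \<bar>f (X 0 \<omega>)\<bar> powr p) \<le> m"

definition centred :: "(real \<Rightarrow> real) \<Rightarrow> int \<Rightarrow> 'a \<Rightarrow> real" where
  "centred f i \<omega> = f (X i \<omega>) - expectation (\<lambda>\<omega>. f (X 0 \<omega>))"

definition autocov :: "(real \<Rightarrow> real) \<Rightarrow> nat \<Rightarrow> real" where
  "autocov f j = expectation (\<lambda>\<omega>. centred f 0 \<omega> * centred f (int j) \<omega>)"

text \<open>The limit of the variance of partial sums divided by their length. For the identity it
  is the two-sided covariance series \<open>v\<close> of the theorem, folded by the symmetry of the
  covariances.\<close>

definition long_run_var :: "(real \<Rightarrow> real) \<Rightarrow> real" where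
  "long_run_var f = autocov f 0 + 2 * (\<Sum>j. autocov f (Suc j))"

lemma measurable_fun_path:
  "f \<in> borel_measurable borel \<Longrightarrow> (\<lambda>x. f (x i)) \<in> borel_measurable (\<Pi>\<^sub>M i\<in>(UNIV::int set). (borel :: real measure))"
  by (rule measurable_compose[OF measurable_component_singleton]) auto

context
  fixes f m assumes mom: "moment_le f m"
begin

lemma f_meas [measurable]: "f \<in> borel_measurable borel" and m_pos: "0 < m"
  using mom by (auto simp: moment_le_def)

lemma powr_moment:
  "integrable M (\<lambda>\<omega>. \<bar>f (X i \<omega>)\<bar> powr p)" "expectation (\<lambda>\<omega>. \<bar>f (X i \<omega>)\<bar> powr p) \<le> m"
proof -
  have [measurable]: "(\<lambda>x. \<bar>f (x 0)\<bar> powr p) \<in> borel_measurable (\<Pi>\<^sub>M i\<in>(UNIV::int set). (borel :: real measure))"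
    by measurable
  show "integrable M (\<lambda>\<omega>. \<bar>f (X i \<omega>)\<bar> powr p)" "expectation (\<lambda>\<omega>. \<bar>f (X i \<omega>)\<bar> powr p) \<le> m"
    using shift_integrable[of "\<lambda>x. \<bar>f (x 0)\<bar> powr p" i] shift_expectation[of "\<lambda>x. \<bar>f (x 0)\<bar> powr p" i] mom
    by (auto simp: moment_le_def)
qed

lemma integrable_f_square: "integrable M (\<lambda>\<omega>. (f (X i \<omega>))\<^sup>2)"
proof (rule Bochner_Integration.integrable_bound[where f="\<lambda>\<omega>. 1 + \<bar>f (X i \<omega>)\<bar> powr p"])
  show "AE \<omega> in M. norm ((f (X i \<omega>))\<^sup>2) \<le> norm (1 + \<bar>f (X i \<omega>)\<bar> powr p)"
  proof (rule AE_I2)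
    fix \<omega>
    let ?y = "\<bar>f (X i \<omega>)\<bar>"
    have "?y\<^sup>2 \<le> 1 + ?y powr p"
    proof (cases "?y \<le> 1")
      case True then show ?thesis using power_le_one[of ?y 2] by (simp add: add_increasing2)
    next
      case False
      then have "?y powr 2 \<le> ?y powr p" using p by (intro powr_mono) auto
      then show ?thesis using False by simp
    qed
    then show "norm ((f (X i \<omega>))\<^sup>2) \<le> norm (1 + \<bar>f (X i \<omega>)\<bar> powr p)" by simp
  qed
qed (use powr_moment in auto)

lemma integrable_f: "integrable M (\<lambda>\<omega>. f (X i \<omega>))"
  by (rule square_integrable_imp_integrable[OF _ integrable_f_square]) simp

lemma expectation_f: "expectation (\<lambda>\<omega>. f (X i \<omega>)) = expectation (\<lambda>\<omega>. f (X 0 \<omega>))"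
  using shift_expectation[OF measurable_fun_path[OF f_meas, of 0], of i] by simp

lemma centred_meas [measurable]: "centred f i \<in> borel_measurable M"
  unfolding centred_def by measurable

lemma centred_meas_generated: "i \<in> I \<Longrightarrow> centred f i \<in> borel_measurable (generated_sigma M X I)"
  unfolding centred_def
  by (intro borel_measurable_diff measurable_compose[OF measurable_generated_sigma f_meas]) auto

lemma integrable_centred_prod:
  "integrable M (centred f i)" "expectation (centred f i) = 0"
  "integrable M (\<lambda>\<omega>. centred f i \<omega> * centred f j \<omega>)"
proof -
  show 1: "integrable M (centred f i)" for i unfolding centred_def using integrable_f by simp
  show "expectation (centred f i) = 0"
    unfolding centred_def using integrable_f expectation_f[of i] by (simp add: prob_space)
  have 2: "integrable M (\<lambda>\<omega>. (centred f i \<omega>)\<^sup>2)" for i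
    unfolding centred_def power2_diff using integrable_f integrable_f_square by auto
  show "integrable M (\<lambda>\<omega>. centred f i \<omega> * centred f j \<omega>)"
    by (rule integrable_mult_of_squares[OF centred_meas centred_meas 2 2])
qed

text \<open>Mixing compares a past with a future, so the earlier index has to come first; the
  general case follows by symmetry. Centring leaves the covariance unchanged, so Davydov's
  inequality is applied to the uncentred variables, whose moment bound is \<open>m\<close>.\<close>

lemma cov_centred_le_ordered:
  assumes "i \<le> j"
  shows "\<bar>expectation (\<lambda>\<omega>. centred f i \<omega> * centred f j \<omega>)\<bar> \<le> 10 * m powr (2 / p) * \<beta> (nat \<bar>i - j\<bar>) powr (1 - 2 / p)"
proof -
  have "\<bar>expectation (\<lambda>\<omega>. f (X i \<omega>) * f (X j \<omega>)) - expectation (\<lambda>\<omega>. f (X i \<omega>)) * expectation (\<lambda>\<omega>. f (X j \<omega>))\<bar>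
      \<le> 10 * (\<beta> (nat \<bar>i - j\<bar>) powr (1 - 2 / p) * m powr (2 / p))"
  proof (rule davydov)
    show "\<bar>prob {\<omega> \<in> space M. f (X i \<omega>) \<in> A \<and> f (X j \<omega>) \<in> B} - prob {\<omega> \<in> space M. f (X i \<omega>) \<in> A} * prob {\<omega> \<in> space M. f (X j \<omega>) \<in> B}\<bar> \<le> \<beta> (nat \<bar>i - j\<bar>)"
      if "A \<in> sets borel" "B \<in> sets borel" for A B
      by (rule mixing_le[of _ i])
        (use assms that in \<open>auto intro!: measurable_compose[OF measurable_generated_sigma f_meas]\<close>)
    have eq: "(\<lambda>\<omega>. f (X i \<omega>) * f (X j \<omega>)) = (\<lambda>\<omega>. centred f i \<omega> * centred f j \<omega> + expectation (\<lambda>\<omega>. f (X 0 \<omega>)) * f (X i \<omega>)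
        + expectation (\<lambda>\<omega>. f (X 0 \<omega>)) * f (X j \<omega>) - expectation (\<lambda>\<omega>. f (X 0 \<omega>)) * expectation (\<lambda>\<omega>. f (X 0 \<omega>)))"
      by (auto simp: centred_def algebra_simps)
    show "integrable M (\<lambda>\<omega>. f (X i \<omega>) * f (X j \<omega>))"
      unfolding eq using integrable_centred_prod integrable_f by auto
  qed (use \<beta>_pos p m_pos powr_moment integrable_f in auto)
  also have "expectation (\<lambda>\<omega>. f (X i \<omega>) * f (X j \<omega>)) - expectation (\<lambda>\<omega>. f (X i \<omega>)) * expectation (\<lambda>\<omega>. f (X j \<omega>))
     = expectation (\<lambda>\<omega>. centred f i \<omega> * centred f j \<omega>)"
  proof -
    define c where "c = expectation (\<lambda>\<omega>. f (X 0 \<omega>))"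
    have "expectation (\<lambda>\<omega>. f (X i \<omega>) * f (X j \<omega>)) = expectation (\<lambda>\<omega>. centred f i \<omega> * centred f j \<omega> + c * f (X i \<omega>) + c * f (X j \<omega>) - c * c)"
      by (rule Bochner_Integration.integral_cong) (auto simp: centred_def c_def algebra_simps)
    also have "\<dots> = expectation (\<lambda>\<omega>. centred f i \<omega> * centred f j \<omega>) + c * expectation (\<lambda>\<omega>. f (X i \<omega>)) + c * expectation (\<lambda>\<omega>. f (X j \<omega>)) - c * c"
      using integrable_centred_prod integrable_f by (simp add: prob_space)
    finally show ?thesis using expectation_f[of i] expectation_f[of j] by (simp add: c_def)
  qed
  finally show ?thesis by (simp add: mult_ac)
qed

lemma cov_centred_le:
  "\<bar>expectation (\<lambda>\<omega>. centred f i \<omega> * centred f j \<omega>)\<bar> \<le> 10 * m powr (2 / p) * \<beta> (nat \<bar>i - j\<bar>) powr (1 - 2 / p)"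
  using cov_centred_le_ordered[of i j] cov_centred_le_ordered[of j i]
  by (cases "i \<le> j") (auto simp: mult.commute abs_minus_commute)

lemma integrable_sum_square:
  assumes "finite I"
  shows "integrable M (\<lambda>\<omega>. (\<Sum>i\<in>I. centred f i \<omega>)\<^sup>2)"
    and "expectation (\<lambda>\<omega>. (\<Sum>i\<in>I. centred f i \<omega>)\<^sup>2) = (\<Sum>i\<in>I. \<Sum>j\<in>I. expectation (\<lambda>\<omega>. centred f i \<omega> * centred f j \<omega>))"
  unfolding power2_eq_square sum_product
  using integrable_centred_prod
  by (simp_all only: Bochner_Integration.integral_sum Bochner_Integration.integrable_sum)

text \<open>Growth is linear in \<open>card I\<close> for arbitrary finite \<open>I\<close>, which
  covers index sets with holes such as the gaps between blocks. Each row of the covariance matrix is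
  summed over both sides of the diagonal, so the constant 20 is twice the 10 of Davydov's
  inequality.\<close>

lemma sum_second_moment_le:
  assumes "finite I"
  shows "expectation (\<lambda>\<omega>. (\<Sum>i\<in>I. centred f i \<omega>)\<^sup>2) \<le> 20 * m powr (2 / p) * rate_sum * real (card I)"
proof -
  have inner: "(\<Sum>j\<in>I. 10 * m powr (2 / p) * \<beta> (nat \<bar>i - j\<bar>) powr (1 - 2 / p)) \<le> 10 * m powr (2 / p) * (2 * rate_sum)" for i
    unfolding sum_distrib_left[symmetric] rate_sum_def
    by (intro mult_left_mono sum_abs_diff_le_suminf[where b="\<lambda>j. \<beta> j powr (1 - 2 / p)"] \<beta>_summable assms) auto
  have "expectation (\<lambda>\<omega>. (\<Sum>i\<in>I. centred f i \<omega>)\<^sup>2)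
     \<le> (\<Sum>i\<in>I. \<Sum>j\<in>I. 10 * m powr (2 / p) * \<beta> (nat \<bar>i - j\<bar>) powr (1 - 2 / p))"
    unfolding integrable_sum_square(2)[OF assms]
    by (intro sum_mono order_trans[OF abs_ge_self cov_centred_le])
  also have "\<dots> \<le> (\<Sum>i\<in>I. 10 * m powr (2 / p) * (2 * rate_sum))"
    by (intro sum_mono inner)
  finally show ?thesis by (simp add: mult_ac)
qed

lemma expectation_shift_sum:
  fixes g :: "real \<Rightarrow> 'b :: {banach, second_countable_topology}"
  assumes [measurable]: "g \<in> borel_measurable borel"
  shows "expectation (\<lambda>\<omega>. g (\<Sum>i\<in>I. centred f (i + k) \<omega>)) = expectation (\<lambda>\<omega>. g (\<Sum>i\<in>I. centred f i \<omega>))"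
proof -
  let ?c = "expectation (\<lambda>\<omega>. f (X 0 \<omega>))"
  have "(\<lambda>x. g (\<Sum>i\<in>I. f (x i) - ?c)) \<in> borel_measurable (\<Pi>\<^sub>M i\<in>(UNIV::int set). (borel :: real measure))"
    by measurable
  from shift_expectation[OF this, of k] show ?thesis by (simp add: centred_def)
qed

lemma cov_centred_shift:
  "expectation (\<lambda>\<omega>. centred f (i + k) \<omega> * centred f (j + k) \<omega>) = expectation (\<lambda>\<omega>. centred f i \<omega> * centred f j \<omega>)"
proof -
  let ?c = "expectation (\<lambda>\<omega>. f (X 0 \<omega>))"
  have "(\<lambda>x. (f (x i) - ?c) * (f (x j) - ?c)) \<in> borel_measurable (\<Pi>\<^sub>M i\<in>(UNIV::int set). (borel :: real measure))"
    by measurable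
  from shift_expectation[OF this, of k] show ?thesis by (simp add: centred_def)
qed

lemma autocov_le: "\<bar>autocov f j\<bar> \<le> 10 * m powr (2 / p) * \<beta> j powr (1 - 2 / p)"
  using cov_centred_le[of 0 "int j"] by (simp add: autocov_def)

lemma summable_autocov: "summable (\<lambda>j. \<bar>autocov f (Suc j)\<bar>)"
proof (rule summable_comparison_test'[where N=0 and g="\<lambda>j. 10 * m powr (2 / p) * \<beta> (Suc j) powr (1 - 2 / p)"])
  show "summable (\<lambda>j. 10 * m powr (2 / p) * \<beta> (Suc j) powr (1 - 2 / p))"
    by (intro summable_mult iffD2[OF summable_Suc_iff[of "\<lambda>j. \<beta> j powr (1 - 2 / p)"] \<beta>_summable])
qed (use autocov_le in auto)

text \<open>The new index contributes its own variance and, twice, its covariances with the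
  \<open>n\<close> earlier indices, whose lags are \<open>1, ..., n\<close>. The increment is thus a
  partial sum of \<open>long_run_var\<close>, and the growth rate of the variance becomes a Cesaro
  limit.\<close>

lemma var_sum_Suc:
  "expectation (\<lambda>\<omega>. (\<Sum>i\<in>{1..int (Suc n)}. centred f i \<omega>)\<^sup>2) =
   expectation (\<lambda>\<omega>. (\<Sum>i\<in>{1..int n}. centred f i \<omega>)\<^sup>2) + (autocov f 0 + 2 * (\<Sum>j<n. autocov f (Suc j)))"
proof -
  let ?r = "\<lambda>i j. expectation (\<lambda>\<omega>. centred f i \<omega> * centred f j \<omega>)"
  have sym: "?r i j = ?r j i" for i j by (simp add: mult.commute)
  have I: "{1..int (Suc n)} = insert (int (Suc n)) {1..int n}" by auto
  have a: "?r i (i + int j) = autocov f j" for i j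
    using cov_centred_shift[of 0 i "int j"] unfolding autocov_def add_0 add.commute[of i] by simp
  \<comment> \<open>The index \<open>i\<close> has lag \<open>n + 1 - i\<close> from the new one,
    that is \<open>Suc (n - nat i)\<close>; this is the reindexing.\<close>
  have off: "(\<Sum>i\<in>{1..int n}. ?r i (int (Suc n))) = (\<Sum>j<n. autocov f (Suc j))"
  proof (rule sum.reindex_bij_witness[of _ "\<lambda>j. int (n - j)" "\<lambda>i. n - nat i"])
    fix i assume i: "i \<in> {1..int n}"
    then have "int (Suc n) = i + int (Suc (n - nat i))" by auto
    then show "autocov f (Suc (n - nat i)) = ?r i (int (Suc n))" by (simp only: a)
  qed auto
  have diag: "?r (int (Suc n)) (int (Suc n)) = autocov f 0" using a[of "int (Suc n)" 0] by simp
  have nI: "int (Suc n) \<notin> {1..int n}" by simp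
  have split: "(\<Sum>i\<in>insert x J. \<Sum>j\<in>insert x J. ?r i j) = (\<Sum>i\<in>J. \<Sum>j\<in>J. ?r i j) + (?r x x + 2 * (\<Sum>i\<in>J. ?r i x))"
    if "finite J" "x \<notin> J" for J x
  proof -
    have "(\<Sum>j\<in>J. ?r x j) = (\<Sum>i\<in>J. ?r i x)" by (rule sum.cong[OF refl sym])
    then show ?thesis unfolding sum.insert[OF that] sum.distrib by linarith
  qed
  show ?thesis
    unfolding I integrable_sum_square(2)[OF finite_atLeastAtMost_int]
      integrable_sum_square(2)[OF finite.insertI[OF finite_atLeastAtMost_int]]
      split[OF finite_atLeastAtMost_int nI] off diag ..
qed

lemma var_sum_asymptotics:
  "(\<lambda>n. expectation (\<lambda>\<omega>. (\<Sum>i\<in>{1..int n}. centred f i \<omega>)\<^sup>2) / real n) \<longlonglongrightarrow> long_run_var f"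
proof -
  have "expectation (\<lambda>\<omega>. (\<Sum>i\<in>{1..int n}. centred f i \<omega>)\<^sup>2) = (\<Sum>k<n. autocov f 0 + 2 * (\<Sum>j<k. autocov f (Suc j)))" for n
  proof (induction n)
    case (Suc n)
    then show ?case using var_sum_Suc[of n] by simp
  qed simp
  moreover have "(\<lambda>k. autocov f 0 + 2 * (\<Sum>j<k. autocov f (Suc j))) \<longlonglongrightarrow> long_run_var f"
    unfolding long_run_var_def
    using summable_LIMSEQ[OF summable_rabs_cancel[OF summable_autocov]]
    by (intro tendsto_intros)
  ultimately show ?thesis using cesaro_mean_tendsto by simp
qed

lemma long_run_var_nonneg: "0 \<le> long_run_var f"
  by (rule LIMSEQ_le_const[OF var_sum_asymptotics]) (auto intro!: exI[of _ 0] divide_nonneg_nonneg integral_nonneg_AE)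

text \<open>Identifies the series in the second hypothesis of the theorem. The integers split into
  positive lags, negative lags and 0; shifting by the lag turns a negative lag into a positive
  one.\<close>

lemma infsum_autocov:
  "(\<Sum>\<^sub>\<infinity>j\<in>(UNIV :: int set). expectation (\<lambda>\<omega>. centred f 0 \<omega> * centred f j \<omega>)) = long_run_var f"
proof -
  let ?r = "\<lambda>j. expectation (\<lambda>\<omega>. centred f 0 \<omega> * centred f j \<omega>)"
  define s where "s = (\<Sum>j. autocov f (Suc j))"
  have s: "((\<lambda>j. autocov f (Suc j)) has_sum s) UNIV"
    unfolding s_def by (rule norm_summable_imp_has_sum)
      (use summable_autocov summable_sums[OF summable_rabs_cancel[OF summable_autocov]] in auto)
  have neg: "?r (- int (Suc j)) = autocov f (Suc j)" for j
    using cov_centred_shift[of "int (Suc j)" "- int (Suc j)" 0] by (simp add: autocov_def mult.commute)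
  have "(?r has_sum s) ((\<lambda>j. int (Suc j)) ` UNIV)"
    by (subst has_sum_reindex) (use s in \<open>auto simp: inj_on_def o_def autocov_def\<close>)
  moreover have "(?r has_sum s) ((\<lambda>j. - int (Suc j)) ` UNIV)"
    by (subst has_sum_reindex) (use s neg in \<open>auto simp: inj_on_def o_def\<close>)
  ultimately have "(?r has_sum (s + s)) ((\<lambda>j. int (Suc j)) ` UNIV \<union> (\<lambda>j. - int (Suc j)) ` UNIV)"
    by (rule has_sum_Un_disjoint) auto
  moreover have "(?r has_sum autocov f 0) {0}"
    using has_sum_finite[of "{0::int}" ?r] by (simp add: autocov_def)
  ultimately have "(?r has_sum (s + s + autocov f 0)) ((\<lambda>j. int (Suc j)) ` UNIV \<union> (\<lambda>j. - int (Suc j)) ` UNIV \<union> {0})"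
    by (rule has_sum_Un_disjoint) auto
  moreover have "(\<lambda>j. int (Suc j)) ` UNIV \<union> (\<lambda>j. - int (Suc j)) ` UNIV \<union> {0} = (UNIV :: int set)"
  proof (intro equalityI subsetI)
    fix x :: int
    consider "x = 0" | "x = int (Suc (nat (x - 1)))" | "x = - int (Suc (nat (- x - 1)))" by linarith
    then show "x \<in> (\<lambda>j. int (Suc j)) ` UNIV \<union> (\<lambda>j. - int (Suc j)) ` UNIV \<union> {0}" by cases blast+
  qed simp
  ultimately show ?thesis unfolding long_run_var_def s_def[symmetric] by (simp add: infsumI)
qed

end

end

section \<open>Tools for Bernstein's block method\<close>

lemma cmod_iexp_diff_le: "cmod (iexp x - iexp y) \<le> \<bar>x - y\<bar>"
proof -
  have "iexp x - iexp y = iexp y * (iexp (x - y) - 1)"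
    by (simp add: algebra_simps flip: exp_add)
  also have "cmod \<dots> = cmod (iexp (x - y) - 1)" by (simp add: norm_mult)
  also have "\<dots> \<le> \<bar>x - y\<bar>" using iexp_approx1[of "x - y" 0] by simp
  finally show ?thesis .
qed

lemma abs_power3: "\<bar>x\<bar> ^ 3 = x\<^sup>2 * \<bar>x\<bar>" for x :: real
  unfolding power2_abs[of x, symmetric] by (simp only: power3_eq_cube power2_eq_square)

text \<open>A cycle has length \<open>a + b\<close>: the \<open>j\<close>-th block consists of its
  first \<open>a\<close> indices, and the remaining \<open>b\<close> indices are the gap that
  separates it from the next block.\<close>

definition block :: "nat \<Rightarrow> nat \<Rightarrow> nat \<Rightarrow> int set" where
  "block a b j = (\<lambda>i. i + int (j * (a + b))) ` {1..int a}"

lemma exp_neg_linear_approx: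
  fixes s :: real
  assumes "0 \<le> s"
  shows "\<bar>exp (- s) - (1 - s)\<bar> \<le> s\<^sup>2"
proof -
  have "exp (- s) \<le> 1 / (1 + s)"
    using exp_ge_add_one_self[of s] assms by (simp add: exp_minus field_simps)
  also have "1 / (1 + s) \<le> 1 - s + s\<^sup>2"
  proof -
    have "(1 - s + s\<^sup>2) * (1 + s) = 1 + s ^ 3" by (simp add: power2_eq_square power3_eq_cube algebra_simps)
    then have "1 \<le> (1 - s + s\<^sup>2) * (1 + s)" using assms by simp
    then show ?thesis using assms by (subst pos_divide_le_eq) auto
  qed
  finally show ?thesis using exp_ge_add_one_self[of "- s"] by (simp add: abs_le_iff)
qed

lemma exp_neg_diff_le:
  fixes x y :: real
  assumes "0 \<le> x" "0 \<le> y"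
  shows "\<bar>exp (- x) - exp (- y)\<bar> \<le> \<bar>x - y\<bar>"
proof -
  have *: "exp (- x) - exp (- y) \<le> y - x" if "0 \<le> x" "x \<le> y" for x y :: real
  proof -
    have "exp (- x) - exp (- y) = exp (- x) * (1 - exp (- (y - x)))" by (simp add: algebra_simps flip: exp_add)
    also have "1 - exp (- (y - x)) \<le> y - x"
      using exp_ge_add_one_self[of "- (y - x)"] by linarith
    then have "exp (- x) * (1 - exp (- (y - x))) \<le> 1 * (y - x)"
      using that by (intro mult_mono) auto
    finally show ?thesis by simp
  qed
  show ?thesis using *[of x y] *[of y x] assms by (cases "x \<le> y") (auto simp: abs_if)
qed

text \<open>The terms with indices in \<open>{n div 2..<n}\<close> number at least
  \<open>n / 2\<close> and each is at least \<open>b n\<close>. Their sum is a difference of two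
  partial sums that converge to the same limit.\<close>

lemma decseq_summable_mult_tendsto_0:
  fixes b :: "nat \<Rightarrow> real"
  assumes anti: "\<And>s t. s \<le> t \<Longrightarrow> b t \<le> b s" and b: "\<And>n. 0 \<le> b n" "summable b"
  shows "(\<lambda>n. real n * b n) \<longlonglongrightarrow> 0"
proof (rule tendsto_sandwich[where f="\<lambda>_. 0" and h="\<lambda>n. 2 * ((\<Sum>k<n. b k) - (\<Sum>k<n div 2. b k))"])
  have "filterlim (\<lambda>n::nat. n div 2) at_top sequentially"
    unfolding filterlim_at_top
  proof
    fix Z :: nat
    show "\<forall>\<^sub>F n in sequentially. Z \<le> n div 2"
      using eventually_ge_at_top[of "2 * Z"] by eventually_elim auto
  qed
  from filterlim_compose[OF summable_LIMSEQ[OF b(2)] this]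
  have "(\<lambda>n. 2 * ((\<Sum>k<n. b k) - (\<Sum>k<n div 2. b k))) \<longlonglongrightarrow> 2 * (suminf b - suminf b)"
    by (intro tendsto_intros summable_LIMSEQ b)
  then show "(\<lambda>n. 2 * ((\<Sum>k<n. b k) - (\<Sum>k<n div 2. b k))) \<longlonglongrightarrow> 0" by simp
  show "\<forall>\<^sub>F n in sequentially. real n * b n \<le> 2 * ((\<Sum>k<n. b k) - (\<Sum>k<n div 2. b k))"
  proof (rule always_eventually, rule allI)
    fix n :: nat
    have "(\<Sum>k<n. b k) - (\<Sum>k<n div 2. b k) = (\<Sum>k\<in>{n div 2..<n}. b k)"
      using sum.atLeastLessThan_concat[of 0 "n div 2" n b] unfolding atLeast0LessThan by simp
    also have "\<dots> \<ge> (\<Sum>k\<in>{n div 2..<n}. b n)" by (intro sum_mono anti) auto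
    also have "(\<Sum>k\<in>{n div 2..<n}. b n) = real (n - n div 2) * b n" by simp
    finally have "real (n - n div 2) * b n \<le> (\<Sum>k<n. b k) - (\<Sum>k<n div 2. b k)" .
    moreover have "real n / 2 * b n \<le> real (n - n div 2) * b n"
      by (intro mult_right_mono b) linarith
    ultimately show "real n * b n \<le> 2 * ((\<Sum>k<n. b k) - (\<Sum>k<n div 2. b k))" by simp
  qed
qed (use b in auto)

lemma ceiling_scale_tendsto:
  fixes c :: real
  assumes "c > 0"
  shows "(\<lambda>n. real (nat \<lceil>c * sqrt (real n)\<rceil>) / sqrt (real n)) \<longlonglongrightarrow> c"
proof (rule tendsto_sandwich[where f="\<lambda>_. c" and h="\<lambda>n. c + 1 / sqrt (real n)"])
  have nn: "real (nat \<lceil>c * sqrt (real n)\<rceil>) = of_int \<lceil>c * sqrt (real n)\<rceil>" for n :: nat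
  proof -
    have "- 1 < c * sqrt (real n)" using assms by (simp add: less_le_trans[of "- 1" 0])
    then show ?thesis by simp
  qed
  show "\<forall>\<^sub>F n in sequentially. c \<le> real (nat \<lceil>c * sqrt (real n)\<rceil>) / sqrt (real n)"
    using eventually_gt_at_top[of 0]
    by eventually_elim (simp add: nn le_divide_eq)
  show "\<forall>\<^sub>F n in sequentially. real (nat \<lceil>c * sqrt (real n)\<rceil>) / sqrt (real n) \<le> c + 1 / sqrt (real n)"
    using eventually_gt_at_top[of 0]
  proof eventually_elim
    case (elim n)
    have "of_int \<lceil>c * sqrt (real n)\<rceil> \<le> c * sqrt (real n) + 1" by linarith
    then show ?case using elim by (simp add: nn divide_le_eq algebra_simps)
  qed
  have "(\<lambda>n. c + 1 / sqrt (real n)) \<longlonglongrightarrow> c + 0"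
    by (intro tendsto_intros tendsto_divide_0[OF tendsto_const] filterlim_at_top_imp_at_infinity
      filterlim_compose[OF sqrt_at_top] filterlim_real_sequentially)
  then show "(\<lambda>n. c + 1 / sqrt (real n)) \<longlonglongrightarrow> c" by simp
qed simp

lemma ceiling_scale_at_top:
  fixes c :: real
  assumes "c > 0"
  shows "filterlim (\<lambda>n. nat \<lceil>c * sqrt (real n)\<rceil>) at_top sequentially"
proof -
  have s: "filterlim (\<lambda>n. c * sqrt (real n)) at_top sequentially"
    by (intro filterlim_tendsto_pos_mult_at_top[OF tendsto_const assms]
      filterlim_compose[OF sqrt_at_top] filterlim_real_sequentially)
  show ?thesis
    unfolding filterlim_at_top
  proof
    fix Z :: nat
    have "\<forall>\<^sub>F n in sequentially. real Z \<le> c * sqrt (real n)"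
      using s unfolding filterlim_at_top by blast
    then show "\<forall>\<^sub>F n in sequentially. Z \<le> nat \<lceil>c * sqrt (real n)\<rceil>"
      by eventually_elim linarith
  qed
qed

context prob_space
begin

lemma expectation_iexp_eq:
  assumes [measurable]: "S \<in> borel_measurable M"
  shows "expectation (\<lambda>\<omega>. iexp (S \<omega>)) = Complex (expectation (\<lambda>\<omega>. cos (S \<omega>))) (expectation (\<lambda>\<omega>. sin (S \<omega>)))"
proof -
  have i: "integrable M (\<lambda>\<omega>. iexp (S \<omega>))"
    by (rule integrable_bounded_rv[where c=1]) auto
  show ?thesis
    using integral_Re[OF i] integral_Im[OF i] by (simp add: complex_eq_iff Re_exp Im_exp)
qed

lemma cmod_expectation_iexp_le_1:
  "S \<in> borel_measurable M \<Longrightarrow> cmod (expectation (\<lambda>\<omega>. iexp (S \<omega>))) \<le> 1"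
  by (rule order_trans[OF integral_norm_bound]) (simp add: prob_space)

text \<open>The map \<open>iexp\<close> is 1-Lipschitz on the reals, and the first absolute moment
  is at most the root of the second.\<close>

lemma iexp_diff_expectation_le:
  assumes [measurable]: "S \<in> borel_measurable M" "T \<in> borel_measurable M"
    and i: "integrable M (\<lambda>\<omega>. (S \<omega> - T \<omega>)\<^sup>2)"
  shows "cmod (expectation (\<lambda>\<omega>. iexp (S \<omega>)) - expectation (\<lambda>\<omega>. iexp (T \<omega>))) \<le> sqrt (expectation (\<lambda>\<omega>. (S \<omega> - T \<omega>)\<^sup>2))"
proof -
  have [simp]: "integrable M (\<lambda>\<omega>. iexp (S \<omega>))" "integrable M (\<lambda>\<omega>. iexp (T \<omega>))"
    by (auto intro!: integrable_bounded_rv[where c=1])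
  have i1: "integrable M (\<lambda>\<omega>. S \<omega> - T \<omega>)"
    by (rule square_integrable_imp_integrable[OF _ i]) simp
  have "cmod (expectation (\<lambda>\<omega>. iexp (S \<omega>)) - expectation (\<lambda>\<omega>. iexp (T \<omega>))) = cmod (expectation (\<lambda>\<omega>. iexp (S \<omega>) - iexp (T \<omega>)))"
    by simp
  also have "\<dots> \<le> expectation (\<lambda>\<omega>. cmod (iexp (S \<omega>) - iexp (T \<omega>)))" by (rule integral_norm_bound)
  also have "\<dots> \<le> expectation (\<lambda>\<omega>. \<bar>S \<omega> - T \<omega>\<bar>)"
    by (rule integral_mono[OF integrable_norm integrable_abs[OF i1]]) (auto simp: cmod_iexp_diff_le)
  also have "\<dots> \<le> sqrt (expectation (\<lambda>\<omega>. (S \<omega> - T \<omega>)\<^sup>2))"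
  proof (rule real_le_rsqrt)
    show "(expectation (\<lambda>\<omega>. \<bar>S \<omega> - T \<omega>\<bar>))\<^sup>2 \<le> expectation (\<lambda>\<omega>. (S \<omega> - T \<omega>)\<^sup>2)"
      using variance_eq[OF integrable_abs[OF i1]] variance_positive[of "\<lambda>\<omega>. \<bar>S \<omega> - T \<omega>\<bar>"] i by simp
  qed
  finally show ?thesis .
qed

text \<open>By the addition formulas, the real and the imaginary part of the difference are each a
  combination of two covariances of sines and cosines. Each covariance is at most
  \<open>4 * b\<close>, so each part is at most \<open>8 * b\<close>.\<close>

lemma decoupling:
  assumes [measurable]: "S \<in> borel_measurable M" "T \<in> borel_measurable M"
    and mix: "\<And>A B. A \<in> sets borel \<Longrightarrow> B \<in> sets borel \<Longrightarrow>
      \<bar>prob {\<omega> \<in> space M. S \<omega> \<in> A \<and> T \<omega> \<in> B} - prob {\<omega> \<in> space M. S \<omega> \<in> A} * prob {\<omega> \<in> space M. T \<omega> \<in> B}\<bar> \<le> b"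
  shows "cmod (expectation (\<lambda>\<omega>. iexp (S \<omega> + T \<omega>)) - expectation (\<lambda>\<omega>. iexp (S \<omega>)) * expectation (\<lambda>\<omega>. iexp (T \<omega>))) \<le> 16 * b"
proof -
  have cv: "\<bar>expectation (\<lambda>\<omega>. f (S \<omega>) * g (T \<omega>)) - expectation (\<lambda>\<omega>. f (S \<omega>)) * expectation (\<lambda>\<omega>. g (T \<omega>))\<bar> \<le> 4 * b"
    if [measurable]: "f \<in> borel_measurable borel" "g \<in> borel_measurable borel" and "\<And>x. \<bar>f x\<bar> \<le> 1" "\<And>x. \<bar>g x\<bar> \<le> 1"
    for f g :: "real \<Rightarrow> real"
  proof -
    have "\<bar>expectation (\<lambda>\<omega>. f (S \<omega>) * g (T \<omega>)) - expectation (\<lambda>\<omega>. f (S \<omega>)) * expectation (\<lambda>\<omega>. g (T \<omega>))\<bar> \<le> 4 * b * 1 * 1"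
    proof (rule cov_bounded)
      fix A B :: "real set" assume AB: "A \<in> sets borel" "B \<in> sets borel"
      have "f -` A \<in> sets borel" "g -` B \<in> sets borel"
        using measurable_sets[OF that(1) AB(1)] measurable_sets[OF that(2) AB(2)] by auto
      from mix[OF this] show "\<bar>prob {\<omega> \<in> space M. f (S \<omega>) \<in> A \<and> g (T \<omega>) \<in> B} - prob {\<omega> \<in> space M. f (S \<omega>) \<in> A} * prob {\<omega> \<in> space M. g (T \<omega>) \<in> B}\<bar> \<le> b"
        by simp
    qed (use that in auto)
    then show ?thesis by simp
  qed
  have cs: "cos \<in> borel_measurable (borel :: real measure)" "sin \<in> borel_measurable (borel :: real measure)" by measurable
  have i: "integrable M (\<lambda>\<omega>. f (S \<omega>) * g (T \<omega>))"
    if [measurable]: "f \<in> borel_measurable borel" "g \<in> borel_measurable borel" and "\<And>x. \<bar>f x\<bar> \<le> 1" "\<And>x. \<bar>g x\<bar> \<le> 1"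
    for f g :: "real \<Rightarrow> real"
    by (rule integrable_bounded_rv[where c=1]) (use that in \<open>auto simp: abs_mult intro!: mult_le_one\<close>)
  have c: "expectation (\<lambda>\<omega>. cos (S \<omega> + T \<omega>)) = expectation (\<lambda>\<omega>. cos (S \<omega>) * cos (T \<omega>)) - expectation (\<lambda>\<omega>. sin (S \<omega>) * sin (T \<omega>))"
    unfolding cos_add by (rule Bochner_Integration.integral_diff) (auto intro!: i)
  have s: "expectation (\<lambda>\<omega>. sin (S \<omega> + T \<omega>)) = expectation (\<lambda>\<omega>. sin (S \<omega>) * cos (T \<omega>)) + expectation (\<lambda>\<omega>. cos (S \<omega>) * sin (T \<omega>))"
    unfolding sin_add by (rule Bochner_Integration.integral_add) (auto intro!: i)
  let ?z = "expectation (\<lambda>\<omega>. iexp (S \<omega> + T \<omega>)) - expectation (\<lambda>\<omega>. iexp (S \<omega>)) * expectation (\<lambda>\<omega>. iexp (T \<omega>))"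
  note e = expectation_iexp_eq[OF assms(1)] expectation_iexp_eq[OF assms(2)]
    expectation_iexp_eq[OF borel_measurable_add[OF assms(1,2)]]
  have "Re ?z = (expectation (\<lambda>\<omega>. cos (S \<omega>) * cos (T \<omega>)) - expectation (\<lambda>\<omega>. cos (S \<omega>)) * expectation (\<lambda>\<omega>. cos (T \<omega>)))
     - (expectation (\<lambda>\<omega>. sin (S \<omega>) * sin (T \<omega>)) - expectation (\<lambda>\<omega>. sin (S \<omega>)) * expectation (\<lambda>\<omega>. sin (T \<omega>)))"
    unfolding e c by simp
  then have "\<bar>Re ?z\<bar> \<le> 8 * b"
    using cv[of cos cos, OF cs(1) cs(1) abs_cos_le_one abs_cos_le_one]
      cv[of sin sin, OF cs(2) cs(2) abs_sin_le_one abs_sin_le_one] by linarith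
  moreover have "Im ?z = (expectation (\<lambda>\<omega>. sin (S \<omega>) * cos (T \<omega>)) - expectation (\<lambda>\<omega>. sin (S \<omega>)) * expectation (\<lambda>\<omega>. cos (T \<omega>)))
     + (expectation (\<lambda>\<omega>. cos (S \<omega>) * sin (T \<omega>)) - expectation (\<lambda>\<omega>. cos (S \<omega>)) * expectation (\<lambda>\<omega>. sin (T \<omega>)))"
    unfolding e s by simp
  then have "\<bar>Im ?z\<bar> \<le> 8 * b"
    using cv[of cos sin, OF cs(1) cs(2) abs_cos_le_one abs_sin_le_one]
      cv[of sin cos, OF cs(2) cs(1) abs_sin_le_one abs_cos_le_one] by linarith
  ultimately show ?thesis using cmod_le[of ?z] by linarith
qed

end

context mixing_space
begin

text \<open>As \<open>\<beta> n \<le> 1\<close>, raising it to a power with exponent below 1 does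
  not decrease it. Hence \<beta> is itself summable, and it is monotone.\<close>

lemma mult_\<beta>_tendsto_0: "(\<lambda>n. real n * \<beta> n) \<longlonglongrightarrow> 0"
proof (rule decseq_summable_mult_tendsto_0)
  show "summable \<beta>"
  proof (rule summable_comparison_test'[OF \<beta>_summable, of 0])
    fix n
    have "\<beta> n powr 1 \<le> \<beta> n powr (1 - 2 / p)"
      using \<beta>_pos[of n] \<beta>_le_1[of n] p by (intro powr_mono') auto
    then show "norm (\<beta> n) \<le> \<beta> n powr (1 - 2 / p)" using \<beta>_pos[of n] by simp
  qed
qed (use \<beta>_anti \<beta>_pos in \<open>auto intro: less_imp_le\<close>)

context
  fixes f m K assumes mom: "moment_le f m" and K: "\<And>i \<omega>. \<bar>centred f i \<omega>\<bar> \<le> K"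
begin

lemma centred_meas' [measurable]: "centred f i \<in> borel_measurable M"
  by (rule centred_meas[OF mom])

text \<open>Blocks are split off one at a time from the right, at a cost of
  \<open>16 * \<beta> b\<close> each. The factor that remains has modulus at most 1, so the errors
  add up and are not amplified.\<close>

lemma block_decoupling:
  "cmod (expectation (\<lambda>\<omega>. iexp (\<theta> * (\<Sum>j<k. \<Sum>i\<in>block a b j. centred f i \<omega>)))
     - expectation (\<lambda>\<omega>. iexp (\<theta> * (\<Sum>i\<in>{1..int a}. centred f i \<omega>))) ^ k) \<le> 16 * real k * \<beta> b"
proof (induction k)
  case (Suc k)
  let ?S = "\<lambda>\<omega>. \<theta> * (\<Sum>j<k. \<Sum>i\<in>block a b j. centred f i \<omega>)"
  let ?T = "\<lambda>\<omega>. \<theta> * (\<Sum>i\<in>block a b k. centred f i \<omega>)"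
  let ?z = "expectation (\<lambda>\<omega>. iexp (\<theta> * (\<Sum>i\<in>{1..int a}. centred f i \<omega>)))"
  have z: "expectation (\<lambda>\<omega>. iexp (?T \<omega>)) = ?z"
  proof -
    have T: "?T \<omega> = \<theta> * (\<Sum>i\<in>{1..int a}. centred f (i + int (k * (a + b))) \<omega>)" for \<omega>
      unfolding block_def by (subst sum.reindex) (auto simp: inj_on_def)
    show ?thesis
      unfolding T by (rule expectation_shift_sum[OF mom, where g="\<lambda>x. iexp (\<theta> * x)"]) measurable
  qed
  have d: "cmod (expectation (\<lambda>\<omega>. iexp (?S \<omega> + ?T \<omega>)) - expectation (\<lambda>\<omega>. iexp (?S \<omega>)) * expectation (\<lambda>\<omega>. iexp (?T \<omega>))) \<le> 16 * \<beta> b"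
  proof (rule decoupling)
    \<comment> \<open>The last index of block \<open>k - 1\<close>. Block \<open>k\<close> starts at
      \<open>?k + b + 1\<close>, so its indices lie in the future at lag \<open>b\<close>.\<close>
    let ?k = "int (k * (a + b)) - int b"
    fix A B :: "real set" assume AB: "A \<in> sets borel" "B \<in> sets borel"
    show "\<bar>prob {\<omega> \<in> space M. ?S \<omega> \<in> A \<and> ?T \<omega> \<in> B} - prob {\<omega> \<in> space M. ?S \<omega> \<in> A} * prob {\<omega> \<in> space M. ?T \<omega> \<in> B}\<bar> \<le> \<beta> b"
    proof (rule mixing_le[OF _ _ AB])
      have "i \<le> ?k" if "j < k" "i \<in> block a b j" for i j
      proof -
        have "i \<le> int a + int (j * (a + b))" using that by (auto simp: block_def)
        moreover have "(j + 1) * (a + b) \<le> k * (a + b)" using that by (intro mult_right_mono) auto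
        then have "int ((j + 1) * (a + b)) \<le> int (k * (a + b))" by (simp only: of_nat_le_iff)
        ultimately show ?thesis by (simp add: algebra_simps)
      qed
      then show "?S \<in> borel_measurable (generated_sigma M X {..?k})"
        by (intro borel_measurable_times borel_measurable_const borel_measurable_sum centred_meas_generated[OF mom]) auto
      show "?T \<in> borel_measurable (generated_sigma M X {?k + int b..})"
        by (intro borel_measurable_times borel_measurable_const borel_measurable_sum centred_meas_generated[OF mom])
          (auto simp: block_def)
    qed
  qed measurable
  let ?E = "expectation (\<lambda>\<omega>. iexp (?S \<omega>))"
  have "cmod (expectation (\<lambda>\<omega>. iexp (?S \<omega> + ?T \<omega>)) - ?z ^ Suc k)
     \<le> cmod (expectation (\<lambda>\<omega>. iexp (?S \<omega> + ?T \<omega>)) - ?E * ?z) + cmod (?E * ?z - ?z ^ Suc k)"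
    using norm_triangle_ineq[of "expectation (\<lambda>\<omega>. iexp (?S \<omega> + ?T \<omega>)) - ?E * ?z" "?E * ?z - ?z ^ Suc k"] by simp
  also have "?E * ?z - ?z ^ Suc k = ?z * (?E - ?z ^ k)" by (simp add: algebra_simps)
  also have "cmod \<dots> \<le> 1 * (16 * real k * \<beta> b)"
    unfolding norm_mult by (intro mult_mono Suc cmod_expectation_iexp_le_1) auto
  finally have "cmod (expectation (\<lambda>\<omega>. iexp (?S \<omega> + ?T \<omega>)) - ?z ^ Suc k) \<le> 16 * \<beta> b + 16 * real k * \<beta> b"
    using d unfolding z by linarith
  moreover have "?S \<omega> + ?T \<omega> = \<theta> * (\<Sum>j<Suc k. \<Sum>i\<in>block a b j. centred f i \<omega>)" for \<omega>
    by (simp add: algebra_simps)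
  ultimately show ?case by (simp only: of_nat_Suc algebra_simps mult_1_right)
qed (simp add: prob_space)

text \<open>Taylor expansion of the characteristic function to second order. A block sum
  \<open>X\<close> satisfies \<open>\<bar>X\<bar> \<le> K * a\<close> pointwise, so its third
  absolute moment is at most \<open>K * a * V\<close>. The second error term is the cost of
  replacing \<open>1 - s\<close> by \<open>exp (- s)\<close>.\<close>

lemma block_char_le:
  fixes a :: nat and t :: real
  defines "V \<equiv> expectation (\<lambda>\<omega>. (\<Sum>i\<in>{1..int a}. centred f i \<omega>)\<^sup>2)"
  shows "cmod (expectation (\<lambda>\<omega>. iexp (t * (\<Sum>i\<in>{1..int a}. centred f i \<omega>))) - of_real (exp (- (t\<^sup>2 * V / 2))))
    \<le> \<bar>t\<bar> ^ 3 * K * real a * V + t ^ 4 * V\<^sup>2"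
proof -
  let ?X = "\<lambda>\<omega>. \<Sum>i\<in>{1..int a}. centred f i \<omega>"
  define z where "z = expectation (\<lambda>\<omega>. iexp (t * ?X \<omega>))"
  define s where "s = t\<^sup>2 * V / 2"
  have V0: "0 \<le> V" unfolding V_def by (rule integral_nonneg_AE) simp
  have K0: "0 \<le> K" using K[of 0 undefined] by linarith
  have iX: "integrable M ?X" using integrable_centred_prod(1)[OF mom] by simp
  have iX2: "integrable M (\<lambda>\<omega>. (?X \<omega>)\<^sup>2)" by (rule integrable_sum_square(1)[OF mom]) simp
  have EX: "expectation ?X = 0" using integrable_centred_prod(1,2)[OF mom] by simp
  have "cmod (char (distr M borel ?X) t - of_real (1 - t\<^sup>2 * V / 2)) \<le> t\<^sup>2 / 6 * expectation (\<lambda>\<omega>. min (6 * (?X \<omega>)\<^sup>2) (\<bar>t\<bar> * \<bar>?X \<omega>\<bar> ^ 3))"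
    using char_approx3'[OF _ iX iX2 EX _ refl, of V t] EX by (simp add: V_def)
  also have "char (distr M borel ?X) t = z"
    unfolding char_def z_def by (subst integral_distr) auto
  also have "expectation (\<lambda>\<omega>. min (6 * (?X \<omega>)\<^sup>2) (\<bar>t\<bar> * \<bar>?X \<omega>\<bar> ^ 3)) \<le> expectation (\<lambda>\<omega>. \<bar>t\<bar> * (K * real a) * (?X \<omega>)\<^sup>2)"
  proof (rule integral_mono)
    show "integrable M (\<lambda>\<omega>. min (6 * (?X \<omega>)\<^sup>2) (\<bar>t\<bar> * \<bar>?X \<omega>\<bar> ^ 3))"
      by (rule Bochner_Integration.integrable_bound[OF integrable_mult_right[OF iX2, of 6]]) (auto simp: min_def)
    show "integrable M (\<lambda>\<omega>. \<bar>t\<bar> * (K * real a) * (?X \<omega>)\<^sup>2)" using iX2 by simp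
    fix \<omega>
    have "\<bar>?X \<omega>\<bar> \<le> (\<Sum>i\<in>{1..int a}. K)" by (rule order_trans[OF sum_abs sum_mono[OF K]])
    then have X: "\<bar>?X \<omega>\<bar> \<le> K * real a" by (simp add: mult.commute)
    have "\<bar>?X \<omega>\<bar> ^ 3 = \<bar>?X \<omega>\<bar> * (?X \<omega>)\<^sup>2" by (simp only: abs_power3 mult.commute)
    also have "\<dots> \<le> K * real a * (?X \<omega>)\<^sup>2" using X by (rule mult_right_mono) simp
    finally have "\<bar>t\<bar> * \<bar>?X \<omega>\<bar> ^ 3 \<le> \<bar>t\<bar> * (K * real a * (?X \<omega>)\<^sup>2)" by (rule mult_left_mono) simp
    then show "min (6 * (?X \<omega>)\<^sup>2) (\<bar>t\<bar> * \<bar>?X \<omega>\<bar> ^ 3) \<le> \<bar>t\<bar> * (K * real a) * (?X \<omega>)\<^sup>2"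
      by (simp add: min_le_iff_disj mult_ac)
  qed
  also have "expectation (\<lambda>\<omega>. \<bar>t\<bar> * (K * real a) * (?X \<omega>)\<^sup>2) = \<bar>t\<bar> * (K * real a) * V" by (simp add: V_def)
  also have "t\<^sup>2 / 6 * (\<bar>t\<bar> * (K * real a) * V) = \<bar>t\<bar> ^ 3 * K * real a * V / 6"
    unfolding abs_power3 by simp
  also have "\<dots> \<le> \<bar>t\<bar> ^ 3 * K * real a * V / 1"
    using V0 K0 by (intro divide_left_mono mult_nonneg_nonneg) auto
  finally have 1: "cmod (z - of_real (1 - s)) \<le> \<bar>t\<bar> ^ 3 * K * real a * V"
    by (simp add: s_def mult_left_mono)
  have "\<bar>(1 - s) - exp (- s)\<bar> \<le> s\<^sup>2"
    using exp_neg_linear_approx[of s] V0 by (simp add: s_def abs_minus_commute)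
  also have "s\<^sup>2 \<le> t ^ 4 * V\<^sup>2" by (simp add: s_def power_divide power_mult_distrib)
  finally have "cmod (of_real (1 - s) - of_real (exp (- s))) \<le> t ^ 4 * V\<^sup>2"
    by (simp only: norm_of_real flip: of_real_diff)
  with 1 show ?thesis
    using norm_triangle_ineq[of "z - of_real (1 - s)" "of_real (1 - s) - of_real (exp (- s))"]
    unfolding z_def[symmetric] s_def[symmetric] by simp
qed

definition var_bound :: real where "var_bound = 20 * m powr (2 / p) * rate_sum"

lemma var_bound_nonneg: "0 \<le> var_bound"
  unfolding var_bound_def using rate_sum_nonneg by simp

lemma blocks:
  assumes "k * (a + b) \<le> n"
  shows "(\<Union>j<k. block a b j) \<subseteq> {1..int n}" "card (\<Union>j<k. block a b j) = k * a"
    "(\<Sum>j<k. \<Sum>i\<in>block a b j. g i) = (\<Sum>i\<in>(\<Union>j<k. block a b j). g i :: real)"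
proof -
  have bl: "j * (a + b) + a + b \<le> k * (a + b)" if "j < k" for j
    using mult_right_mono[of "Suc j" k "a + b"] that by simp
  show "(\<Union>j<k. block a b j) \<subseteq> {1..int n}"
  proof
    fix x assume "x \<in> (\<Union>j<k. block a b j)"
    then obtain j i where j: "j < k" "i \<in> {1..int a}" and x: "x = i + int (j * (a + b))"
      unfolding block_def by blast
    have "j * (a + b) + a \<le> n" using bl[OF j(1)] assms by linarith
    then have "int (j * (a + b)) + int a \<le> int n" by linarith
    then show "x \<in> {1..int n}" using j(2) unfolding x by (auto simp del: of_nat_mult)
  qed
  have disj: "block a b j \<inter> block a b j' = {}" if "j \<noteq> j'" for j j'
  proof -
    have *: "block a b j \<inter> block a b j' = {}" if "j < j'" for j j'
    proof -
      have "j * (a + b) + a + b \<le> j' * (a + b)"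
        using mult_right_mono[of "Suc j" j' "a + b"] that by simp
      then have "int (j * (a + b)) + int a \<le> int (j' * (a + b))" by linarith
      then show ?thesis by (auto simp: block_def simp del: of_nat_mult)
    qed
    show ?thesis using *[of j j'] *[of j' j] that by (cases "j < j'") auto
  qed
  have fin: "finite (block a b j)" for j by (simp add: block_def)
  have card: "card (block a b j) = a" for j
    unfolding block_def by (subst card_image) (auto simp: inj_on_def)
  show "card (\<Union>j<k. block a b j) = k * a"
    using disj fin card by (subst card_UN_disjoint) auto
  show "(\<Sum>j<k. \<Sum>i\<in>block a b j. g i) = (\<Sum>i\<in>(\<Union>j<k. block a b j). g i)"
    using disj fin by (subst sum.UNION_disjoint) auto
qed

text \<open>The four error terms come from four replacements: dropping the gaps and the incomplete
  last cycle, making the blocks independent, replacing the characteristic function of a block by a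
  Gaussian one, and replacing the total block variance by \<open>v\<close>. The number
  \<open>r\<close> bounds the proportion of dropped indices.\<close>

lemma bernstein_bound:
  fixes a b n :: nat and \<theta> :: real
  assumes a: "a \<ge> 1" and n: "n \<ge> 1"
  defines "V \<equiv> expectation (\<lambda>\<omega>. (\<Sum>i\<in>{1..int a}. centred f i \<omega>)\<^sup>2)"
    and "v \<equiv> long_run_var f"
    and "r \<equiv> real b / real a + real (a + b) / real n"
  shows "cmod (expectation (\<lambda>\<omega>. iexp (\<theta> / sqrt (real n) * (\<Sum>i\<in>{1..int n}. centred f i \<omega>))) - of_real (exp (- (\<theta>\<^sup>2 * v / 2))))
    \<le> \<bar>\<theta>\<bar> * sqrt (var_bound * r) + 16 * (real n / real a * \<beta> b)
      + (\<bar>\<theta>\<bar> ^ 3 * K * var_bound * (real a / sqrt (real n)) + \<theta> ^ 4 * var_bound\<^sup>2 * (real a / real n))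
      + \<theta>\<^sup>2 / 2 * (\<bar>V / real a - v\<bar> + v * r)"
proof -
  define k where "k = n div (a + b)"
  define t where "t = \<theta> / sqrt (real n)"
  define U where "U = (\<Union>j<k. block a b j)"
  let ?Y = "centred f"
  have kn: "k * (a + b) \<le> n" unfolding k_def by simp
  have nk: "n < k * (a + b) + (a + b)"
    unfolding k_def using a by (metis add.commute div_mult_mod_eq mod_less_divisor nat_add_left_cancel_less add_gr_0 less_le_trans zero_less_one)
  have ka: "real k * real a \<le> real n"
    using kn by (metis add_leD1 add_mult_distrib2 of_nat_le_iff of_nat_mult)
  have k_le: "real k \<le> real n / real a" using ka a by (simp add: field_simps)
  have V: "0 \<le> V" "V \<le> var_bound * real a"
    unfolding V_def var_bound_def using sum_second_moment_le[OF mom, of "{1..int a}"]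
    by (auto intro: integral_nonneg_AE)
  have K0: "0 \<le> K" using K[of 0 undefined] by linarith
  have v0: "0 \<le> v" unfolding v_def by (rule long_run_var_nonneg[OF mom])
  \<comment> \<open>There are \<open>k \<le> n / a\<close> gaps of length \<open>b\<close>, and the
    incomplete last cycle has fewer than \<open>a + b\<close> indices.\<close>
  have rest: "real n - real k * real a \<le> r * real n"
  proof -
    have "real n < real k * (real a + real b) + (real a + real b)"
      using nk by (metis of_nat_add of_nat_less_iff of_nat_mult)
    then have "real n - real k * real a \<le> real k * real b + real (a + b)" by (simp add: algebra_simps)
    also have "\<dots> \<le> real n / real a * real b + real (a + b)"
      using k_le by (intro add_right_mono mult_right_mono) auto
    also have "\<dots> = r * real n" using n by (simp add: r_def field_simps)
    finally show ?thesis .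
  qed
  have r0: "0 \<le> r" by (simp add: r_def)
  note bl = blocks[OF kn, folded U_def]
  let ?S = "\<lambda>\<omega>. \<Sum>i\<in>{1..int n}. ?Y i \<omega>" and ?T = "\<lambda>\<omega>. \<Sum>j<k. \<Sum>i\<in>block a b j. ?Y i \<omega>"
  define z where "z = expectation (\<lambda>\<omega>. iexp (t * (\<Sum>i\<in>{1..int a}. ?Y i \<omega>)))"
  define w where "w = complex_of_real (exp (- (t\<^sup>2 * V / 2)))"
  have 1: "cmod (expectation (\<lambda>\<omega>. iexp (t * ?S \<omega>)) - expectation (\<lambda>\<omega>. iexp (t * ?T \<omega>))) \<le> \<bar>\<theta>\<bar> * sqrt (var_bound * r)"
  proof -
    have R: "?S \<omega> - ?T \<omega> = (\<Sum>i\<in>{1..int n} - U. ?Y i \<omega>)" for \<omega>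
      unfolding bl(3) using bl(1) by (simp add: sum_diff)
    have sq: "(t * ?S \<omega> - t * ?T \<omega>)\<^sup>2 = t\<^sup>2 * (\<Sum>i\<in>{1..int n} - U. ?Y i \<omega>)\<^sup>2" for \<omega>
      unfolding R[symmetric] by (simp only: right_diff_distrib[symmetric] power_mult_distrib)
    have "cmod (expectation (\<lambda>\<omega>. iexp (t * ?S \<omega>)) - expectation (\<lambda>\<omega>. iexp (t * ?T \<omega>)))
       \<le> sqrt (expectation (\<lambda>\<omega>. (t * ?S \<omega> - t * ?T \<omega>)\<^sup>2))"
      by (rule iexp_diff_expectation_le)
        (measurable, auto simp only: sq finite_Diff finite_atLeastAtMost_int intro!: integrable_mult_right integrable_sum_square(1)[OF mom])
    also have "expectation (\<lambda>\<omega>. (t * ?S \<omega> - t * ?T \<omega>)\<^sup>2) = t\<^sup>2 * expectation (\<lambda>\<omega>. (\<Sum>i\<in>{1..int n} - U. ?Y i \<omega>)\<^sup>2)"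
      unfolding sq by simp
    also have "\<dots> \<le> t\<^sup>2 * (var_bound * real (card ({1..int n} - U)))"
      unfolding var_bound_def by (intro mult_left_mono sum_second_moment_le[OF mom]) auto
    also have "real (card ({1..int n} - U)) = real n - real k * real a"
      using bl(1,2) kn by (subst card_Diff_subset) (auto intro: finite_subset simp: of_nat_diff algebra_simps trans_le_add1)
    also have "t\<^sup>2 * (var_bound * (real n - real k * real a)) \<le> t\<^sup>2 * (var_bound * (r * real n))"
      using rest var_bound_nonneg by (intro mult_left_mono) auto
    also have "\<dots> = \<theta>\<^sup>2 * (var_bound * r)" using n by (simp add: t_def power_divide)
    finally show ?thesis by (simp add: real_sqrt_mult)
  qed
  have 2: "cmod (expectation (\<lambda>\<omega>. iexp (t * ?T \<omega>)) - z ^ k) \<le> 16 * (real n / real a * \<beta> b)"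
    using block_decoupling[where \<theta>=t and k=k and a=a and b=b] mult_right_mono[OF k_le, of "16 * \<beta> b"] \<beta>_pos[of b]
    unfolding z_def by (simp add: mult_ac)
  have 3: "cmod (z ^ k - w ^ k) \<le> \<bar>\<theta>\<bar> ^ 3 * K * var_bound * (real a / sqrt (real n)) + \<theta> ^ 4 * var_bound\<^sup>2 * (real a / real n)"
  proof -
    have "cmod z \<le> 1"
      unfolding z_def
      by (intro cmod_expectation_iexp_le_1 borel_measurable_times borel_measurable_const borel_measurable_sum centred_meas')
    moreover have "cmod w \<le> 1"
      unfolding w_def norm_of_real using V by simp
    ultimately have "cmod (z ^ k - w ^ k) \<le> real k * cmod (z - w)"
      by (rule norm_power_diff)
    also have "\<dots> \<le> real k * (\<bar>t\<bar> ^ 3 * K * real a * V + t ^ 4 * V\<^sup>2)"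
      unfolding z_def w_def V_def by (intro mult_left_mono block_char_le) simp
    also have "\<dots> \<le> (real n / real a) * (\<bar>t\<bar> ^ 3 * K * real a * (var_bound * real a) + t ^ 4 * (var_bound * real a)\<^sup>2)"
      using V K0 k_le var_bound_nonneg by (intro mult_mono add_mono mult_left_mono power_mono) auto
    also have "\<dots> = \<bar>\<theta>\<bar> ^ 3 * K * var_bound * (real a / sqrt (real n)) + \<theta> ^ 4 * var_bound\<^sup>2 * (real a / real n)"
    proof -
      have s2: "sqrt (real n) * sqrt (real n) = real n" by simp
      have t3: "\<bar>t\<bar> ^ 3 = \<bar>\<theta>\<bar> ^ 3 / (real n * sqrt (real n))"
        by (simp add: t_def power_divide abs_divide power3_eq_cube)
      have t4: "t ^ 4 = \<theta> ^ 4 / (real n)\<^sup>2"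
        by (simp add: t_def power_divide power4_eq_xxxx power2_eq_square mult.assoc[symmetric])
      show ?thesis unfolding t3 t4 using n a by (simp add: field_simps power2_eq_square)
    qed
    finally show ?thesis .
  qed
  have 4: "cmod (w ^ k - of_real (exp (- (\<theta>\<^sup>2 * v / 2)))) \<le> \<theta>\<^sup>2 / 2 * (\<bar>V / real a - v\<bar> + v * r)"
  proof -
    have "w ^ k = of_real (exp (- (real k * (t\<^sup>2 * V / 2))))"
      unfolding w_def by (simp flip: of_real_power exp_of_nat_mult)
    then have "cmod (w ^ k - of_real (exp (- (\<theta>\<^sup>2 * v / 2)))) = \<bar>exp (- (real k * (t\<^sup>2 * V / 2))) - exp (- (\<theta>\<^sup>2 * v / 2))\<bar>"
      by (simp only: norm_of_real flip: of_real_diff)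
    also have "\<dots> \<le> \<bar>real k * (t\<^sup>2 * V / 2) - \<theta>\<^sup>2 * v / 2\<bar>"
      using V v0 by (intro exp_neg_diff_le) auto
    also have "real k * (t\<^sup>2 * V / 2) - \<theta>\<^sup>2 * v / 2 = \<theta>\<^sup>2 / 2 * (real k * V / real n - v)"
      by (simp add: t_def power_divide algebra_simps)
    also have "\<bar>\<dots>\<bar> = \<theta>\<^sup>2 / 2 * \<bar>real k * V / real n - v\<bar>" by (simp add: abs_mult)
    also have "real k * V / real n - v = (real k * real a / real n) * (V / real a - v) - v * ((real n - real k * real a) / real n)"
      using n a by (simp add: field_simps)
    also have "\<bar>\<dots>\<bar> \<le> \<bar>(real k * real a / real n) * (V / real a - v)\<bar> + \<bar>v * ((real n - real k * real a) / real n)\<bar>"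
      by (rule abs_triangle_ineq4)
    also have "\<dots> \<le> 1 * \<bar>V / real a - v\<bar> + v * r"
    proof (rule add_mono)
      show "\<bar>(real k * real a / real n) * (V / real a - v)\<bar> \<le> 1 * \<bar>V / real a - v\<bar>"
        unfolding abs_mult using ka n by (intro mult_right_mono) (auto simp: divide_le_eq)
      have "(real n - real k * real a) / real n \<le> r" using rest n by (simp add: divide_le_eq)
      then have "v * ((real n - real k * real a) / real n) \<le> v * r" using v0 by (rule mult_left_mono)
      moreover have "0 \<le> v * ((real n - real k * real a) / real n)" using ka v0 by simp
      ultimately show "\<bar>v * ((real n - real k * real a) / real n)\<bar> \<le> v * r" by linarith
    qed
    finally show ?thesis by (simp add: mult_left_mono)
  qed
  have tri: "cmod (x - y) \<le> cmod (x - u) + cmod (u - u') + cmod (u' - u'') + cmod (u'' - y)" for x y u u' u'' :: complex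
    using dist_triangle[of x y u] dist_triangle[of u y u'] dist_triangle[of u' y u''] unfolding dist_norm by linarith
  from tri[of "expectation (\<lambda>\<omega>. iexp (t * ?S \<omega>))" "of_real (exp (- (\<theta>\<^sup>2 * v / 2)))" "expectation (\<lambda>\<omega>. iexp (t * ?T \<omega>))" "z ^ k" "w ^ k"]
  show ?thesis using 1 2 3 4 unfolding t_def by linarith
qed

text \<open>Blocks of length about \<open>\<epsilon> * sqrt n\<close> are separated by gaps of length about \<open>\<epsilon>\<^sup>2 * sqrt n\<close>.
  A normalised block is then bounded by a multiple of \<open>\<epsilon>\<close>, so no Lindeberg condition has to be
  checked, and \<open>n * \<beta> n \<longlonglongrightarrow> 0\<close> is just enough to decouple the blocks.\<close>

lemma bounded_clt:
  "(\<lambda>n. expectation (\<lambda>\<omega>. iexp (\<theta> / sqrt (real n) * (\<Sum>i\<in>{1..int n}. centred f i \<omega>))))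
     \<longlonglongrightarrow> of_real (exp (- (\<theta>\<^sup>2 * long_run_var f / 2)))"
proof -
  define v where "v = long_run_var f"
  define \<Phi> where "\<Phi> n = expectation (\<lambda>\<omega>. iexp (\<theta> / sqrt (real n) * (\<Sum>i\<in>{1..int n}. centred f i \<omega>)))" for n :: nat
  \<comment> \<open>The limit of the Bernstein bound as \<open>n\<close> grows with \<epsilon>
    fixed: \<open>b / a\<close>, \<open>r\<close> and \<open>a / sqrt n\<close> all tend to
    \<epsilon>, and the remaining terms vanish. Since \<open>l\<close> tends to 0 with \<epsilon>,
    the limits may be taken in this order.\<close>
  define l where "l \<epsilon> = \<bar>\<theta>\<bar> * sqrt (var_bound * \<epsilon>) + \<bar>\<theta>\<bar> ^ 3 * K * var_bound * \<epsilon> + \<theta>\<^sup>2 / 2 * (v * \<epsilon>)" for \<epsilon>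
  have main: "\<forall>\<^sub>F n in sequentially. cmod (\<Phi> n - of_real (exp (- (\<theta>\<^sup>2 * v / 2)))) < e"
    if \<epsilon>: "\<epsilon> > 0" "l \<epsilon> < e" for \<epsilon> e
  proof -
    define a where "a n = nat \<lceil>\<epsilon> * sqrt (real n)\<rceil>" for n :: nat
    define b where "b n = nat \<lceil>\<epsilon>\<^sup>2 * sqrt (real n)\<rceil>" for n :: nat
    define V where "V a = expectation (\<lambda>\<omega>. (\<Sum>i\<in>{1..int a}. centred f i \<omega>)\<^sup>2)" for a :: nat
    define r where "r n = real (b n) / real (a n) + real (a n + b n) / real n" for n
    have at: "filterlim a at_top sequentially" "filterlim b at_top sequentially"
      unfolding a_def b_def using \<epsilon> by (auto intro: ceiling_scale_at_top)
    have as: "(\<lambda>n. real (a n) / sqrt (real n)) \<longlonglongrightarrow> \<epsilon>" "(\<lambda>n. real (b n) / sqrt (real n)) \<longlonglongrightarrow> \<epsilon>\<^sup>2"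
      unfolding a_def b_def using \<epsilon> by (simp_all only: ceiling_scale_tendsto zero_less_power)
    have inv: "(\<lambda>n. 1 / sqrt (real n)) \<longlonglongrightarrow> 0"
      by (intro tendsto_divide_0[OF tendsto_const] filterlim_at_top_imp_at_infinity
        filterlim_compose[OF sqrt_at_top] filterlim_real_sequentially)
    have n1: "\<forall>\<^sub>F n in sequentially. n \<ge> (1::nat)" by (rule eventually_ge_at_top)
    have a1: "\<forall>\<^sub>F n in sequentially. a n \<ge> 1" "\<forall>\<^sub>F n in sequentially. b n \<ge> 1"
      using at unfolding filterlim_at_top by blast+
    have an: "(\<lambda>n. real (a n) / real n) \<longlonglongrightarrow> 0"
    proof (rule Lim_transform_eventually)
      show "(\<lambda>n. real (a n) / sqrt (real n) * (1 / sqrt (real n))) \<longlonglongrightarrow> 0"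
        using tendsto_mult[OF as(1) inv] by simp
      show "\<forall>\<^sub>F n in sequentially. real (a n) / sqrt (real n) * (1 / sqrt (real n)) = real (a n) / real n"
        using n1 by eventually_elim simp
    qed
    have bn: "(\<lambda>n. real (b n) / real n) \<longlonglongrightarrow> 0"
    proof (rule Lim_transform_eventually)
      show "(\<lambda>n. real (b n) / sqrt (real n) * (1 / sqrt (real n))) \<longlonglongrightarrow> 0"
        using tendsto_mult[OF as(2) inv] by simp
      show "\<forall>\<^sub>F n in sequentially. real (b n) / sqrt (real n) * (1 / sqrt (real n)) = real (b n) / real n"
        using n1 by eventually_elim simp
    qed
    have ba: "(\<lambda>n. real (b n) / real (a n)) \<longlonglongrightarrow> \<epsilon>"
    proof (rule Lim_transform_eventually)
      have "(\<lambda>n. (real (b n) / sqrt (real n)) / (real (a n) / sqrt (real n))) \<longlonglongrightarrow> \<epsilon>\<^sup>2 / \<epsilon>"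
        using as \<epsilon> by (intro tendsto_divide) auto
      then show "(\<lambda>n. (real (b n) / sqrt (real n)) / (real (a n) / sqrt (real n))) \<longlonglongrightarrow> \<epsilon>"
        using \<epsilon> by (simp add: power2_eq_square)
      show "\<forall>\<^sub>F n in sequentially. (real (b n) / sqrt (real n)) / (real (a n) / sqrt (real n)) = real (b n) / real (a n)"
        using n1 by eventually_elim simp
    qed
    have r: "r \<longlonglongrightarrow> \<epsilon>"
      unfolding r_def of_nat_add add_divide_distrib using tendsto_add[OF ba tendsto_add[OF an bn]] by simp
    \<comment> \<open>The product is rewritten as
      \<open>(sqrt n / a) * (sqrt n / b) * (b * \<beta> b)\<close>: the first two factors converge
      and the third tends to 0.\<close>
    have nb: "(\<lambda>n. real n / real (a n) * \<beta> (b n)) \<longlonglongrightarrow> 0"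
    proof (rule Lim_transform_eventually)
      have "(\<lambda>n. inverse (real (a n) / sqrt (real n)) * inverse (real (b n) / sqrt (real n)) * (real (b n) * \<beta> (b n))) \<longlonglongrightarrow> inverse \<epsilon> * inverse (\<epsilon>\<^sup>2) * 0"
        using \<epsilon> by (intro tendsto_mult tendsto_inverse as filterlim_compose[OF mult_\<beta>_tendsto_0 at(2)]) auto
      then show "(\<lambda>n. inverse (real (a n) / sqrt (real n)) * inverse (real (b n) / sqrt (real n)) * (real (b n) * \<beta> (b n))) \<longlonglongrightarrow> 0"
        by simp
      show "\<forall>\<^sub>F n in sequentially. inverse (real (a n) / sqrt (real n)) * inverse (real (b n) / sqrt (real n)) * (real (b n) * \<beta> (b n))
         = real n / real (a n) * \<beta> (b n)"
        using n1 a1 by eventually_elim simp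
    qed
    have Va: "(\<lambda>n. \<bar>V (a n) / real (a n) - v\<bar>) \<longlonglongrightarrow> \<bar>v - v\<bar>"
      unfolding V_def v_def
      by (intro tendsto_rabs tendsto_diff tendsto_const filterlim_compose[OF var_sum_asymptotics[OF mom] at(1)])
    define B where "B n = \<bar>\<theta>\<bar> * sqrt (var_bound * r n) + 16 * (real n / real (a n) * \<beta> (b n))
      + (\<bar>\<theta>\<bar> ^ 3 * K * var_bound * (real (a n) / sqrt (real n)) + \<theta> ^ 4 * var_bound\<^sup>2 * (real (a n) / real n))
      + \<theta>\<^sup>2 / 2 * (\<bar>V (a n) / real (a n) - v\<bar> + v * r n)" for n
    have "B \<longlonglongrightarrow> \<bar>\<theta>\<bar> * sqrt (var_bound * \<epsilon>) + 16 * 0 + (\<bar>\<theta>\<bar> ^ 3 * K * var_bound * \<epsilon> + \<theta> ^ 4 * var_bound\<^sup>2 * 0) + \<theta>\<^sup>2 / 2 * (\<bar>v - v\<bar> + v * \<epsilon>)"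
      unfolding B_def by (intro tendsto_intros r nb as(1) an Va)
    then have "B \<longlonglongrightarrow> l \<epsilon>" by (simp add: l_def)
    from order_tendstoD(2)[OF this \<epsilon>(2)] show ?thesis
      using n1 a1(1)
    proof eventually_elim
      case (elim n)
      have "cmod (\<Phi> n - of_real (exp (- (\<theta>\<^sup>2 * v / 2)))) \<le> B n"
        using bernstein_bound[OF elim(3) elim(2), of \<theta> "b n"]
        unfolding \<Phi>_def v_def B_def V_def r_def .
      then show ?case using elim(1) by linarith
    qed
  qed
  have "((\<lambda>\<epsilon>. l \<epsilon>) \<longlongrightarrow> \<bar>\<theta>\<bar> * sqrt (var_bound * 0) + \<bar>\<theta>\<bar> ^ 3 * K * var_bound * 0 + \<theta>\<^sup>2 / 2 * (v * 0)) (at_right 0)"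
    unfolding l_def by (intro tendsto_intros)
  then have l0: "(l \<longlongrightarrow> 0) (at_right 0)" by simp
  have "\<Phi> \<longlonglongrightarrow> of_real (exp (- (\<theta>\<^sup>2 * v / 2)))"
  proof (rule tendstoI)
    fix e :: real assume "e > 0"
    then have "\<forall>\<^sub>F \<epsilon> in at_right 0. l \<epsilon> < e \<and> \<epsilon> > 0"
      using order_tendstoD(2)[OF l0] by (intro eventually_conj) (auto simp: eventually_at_right_less)
    then obtain \<epsilon> where "l \<epsilon> < e" "\<epsilon> > 0" using eventually_happens by fastforce
    from main[OF this(2,1)] show "\<forall>\<^sub>F n in sequentially. dist (\<Phi> n) (of_real (exp (- (\<theta>\<^sup>2 * v / 2)))) < e"
      by (simp add: dist_norm)
  qed
  then show ?thesis unfolding \<Phi>_def v_def .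
qed

end

text \<open>The term \<open>\<beta> 0 = 1\<close> alone gives the bound; it makes the variance
  bounds of the truncation remainders strictly positive.\<close>

lemma rate_sum_ge_1: "1 \<le> rate_sum"
  unfolding rate_sum_def
  using sum_le_suminf[OF \<beta>_summable, of "{0}"] by (simp add: \<beta>_0)

text \<open>Truncation at \<open>K\<close> reduces to the bounded case. The remainders have a bound
  on the \<open>p\<close>-th moment that tends to 0 with growing \<open>K\<close>, so their sums
  have second moment at most \<open>DK K * n\<close>. This is small relative to \<open>n\<close>,
  uniformly in \<open>n\<close>, and controls the characteristic functions and the variances at
  once.\<close>

lemma mixing_clt:
  assumes mom: "moment_le (\<lambda>x. x) m" and mean: "expectation (X 0) = 0"
  shows "(\<lambda>n. expectation (\<lambda>\<omega>. iexp (\<theta> / sqrt (real n) * (\<Sum>i\<in>{1..int n}. X i \<omega>))))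
     \<longlonglongrightarrow> of_real (exp (- (\<theta>\<^sup>2 * long_run_var (\<lambda>x. x) / 2)))"
proof -
  define tr where "tr K x = (if \<bar>x\<bar> \<le> real K then x else 0)" for K :: nat and x :: real
  define tl where "tl K x = x - tr K x" for K :: nat and x :: real
  have [measurable]: "tr K \<in> borel_measurable borel" "tl K \<in> borel_measurable borel" for K
    unfolding tl_def tr_def by measurable
  have pow_le: "\<bar>tr K x\<bar> powr p \<le> \<bar>x\<bar> powr p" "\<bar>tl K x\<bar> powr p \<le> \<bar>x\<bar> powr p" for K x
    using p by (auto simp: tr_def tl_def intro!: powr_mono2)
  have iX: "integrable M (\<lambda>\<omega>. \<bar>X 0 \<omega>\<bar> powr p)" "expectation (\<lambda>\<omega>. \<bar>X 0 \<omega>\<bar> powr p) \<le> m" and m: "m > 0"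
    using mom by (auto simp: moment_le_def)
  have ip: "integrable M (\<lambda>\<omega>. \<bar>tr K (X 0 \<omega>)\<bar> powr p)" "integrable M (\<lambda>\<omega>. \<bar>tl K (X 0 \<omega>)\<bar> powr p)" for K
    by (rule Bochner_Integration.integrable_bound[OF iX(1)]; use pow_le in simp)+
  have mtr: "moment_le (tr K) m" for K
    unfolding moment_le_def using m ip integral_mono[OF ip(1) iX(1) pow_le(1)] iX(2)
    by (auto intro: order_trans)
  \<comment> \<open>The summand \<open>1 / Suc K\<close> keeps the moment bound positive, as
    \<open>moment_le\<close> requires, and vanishes in the limit.\<close>
  define \<mu> where "\<mu> K = expectation (\<lambda>\<omega>. \<bar>tl K (X 0 \<omega>)\<bar> powr p) + 1 / real (Suc K)" for K
  have \<mu>_pos: "0 < \<mu> K" for K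
    unfolding \<mu>_def by (intro add_nonneg_pos integral_nonneg_AE) auto
  have mtl: "moment_le (tl K) (\<mu> K)" for K
    unfolding moment_le_def using \<mu>_pos[of K] ip by (auto simp: \<mu>_def)
  have \<mu>0: "\<mu> \<longlonglongrightarrow> 0"
  proof -
    have "(\<lambda>K. expectation (\<lambda>\<omega>. \<bar>tl K (X 0 \<omega>)\<bar> powr p)) \<longlonglongrightarrow> expectation (\<lambda>\<omega>. 0)"
    proof (rule integral_dominated_convergence[where w="\<lambda>\<omega>. \<bar>X 0 \<omega>\<bar> powr p"])
      show "AE \<omega> in M. (\<lambda>K. \<bar>tl K (X 0 \<omega>)\<bar> powr p) \<longlonglongrightarrow> 0"
      proof (rule AE_I2, rule tendsto_eventually)
        fix \<omega>
        have "\<forall>\<^sub>F K in sequentially. nat \<lceil>\<bar>X 0 \<omega>\<bar>\<rceil> \<le> K" by (rule eventually_ge_at_top)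
        then show "\<forall>\<^sub>F K in sequentially. \<bar>tl K (X 0 \<omega>)\<bar> powr p = 0"
        proof eventually_elim
          case (elim K)
          then have "\<bar>X 0 \<omega>\<bar> \<le> real K" by linarith
          then show ?case by (simp add: tl_def tr_def)
        qed
      qed
    qed (use iX pow_le in auto)
    then have "\<mu> \<longlonglongrightarrow> 0 + 0"
      unfolding \<mu>_def using LIMSEQ_inverse_real_of_nat by (intro tendsto_add) (auto simp: inverse_eq_divide)
    then show ?thesis by simp
  qed
  define DK where "DK K = 20 * \<mu> K powr (2 / p) * rate_sum" for K
  define D0 where "D0 = 20 * m powr (2 / p) * rate_sum"
  have DK_pos: "DK K > 0" for K
    unfolding DK_def using \<mu>_pos[of K] rate_sum_ge_1 by simp
  have DK0: "DK \<longlonglongrightarrow> 0"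
  proof -
    have "(\<lambda>K. \<mu> K powr (2 / p)) \<longlonglongrightarrow> 0 powr (2 / p)"
      using p \<mu>0 \<mu>_pos by (intro tendsto_powr2) (auto intro: less_imp_le always_eventually)
    then have "(\<lambda>K. 20 * \<mu> K powr (2 / p) * rate_sum) \<longlonglongrightarrow> 20 * 0 * rate_sum"
      by (intro tendsto_intros) simp
    then show ?thesis by (simp add: DK_def[abs_def])
  qed
  let ?id = "\<lambda>x::real. x"
  have cX: "centred ?id i = X i" for i
    unfolding centred_def using mean by simp
  have cK: "centred ?id i \<omega> = centred (tr K) i \<omega> + centred (tl K) i \<omega>" for i \<omega> K
    using integrable_f[OF mtr[of K], of 0] integrable_f[OF mtl[of K], of 0] integrable_f[OF mom, of 0]
    unfolding centred_def tl_def by simp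
  define S where "S n \<omega> = (\<Sum>i\<in>{1..int n}. X i \<omega>)" for n \<omega>
  define SK where "SK K n \<omega> = (\<Sum>i\<in>{1..int n}. centred (tr K) i \<omega>)" for K n \<omega>
  define R where "R K n \<omega> = (\<Sum>i\<in>{1..int n}. centred (tl K) i \<omega>)" for K n \<omega>
  have S_eq: "S n \<omega> = SK K n \<omega> + R K n \<omega>" for n \<omega> K
    unfolding S_def SK_def R_def sum.distrib[symmetric] cK[symmetric] cX ..
  have [measurable]: "S n \<in> borel_measurable M" "SK K n \<in> borel_measurable M" "R K n \<in> borel_measurable M" for n K
    unfolding S_def SK_def R_def
    by (intro borel_measurable_sum X_meas centred_meas[OF mtr] centred_meas[OF mtl])+
  have S2: "integrable M (\<lambda>\<omega>. (S n \<omega>)\<^sup>2)" "expectation (\<lambda>\<omega>. (S n \<omega>)\<^sup>2) \<le> D0 * real n" for n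
    using integrable_sum_square(1)[OF mom, of "{1..int n}"] sum_second_moment_le[OF mom, of "{1..int n}"]
    by (auto simp: S_def cX D0_def)
  have SK2: "integrable M (\<lambda>\<omega>. (SK K n \<omega>)\<^sup>2)" for n K
    using integrable_sum_square(1)[OF mtr, of "{1..int n}" K] by (simp add: SK_def)
  have R2: "integrable M (\<lambda>\<omega>. (R K n \<omega>)\<^sup>2)" "expectation (\<lambda>\<omega>. (R K n \<omega>)\<^sup>2) \<le> DK K * real n" for n K
    using integrable_sum_square(1)[OF mtl, of "{1..int n}" K] sum_second_moment_le[OF mtl, of "{1..int n}" K]
    by (auto simp: R_def DK_def)
  let ?v = "long_run_var ?id" and ?vK = "\<lambda>K. long_run_var (tr K)"
  \<comment> \<open>The difference of the squares of \<open>S\<close> and \<open>SK\<close> is at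
    most \<open>(1 + 1 / c) * R^2 + c * S^2\<close> for every \<open>c > 0\<close>. The choice
    \<open>c = sqrt (DK K)\<close> balances the two parts, and \<eta> collects the resulting
    terms.\<close>
  define \<eta> where "\<eta> K = DK K + sqrt (DK K) + sqrt (DK K) * D0" for K
  have v_diff: "\<bar>?v - ?vK K\<bar> \<le> \<eta> K" for K
  proof -
    let ?c = "sqrt (DK K)"
    have c: "?c > 0" using DK_pos by simp
    have "(\<lambda>n. \<bar>expectation (\<lambda>\<omega>. (S n \<omega>)\<^sup>2) / real n - expectation (\<lambda>\<omega>. (SK K n \<omega>)\<^sup>2) / real n\<bar>) \<longlonglongrightarrow> \<bar>?v - ?vK K\<bar>"
      using tendsto_rabs[OF tendsto_diff[OF var_sum_asymptotics[OF mom] var_sum_asymptotics[OF mtr]]]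
      unfolding S_def SK_def cX .
    then show ?thesis
    proof (rule LIMSEQ_le_const2, intro exI allI impI)
      fix n :: nat assume n: "n \<ge> 1"
      have pt: "\<bar>(S n \<omega>)\<^sup>2 - (SK K n \<omega>)\<^sup>2\<bar> \<le> (1 + 1 / ?c) * (R K n \<omega>)\<^sup>2 + ?c * (S n \<omega>)\<^sup>2" for \<omega>
      proof -
        let ?s = "S n \<omega>" and ?r = "R K n \<omega>"
        have "SK K n \<omega> = ?s - ?r" using S_eq[of n \<omega> K] by simp
        then have "(S n \<omega>)\<^sup>2 - (SK K n \<omega>)\<^sup>2 = 2 * ?s * ?r - ?r\<^sup>2" by (simp add: power2_diff)
        moreover have "\<bar>2 * ?s * ?r\<bar> \<le> ?r\<^sup>2 / ?c + ?c * ?s\<^sup>2"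
        proof -
          have "0 \<le> (\<bar>?r\<bar> - ?c * \<bar>?s\<bar>)\<^sup>2 / ?c" using c by simp
          also have "\<dots> = ?r\<^sup>2 / ?c + ?c * ?s\<^sup>2 - 2 * \<bar>?s\<bar> * \<bar>?r\<bar>"
            using c by (simp add: power2_diff power_mult_distrib field_simps power2_eq_square)
          finally show ?thesis by (simp add: abs_mult)
        qed
        moreover have "(1 + 1 / ?c) * ?r\<^sup>2 = ?r\<^sup>2 + ?r\<^sup>2 / ?c" by (simp add: algebra_simps)
        ultimately show ?thesis using zero_le_power2[of ?r] by linarith
      qed
      have "\<bar>expectation (\<lambda>\<omega>. (S n \<omega>)\<^sup>2) - expectation (\<lambda>\<omega>. (SK K n \<omega>)\<^sup>2)\<bar> = \<bar>expectation (\<lambda>\<omega>. (S n \<omega>)\<^sup>2 - (SK K n \<omega>)\<^sup>2)\<bar>"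
        using S2 SK2 by simp
      also have "\<dots> \<le> expectation (\<lambda>\<omega>. \<bar>(S n \<omega>)\<^sup>2 - (SK K n \<omega>)\<^sup>2\<bar>)" by (rule integral_abs_bound)
      also have "\<dots> \<le> expectation (\<lambda>\<omega>. (1 + 1 / ?c) * (R K n \<omega>)\<^sup>2 + ?c * (S n \<omega>)\<^sup>2)"
        by (rule integral_mono[OF integrable_abs]) (use S2 SK2 R2 pt in auto)
      also have "\<dots> = (1 + 1 / ?c) * expectation (\<lambda>\<omega>. (R K n \<omega>)\<^sup>2) + ?c * expectation (\<lambda>\<omega>. (S n \<omega>)\<^sup>2)"
        using S2 R2 by simp
      also have "\<dots> \<le> (1 + 1 / ?c) * (DK K * real n) + ?c * (D0 * real n)"
        using S2 R2 c by (intro add_mono mult_left_mono) auto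
      also have "\<dots> = \<eta> K * real n"
      proof -
        have "DK K / ?c = ?c" using DK_pos[of K] by (simp add: real_div_sqrt)
        then have "(1 + 1 / ?c) * DK K = DK K + ?c" by (simp add: algebra_simps)
        then have "(1 + 1 / ?c) * (DK K * real n) = (DK K + ?c) * real n" by (metis mult.assoc)
        then show ?thesis by (simp add: \<eta>_def algebra_simps)
      qed
      finally have "\<bar>expectation (\<lambda>\<omega>. (S n \<omega>)\<^sup>2) - expectation (\<lambda>\<omega>. (SK K n \<omega>)\<^sup>2)\<bar> / real n \<le> \<eta> K"
        using n by (simp add: divide_le_eq)
      then show "\<bar>expectation (\<lambda>\<omega>. (S n \<omega>)\<^sup>2) / real n - expectation (\<lambda>\<omega>. (SK K n \<omega>)\<^sup>2) / real n\<bar> \<le> \<eta> K"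
        by (simp add: abs_divide flip: diff_divide_distrib)
    qed
  qed
  define \<Phi> where "\<Phi> n = expectation (\<lambda>\<omega>. iexp (\<theta> / sqrt (real n) * S n \<omega>))" for n
  define \<Psi> where "\<Psi> K n = expectation (\<lambda>\<omega>. iexp (\<theta> / sqrt (real n) * SK K n \<omega>))" for K n
  have diff: "cmod (\<Phi> n - \<Psi> K n) \<le> \<bar>\<theta>\<bar> * sqrt (DK K)" if n: "n \<ge> 1" for n K
  proof -
    let ?t = "\<theta> / sqrt (real n)"
    have sq: "(?t * S n \<omega> - ?t * SK K n \<omega>)\<^sup>2 = ?t\<^sup>2 * (R K n \<omega>)\<^sup>2" for \<omega>
      unfolding S_eq[of n \<omega> K] by (simp only: right_diff_distrib[symmetric] power_mult_distrib add_diff_cancel_left')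
    have "cmod (\<Phi> n - \<Psi> K n) \<le> sqrt (expectation (\<lambda>\<omega>. (?t * S n \<omega> - ?t * SK K n \<omega>)\<^sup>2))"
      unfolding \<Phi>_def \<Psi>_def
      by (rule iexp_diff_expectation_le) (use R2 in \<open>simp_all only: sq integrable_mult_right\<close>, measurable)
    also have "expectation (\<lambda>\<omega>. (?t * S n \<omega> - ?t * SK K n \<omega>)\<^sup>2) = ?t\<^sup>2 * expectation (\<lambda>\<omega>. (R K n \<omega>)\<^sup>2)"
      unfolding sq by simp
    also have "\<dots> \<le> ?t\<^sup>2 * (DK K * real n)" by (intro mult_left_mono R2) simp
    also have "\<dots> = \<theta>\<^sup>2 * DK K" using n by (simp add: power_divide)
    finally show ?thesis by (simp add: real_sqrt_mult)
  qed
  have lim\<Psi>: "\<Psi> K \<longlonglongrightarrow> of_real (exp (- (\<theta>\<^sup>2 * ?vK K / 2)))" for K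
  proof -
    have "\<bar>centred (tr K) i \<omega>\<bar> \<le> 2 * real K" for i \<omega>
    proof -
      have tb: "\<bar>tr K x\<bar> \<le> real K" for x by (simp add: tr_def)
      have "\<bar>expectation (\<lambda>\<omega>. tr K (X 0 \<omega>))\<bar> \<le> expectation (\<lambda>\<omega>. \<bar>tr K (X 0 \<omega>)\<bar>)" by (rule integral_abs_bound)
      also have "\<dots> \<le> real K"
        using integrable_f[OF mtr[of K], of 0] tb by (intro integral_le_const) auto
      finally show ?thesis unfolding centred_def using tb[of "X i \<omega>"] by linarith
    qed
    from bounded_clt[OF mtr this, of \<theta>] show ?thesis unfolding \<Psi>_def SK_def .
  qed
  let ?L = "complex_of_real (exp (- (\<theta>\<^sup>2 * ?v / 2)))"
  have "\<Phi> \<longlonglongrightarrow> ?L"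
  proof (rule tendstoI)
    fix e :: real assume e: "e > 0"
    have "(\<lambda>K. \<bar>\<theta>\<bar> * sqrt (DK K) + \<theta>\<^sup>2 / 2 * \<eta> K) \<longlonglongrightarrow> \<bar>\<theta>\<bar> * sqrt 0 + \<theta>\<^sup>2 / 2 * (0 + sqrt 0 + sqrt 0 * D0)"
      unfolding \<eta>_def by (intro tendsto_intros DK0)
    then have "\<forall>\<^sub>F K in sequentially. \<bar>\<theta>\<bar> * sqrt (DK K) + \<theta>\<^sup>2 / 2 * \<eta> K < e / 2"
      using e by (intro order_tendstoD(2)) auto
    then obtain K where K: "\<bar>\<theta>\<bar> * sqrt (DK K) + \<theta>\<^sup>2 / 2 * \<eta> K < e / 2"
      using eventually_happens by fastforce
    have "\<forall>\<^sub>F n in sequentially. dist (\<Psi> K n) (of_real (exp (- (\<theta>\<^sup>2 * ?vK K / 2)))) < e / 2"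
      using tendstoD[OF lim\<Psi>, of "e / 2"] e by simp
    then show "\<forall>\<^sub>F n in sequentially. dist (\<Phi> n) ?L < e"
      using eventually_ge_at_top[of 1]
    proof eventually_elim
      case (elim n)
      have "dist (of_real (exp (- (\<theta>\<^sup>2 * ?vK K / 2)))) ?L = \<bar>exp (- (\<theta>\<^sup>2 * ?vK K / 2)) - exp (- (\<theta>\<^sup>2 * ?v / 2))\<bar>"
        by (simp only: dist_norm norm_of_real flip: of_real_diff)
      also have "\<dots> \<le> \<bar>\<theta>\<^sup>2 * ?vK K / 2 - \<theta>\<^sup>2 * ?v / 2\<bar>"
        using long_run_var_nonneg[OF mom] long_run_var_nonneg[OF mtr] by (intro exp_neg_diff_le) auto
      also have "\<theta>\<^sup>2 * ?vK K / 2 - \<theta>\<^sup>2 * ?v / 2 = - (\<theta>\<^sup>2 / 2 * (?v - ?vK K))" by (simp add: algebra_simps)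
      also have "\<bar>\<dots>\<bar> \<le> \<theta>\<^sup>2 / 2 * \<eta> K"
        using v_diff[of K] by (simp add: abs_mult mult_left_mono)
      finally have "dist (of_real (exp (- (\<theta>\<^sup>2 * ?vK K / 2)))) ?L \<le> \<theta>\<^sup>2 / 2 * \<eta> K" .
      moreover have "dist (\<Phi> n) (\<Psi> K n) \<le> \<bar>\<theta>\<bar> * sqrt (DK K)" using diff[OF elim(2)] by (simp add: dist_norm)
      ultimately show ?case
        using elim(1) K dist_triangle[of "\<Phi> n" ?L "\<Psi> K n"]
          dist_triangle[of "\<Psi> K n" ?L "of_real (exp (- (\<theta>\<^sup>2 * ?vK K / 2)))"] by linarith
    qed
  qed
  then show ?thesis unfolding \<Phi>_def S_def .
qed

end

section \<open>Gaussian smoothing and Fisher information\<close>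

text \<open>Convexity of \<open>S\<close> gives the mean value bound
  \<open>\<bar>F (x + h) u - F x u\<bar> \<le> w u * \<bar>h\<bar>\<close>, so dominated convergence
  applies to the difference quotients along any null sequence.\<close>

lemma has_derivative_integral_dominated:
  fixes F F' :: "real \<Rightarrow> 'a \<Rightarrow> real"
  assumes S: "open S" "convex S" "x \<in> S"
    and deriv: "\<And>y u. y \<in> S \<Longrightarrow> u \<in> space M \<Longrightarrow> ((\<lambda>y. F y u) has_real_derivative F' y u) (at y)"
    and int: "\<And>y. y \<in> S \<Longrightarrow> integrable M (F y)"
    and bound: "\<And>y u. y \<in> S \<Longrightarrow> u \<in> space M \<Longrightarrow> \<bar>F' y u\<bar> \<le> w u"
    and w: "integrable M w" and meas: "F' x \<in> borel_measurable M"
  shows "((\<lambda>y. \<integral>u. F y u \<partial>M) has_real_derivative (\<integral>u. F' x u \<partial>M)) (at x)"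
  unfolding DERIV_def tendsto_at_iff_sequentially
proof (intro allI impI)
  fix h :: "nat \<Rightarrow> real" assume h: "\<forall>i. h i \<in> UNIV - {0}" "h \<longlonglongrightarrow> 0"
  \<comment> \<open>The quotient is set to 0 when \<open>x + h i\<close> lies outside
    \<open>S\<close>, so that every member of the sequence is measurable and dominated, not only
    those from some index on.\<close>
  define q where "q i u = (if x + h i \<in> S then (F (x + h i) u - F x u) / h i else 0)" for i u
  have "(\<lambda>i. x + h i) \<longlonglongrightarrow> x + 0" by (intro tendsto_intros h)
  then have ev: "\<forall>\<^sub>F i in sequentially. x + h i \<in> S"
    using topological_tendstoD[of "\<lambda>i. x + h i" x sequentially S] S by simp
  have "(\<lambda>i. \<integral>u. q i u \<partial>M) \<longlonglongrightarrow> (\<integral>u. F' x u \<partial>M)"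
  proof (rule integral_dominated_convergence[OF meas _ w])
    show "q i \<in> borel_measurable M" for i
      unfolding q_def using int[of "x + h i"] int[of x] S by (cases "x + h i \<in> S") auto
    show "AE u in M. (\<lambda>i. q i u) \<longlonglongrightarrow> F' x u"
    proof (rule AE_I2)
      fix u assume u: "u \<in> space M"
      have "(\<lambda>i. (F (x + h i) u - F x u) / h i) \<longlonglongrightarrow> F' x u"
        using deriv[OF S(3) u] h unfolding DERIV_def tendsto_at_iff_sequentially by (auto simp: o_def)
      then show "(\<lambda>i. q i u) \<longlonglongrightarrow> F' x u"
        by (rule Lim_transform_eventually) (use ev in \<open>auto elim!: eventually_mono simp: q_def\<close>)
    qed
    show "AE u in M. norm (q i u) \<le> w u" for i
    proof (rule AE_I2)
      fix u assume u: "u \<in> space M"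
      show "norm (q i u) \<le> w u"
      proof (cases "x + h i \<in> S")
        case True
        have "norm (F (x + h i) u - F x u) \<le> w u * norm ((x + h i) - x)"
          by (rule field_differentiable_bound[OF S(2), of _ "\<lambda>y. F' y u"])
            (use S True deriv bound u in \<open>auto intro: has_field_derivative_at_within\<close>)
        then show ?thesis using h(1) True by (simp add: q_def divide_le_eq)
      next
        case False
        then show ?thesis using order_trans[OF abs_ge_zero bound[OF S(3) u]] by (simp add: q_def)
      qed
    qed
  qed
  then show "((\<lambda>h. ((\<integral>u. F (x + h) u \<partial>M) - (\<integral>u. F x u \<partial>M)) / h) \<circ> h) \<longlonglongrightarrow> (\<integral>u. F' x u \<partial>M)"
  proof (rule Lim_transform_eventually)
    show "\<forall>\<^sub>F i in sequentially. (\<integral>u. q i u \<partial>M) = ((\<lambda>h. ((\<integral>u. F (x + h) u \<partial>M) - (\<integral>u. F x u \<partial>M)) / h) \<circ> h) i"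
      using ev by eventually_elim (use int S in \<open>simp add: q_def[abs_def]\<close>)
  qed
qed

text \<open>Induction on the coefficients. Multiplication by \<open>x\<close> is paid for with one
  half of the exponent \<open>c\<close>, which is why \<open>c\<close> is arbitrary in the
  induction.\<close>

lemma poly_le_exp_square:
  fixes q :: "real poly"
  assumes "c > 0"
  shows "\<exists>C\<ge>0. \<forall>x. \<bar>poly q x\<bar> \<le> C * exp (c * x\<^sup>2)"
  using assms
proof (induction q arbitrary: c rule: pCons_induct)
  case 0
  show ?case by (intro exI[of _ 0]) simp
next
  case (pCons a q)
  obtain C where C: "C \<ge> 0" "\<And>x. \<bar>poly q x\<bar> \<le> C * exp (c / 2 * x\<^sup>2)"
    using pCons.IH[of "c / 2"] pCons.prems by auto
  have x: "\<bar>x\<bar> \<le> (1 + 2 / c) * exp (c / 2 * x\<^sup>2)" for x :: real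
  proof -
    have e: "1 + c / 2 * x\<^sup>2 \<le> exp (c / 2 * x\<^sup>2)" by (rule exp_ge_add_one_self)
    have e1: "1 \<le> exp (c / 2 * x\<^sup>2)" using pCons.prems by simp
    have "\<bar>x\<bar> \<le> 1 + x\<^sup>2" using sum_squares_bound[of 1 "\<bar>x\<bar>"] by simp
    also have "x\<^sup>2 \<le> 2 / c * exp (c / 2 * x\<^sup>2)" using e pCons.prems by (simp add: field_simps)
    also have "1 + 2 / c * exp (c / 2 * x\<^sup>2) \<le> (1 + 2 / c) * exp (c / 2 * x\<^sup>2)"
      unfolding distrib_right mult_1_left using e1 by linarith
    finally show ?thesis by simp
  qed
  show ?case
  proof (intro exI conjI allI)
    show "0 \<le> \<bar>a\<bar> + (1 + 2 / c) * C" using C pCons.prems by simp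
    fix x :: real
    have "\<bar>poly (pCons a q) x\<bar> \<le> \<bar>a\<bar> + \<bar>x\<bar> * \<bar>poly q x\<bar>"
      by (simp add: abs_mult[symmetric] abs_triangle_ineq)
    also have "\<dots> \<le> \<bar>a\<bar> * exp (c * x\<^sup>2) + ((1 + 2 / c) * exp (c / 2 * x\<^sup>2)) * (C * exp (c / 2 * x\<^sup>2))"
      using C x pCons.prems by (intro add_mono mult_mono) (auto simp: mult_le_cancel_left1)
    also have "((1 + 2 / c) * exp (c / 2 * x\<^sup>2)) * (C * exp (c / 2 * x\<^sup>2)) = (1 + 2 / c) * C * exp (c * x\<^sup>2)"
      by (simp add: mult_ac flip: exp_add)
    finally show "\<bar>poly (pCons a q) x\<bar> \<le> (\<bar>a\<bar> + (1 + 2 / c) * C) * exp (c * x\<^sup>2)"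
      by (simp add: algebra_simps)
  qed
qed

text \<open>The heat kernel, parametrised by the variance \<open>t\<close> and not by the standard
  deviation, since \<open>t\<close> serves as the time variable.\<close>

definition gauss :: "real \<Rightarrow> real \<Rightarrow> real" where
  "gauss t x = exp (- x\<^sup>2 / (2 * t)) / sqrt (2 * pi * t)"

lemma gauss_eq_normal_density: "t > 0 \<Longrightarrow> gauss t = normal_density 0 (sqrt t)"
  by (auto simp: gauss_def normal_density_def)

lemma gauss_measurable [measurable]: "gauss t \<in> borel_measurable borel"
  unfolding gauss_def by measurable

lemma gauss_measurable2 [measurable]: "(\<lambda>x. gauss (f x) (g x)) \<in> borel_measurable N"
  if [measurable]: "f \<in> borel_measurable N" "g \<in> borel_measurable N"
  unfolding gauss_def by measurable

lemma gauss_pos: "t > 0 \<Longrightarrow> 0 < gauss t x"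
  by (simp add: gauss_def)

lemma gauss_le: "t > 0 \<Longrightarrow> gauss t x \<le> 1 / sqrt (2 * pi * t)"
  unfolding gauss_def by (intro divide_right_mono) auto

lemma ln_gauss: "t > 0 \<Longrightarrow> ln (gauss t x) = - x\<^sup>2 / (2 * t) - ln (2 * pi * t) / 2"
  unfolding gauss_def by (simp add: ln_div ln_sqrt)

lemma gauss_integral:
  assumes "t > 0"
  shows "integrable lborel (gauss t)" "(\<integral>x. gauss t x \<partial>lborel) = 1"
  using assms by (simp_all add: gauss_eq_normal_density)

lemma gauss_integral_square:
  assumes "t > 0"
  shows "integrable lborel (\<lambda>x. x\<^sup>2 * gauss t x)" "(\<integral>x. x\<^sup>2 * gauss t x \<partial>lborel) = t"
  using integrable_normal_moment[of "sqrt t" 0 2] integral_normal_moment_even[of "sqrt t" 0 1] assms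
  by (simp_all add: gauss_eq_normal_density mult.commute)

lemma gauss_integral_first:
  assumes "t > 0"
  shows "integrable lborel (\<lambda>x. x * gauss t x)" "(\<integral>x. x * gauss t x \<partial>lborel) = 0"
  using integrable_normal_moment_nz_1[of "sqrt t" 0] integral_normal_moment_nz_1[of "sqrt t" 0] assms
  by (simp_all add: gauss_eq_normal_density mult.commute)

definition poly_gauss :: "real poly \<Rightarrow> real \<Rightarrow> real \<Rightarrow> real" where
  "poly_gauss q t x = poly q x * gauss t x"

text \<open>The polynomial factor in the derivative of \<open>q\<close> times the Gaussian, namely
  \<open>q' - x * q / t\<close>. Polynomials times Gaussians are thus closed under differentiation,
  which handles derivatives of all orders at once.\<close>

definition dpoly :: "real \<Rightarrow> real poly \<Rightarrow> real poly" where
  "dpoly t q = pderiv q - smult (1 / t) (pCons 0 q)"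

lemma gauss_DERIV:
  "t > 0 \<Longrightarrow> (gauss t has_real_derivative (- x / t) * gauss t x) (at x)"
  unfolding gauss_def[abs_def] by (auto intro!: derivative_eq_intros simp: field_simps)

lemma poly_gauss_DERIV:
  "t > 0 \<Longrightarrow> (poly_gauss q t has_real_derivative poly_gauss (dpoly t q) t x) (at x)"
  unfolding poly_gauss_def[abs_def] dpoly_def
  by (auto intro!: derivative_eq_intros gauss_DERIV poly_DERIV simp: algebra_simps)

lemma poly_measurable [measurable]: "(\<lambda>x. poly q (f x)) \<in> borel_measurable N"
  if "f \<in> borel_measurable N" for q :: "real poly"
  by (rule measurable_compose[OF that]) (intro borel_measurable_continuous_onI continuous_intros)

lemma poly_gauss_measurable [measurable]: "poly_gauss q t \<in> borel_measurable borel"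
  unfolding poly_gauss_def by measurable

lemma poly_gauss_bounded:
  assumes "t > 0"
  shows "\<exists>C. \<forall>x. \<bar>poly_gauss q t x\<bar> \<le> C"
proof -
  obtain C where C: "C \<ge> 0" "\<And>x. \<bar>poly q x\<bar> \<le> C * exp (1 / (2 * t) * x\<^sup>2)"
    using poly_le_exp_square[of "1 / (2 * t)" q] assms by auto
  have "\<bar>poly_gauss q t x\<bar> \<le> C / sqrt (2 * pi * t)" for x
  proof -
    have "\<bar>poly_gauss q t x\<bar> = \<bar>poly q x\<bar> * gauss t x"
      unfolding poly_gauss_def abs_mult using gauss_pos[OF assms, of x] by simp
    also have "\<dots> \<le> C * exp (1 / (2 * t) * x\<^sup>2) * gauss t x"
      using C gauss_pos[OF assms, of x] by (intro mult_right_mono) auto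
    also have "\<dots> = C / sqrt (2 * pi * t)"
      by (simp add: gauss_def exp_minus field_simps)
    finally show ?thesis .
  qed
  then show ?thesis by blast
qed

text \<open>The weight \<open>1 + y\<^sup>2\<close> will absorb the quadratic growth of the logarithm of a smoothed
  density.\<close>

lemma gauss_kernels_le:
  assumes "0 < a" "a \<le> b"
  shows "\<exists>C\<ge>0. \<forall>t y. a \<le> t \<longrightarrow> t \<le> b \<longrightarrow>
     (1 + y\<^sup>2) * gauss t y \<le> C * gauss (2 * b) y \<and>
     (1 + y\<^sup>2) * (\<bar>y / t\<bar> * gauss t y) \<le> C * gauss (2 * b) y \<and>
     (1 + y\<^sup>2) * (\<bar>y\<^sup>2 / t\<^sup>2 - 1 / t\<bar> * gauss t y) \<le> C * gauss (2 * b) y"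
proof -
  \<comment> \<open>One factor \<open>1 + x^2\<close> is the weight and the other dominates the
    polynomial factors of the kernels. Absorbing both costs \<open>exp (y^2 / (4 * b))\<close>,
    which is what separates the Gaussian exponents for the variances \<open>b\<close> and
    \<open>2 * b\<close>.\<close>
  define q :: "real poly" where "q = [:1, 0, 1:] * [:1, 0, 1:]"
  obtain C where C: "C \<ge> 0" "\<And>x. \<bar>poly q x\<bar> \<le> C * exp (1 / (4 * b) * x\<^sup>2)"
    using poly_le_exp_square[of "1 / (4 * b)" q] assms by auto
  have q: "poly q x = (1 + x\<^sup>2) * (1 + x\<^sup>2)" for x
    by (simp add: q_def power2_eq_square algebra_simps)
  define c where "c = 1 + 1 / a + 1 / a\<^sup>2"
  define C' where "C' = c * (C * sqrt (2 * pi * (2 * b)) / sqrt (2 * pi * a))"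
  have c: "c \<ge> 1" "1 / a \<le> c" "1 / a\<^sup>2 + 1 / a \<le> c" unfolding c_def using assms by auto
  have main: "(1 + y\<^sup>2) * (k * gauss t y) \<le> C' * gauss (2 * b) y"
    if t: "a \<le> t" "t \<le> b" and k: "0 \<le> k" "k \<le> c * (1 + y\<^sup>2)" for t y k
  proof -
    have g: "gauss t y \<le> exp (- y\<^sup>2 / (2 * b)) / sqrt (2 * pi * a)"
      unfolding gauss_def using assms t
      by (intro frac_le) (auto intro: mult_left_mono divide_left_mono)
    have "(1 + y\<^sup>2) * (k * gauss t y) \<le> (1 + y\<^sup>2) * ((c * (1 + y\<^sup>2)) * (exp (- y\<^sup>2 / (2 * b)) / sqrt (2 * pi * a)))"
      using k g gauss_pos[of t y] assms t c by (intro mult_left_mono mult_mono) auto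
    also have "\<dots> = c / sqrt (2 * pi * a) * \<bar>poly q y\<bar> * exp (- y\<^sup>2 / (2 * b))"
      by (simp add: q)
    also have "\<dots> \<le> c / sqrt (2 * pi * a) * (C * exp (1 / (4 * b) * y\<^sup>2)) * exp (- y\<^sup>2 / (2 * b))"
      using C(2)[of y] c assms by (intro mult_right_mono mult_left_mono) auto
    also have "\<dots> = c / sqrt (2 * pi * a) * C * exp (1 / (4 * b) * y\<^sup>2 + - y\<^sup>2 / (2 * b))"
      by (simp only: exp_add mult.assoc)
    also have "1 / (4 * b) * y\<^sup>2 + - y\<^sup>2 / (2 * b) = - y\<^sup>2 / (2 * (2 * b))"
      using assms by (simp add: field_simps)
    also have "c / sqrt (2 * pi * a) * C * exp (- y\<^sup>2 / (2 * (2 * b))) = C' * gauss (2 * b) y"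
      using assms by (simp add: C'_def gauss_def)
    finally show ?thesis .
  qed
  show ?thesis
  proof (intro exI[of _ C'] conjI allI impI)
    show "0 \<le> C'" unfolding C'_def using C c assms by simp
    fix t y :: real assume t: "a \<le> t" "t \<le> b"
    have cy: "c \<le> c * (1 + y\<^sup>2)" using c by (simp add: mult_le_cancel_left1)
    show "(1 + y\<^sup>2) * gauss t y \<le> C' * gauss (2 * b) y"
      using main[OF t, of 1 y] c cy by simp
    have y1: "\<bar>y\<bar> \<le> 1 + y\<^sup>2" using sum_squares_bound[of 1 "\<bar>y\<bar>"] by simp
    have "\<bar>y / t\<bar> = 1 / t * \<bar>y\<bar>" using assms t by (simp add: abs_divide)
    also have "\<dots> \<le> c * (1 + y\<^sup>2)"
      using assms t c y1 by (intro mult_mono order_trans[OF divide_left_mono[of a t 1] c(2)]) auto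
    finally show "(1 + y\<^sup>2) * (\<bar>y / t\<bar> * gauss t y) \<le> C' * gauss (2 * b) y"
      using main[OF t, of "\<bar>y / t\<bar>" y] by simp
    have i: "1 / t \<le> 1 / a" "1 / t\<^sup>2 \<le> 1 / a\<^sup>2"
      using assms t by (auto intro!: divide_left_mono power_mono)
    have "\<bar>y\<^sup>2 / t\<^sup>2 - 1 / t\<bar> \<le> 1 / t\<^sup>2 * y\<^sup>2 + 1 / t"
      using assms t abs_triangle_ineq4[of "y\<^sup>2 / t\<^sup>2" "1 / t"] by simp
    also have "\<dots> \<le> 1 / a\<^sup>2 * y\<^sup>2 + 1 / a" using i by (intro add_mono mult_right_mono) auto
    also have "\<dots> \<le> (1 / a\<^sup>2 + 1 / a) * (1 + y\<^sup>2)" using assms by (simp add: algebra_simps add_divide_distrib)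
    also have "\<dots> \<le> c * (1 + y\<^sup>2)" using c by (intro mult_right_mono) auto
    finally show "(1 + y\<^sup>2) * (\<bar>y\<^sup>2 / t\<^sup>2 - 1 / t\<bar> * gauss t y) \<le> C' * gauss (2 * b) y"
      using main[OF t, of "\<bar>y\<^sup>2 / t\<^sup>2 - 1 / t\<bar>" y] by simp
  qed
qed

text \<open>The heat equation: \<open>(y^2 / t^2 - 1 / t) * gauss t y\<close> is the second
  derivative in space. The kernel is written as the exponential of its logarithm, whose dependence
  on \<open>t\<close> is elementary.\<close>

lemma gauss_DERIV_time:
  assumes "t > 0"
  shows "((\<lambda>t. gauss t y) has_real_derivative 1 / 2 * ((y\<^sup>2 / t\<^sup>2 - 1 / t) * gauss t y)) (at t)"
proof -
  let ?A = "\<lambda>s. - y\<^sup>2 / (2 * s) - ln (2 * pi * s) / 2"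
  have g: "exp (?A s) = gauss s y" if "s > 0" for s
    using ln_gauss[OF that, of y] gauss_pos[OF that, of y] by (metis exp_ln)
  have "\<forall>\<^sub>F s in nhds t. s > 0"
    using eventually_nhds_in_open[of "{0<..}" t] assms by simp
  then have ev: "\<forall>\<^sub>F s in nhds t. exp (?A s) = gauss s y"
    by (rule eventually_mono) (rule g)
  have "(?A has_real_derivative 1 / 2 * (y\<^sup>2 / t\<^sup>2 - 1 / t)) (at t)"
    using assms by (auto intro!: derivative_eq_intros simp: field_simps power2_eq_square)
  then have "((\<lambda>s. exp (?A s)) has_real_derivative exp (?A t) * (1 / 2 * (y\<^sup>2 / t\<^sup>2 - 1 / t))) (at t)"
    by (rule DERIV_fun_exp)
  then show ?thesis
    using DERIV_cong_ev[OF refl ev refl] g[OF assms] by (simp add: mult_ac)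
qed

lemma continuous_AE_eq:
  fixes f g :: "real \<Rightarrow> real"
  assumes "continuous_on UNIV f" "continuous_on UNIV g" "AE x in lborel. f x = g x"
  shows "f = g"
proof -
  have op: "open {x. f x \<noteq> g x}" using assms by (intro open_Collect_neq) auto
  then have "{x. f x \<noteq> g x} \<in> null_sets lborel"
    using assms(3) AE_iff_null[of lborel "\<lambda>x. f x = g x"] by simp
  then have neg: "negligible {x. f x \<noteq> g x}"
    by (simp add: negligible_iff_null_sets null_sets_completionI)
  show ?thesis
  proof (rule ccontr)
    assume "f \<noteq> g"
    then have "{x. f x \<noteq> g x} \<noteq> {}" by auto
    from open_not_negligible[OF op this] neg show False by simp
  qed
qed

lemma lborel_integral_shift:
  fixes g :: "real \<Rightarrow> real"
  shows "integrable lborel (\<lambda>x. g (x - u)) \<longleftrightarrow> integrable lborel g"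
    and "(\<integral>x. g (x - u) \<partial>lborel) = (\<integral>x. g x \<partial>lborel)"
proof -
  have eq: "(\<lambda>x. g (x - u)) = (\<lambda>x. g (- u + 1 * x))" by simp
  show "integrable lborel (\<lambda>x. g (x - u)) \<longleftrightarrow> integrable lborel g"
    unfolding eq by (rule lborel_integrable_real_affine_iff) simp
  show "(\<integral>x. g (x - u) \<partial>lborel) = (\<integral>x. g x \<partial>lborel)"
    unfolding eq using lborel_integral_real_affine[of 1 g "- u"] by simp
qed

text \<open>Fubini's theorem for a convolution in which the law carries an additional weight
  \<open>h\<close>. The weights 1, \<open>u\<close> and \<open>u^2\<close> yield the total mass and
  the second moment of the smoothed density, and a quadratic weight yields an integrable
  majorant.\<close>

lemma (in real_distribution) conv_integral:
  fixes g h :: "real \<Rightarrow> real"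
  assumes g: "integrable lborel g" and h: "integrable M h"
  shows "integrable (M \<Otimes>\<^sub>M lborel) (\<lambda>(u, x). h u * g (x - u))"
    and "integrable lborel (\<lambda>x. \<integral>u. h u * g (x - u) \<partial>M)"
    and "(\<integral>x. (\<integral>u. h u * g (x - u) \<partial>M) \<partial>lborel) = (\<integral>u. h u \<partial>M) * (\<integral>x. g x \<partial>lborel)"
    and "AE x in lborel. integrable M (\<lambda>u. h u * g (x - u))"
proof -
  have [measurable]: "g \<in> borel_measurable borel" "h \<in> borel_measurable borel"
    using g h by (auto dest: borel_measurable_integrable)
  have [measurable_cong]: "sets M = sets borel" by simp
  interpret pair_sigma_finite M lborel ..
  have sh: "integrable lborel (\<lambda>x. g (x - u))" for u using g lborel_integral_shift(1) by blast
  show pr: "integrable (M \<Otimes>\<^sub>M lborel) (\<lambda>(u, x). h u * g (x - u))"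
  proof (rule Fubini_integrable)
    show "(\<lambda>(u, x). h u * g (x - u)) \<in> borel_measurable (M \<Otimes>\<^sub>M lborel)" by measurable
    have "(\<integral>x. norm (h u * g (x - u)) \<partial>lborel) = norm (h u) * (\<integral>x. norm (g x) \<partial>lborel)" for u
      using lborel_integral_shift(2)[of "\<lambda>x. norm (g x)" u] by (simp add: abs_mult)
    then show "integrable M (\<lambda>u. \<integral>x. norm (case (u, x) of (u, x) \<Rightarrow> h u * g (x - u)) \<partial>lborel)"
      using h by simp
    show "AE u in M. integrable lborel (\<lambda>x. case (u, x) of (u, x) \<Rightarrow> h u * g (x - u))"
      using sh by simp
  qed
  show "integrable lborel (\<lambda>x. \<integral>u. h u * g (x - u) \<partial>M)"
    using integrable_snd[OF pr] .
  show "AE x in lborel. integrable M (\<lambda>u. h u * g (x - u))"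
    using AE_integrable_snd[OF pr] .
  have "(\<integral>x. (\<integral>u. h u * g (x - u) \<partial>M) \<partial>lborel) = (\<integral>u. (\<integral>x. h u * g (x - u) \<partial>lborel) \<partial>M)"
    using Fubini_integral[OF pr] by simp
  also have "\<dots> = (\<integral>u. h u * (\<integral>x. g x \<partial>lborel) \<partial>M)"
    by (simp add: lborel_integral_shift(2))
  finally show "(\<integral>x. (\<integral>u. h u * g (x - u) \<partial>M) \<partial>lborel) = (\<integral>u. h u \<partial>M) * (\<integral>x. g x \<partial>lborel)"
    by simp
qed

section \<open>Smoothed densities, their derivatives and their Fisher information\<close>

locale gauss_smoothing = real_distribution \<mu> for \<mu> :: "real measure" +
  assumes square_integrable: "integrable \<mu> (\<lambda>u. u\<^sup>2)"
begin

definition second_moment :: real where "second_moment = (\<integral>u. u\<^sup>2 \<partial>\<mu>)"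

lemma second_moment_nonneg: "0 \<le> second_moment"
  unfolding second_moment_def by (rule integral_nonneg_AE) simp

lemma borel_measurable_mu [measurable_cong]: "sets \<mu> = sets borel"
  by simp

lemma prob_UNIV: "prob UNIV = 1"
  using prob_space by simp

lemma integrable_id: "integrable \<mu> (\<lambda>u. u)"
  by (rule square_integrable_imp_integrable[OF _ square_integrable]) simp

text \<open>A family closed under differentiation that contains the smoothed density and its first
  two derivatives, by \<open>dens_eq\<close>; it makes smoothness an induction.\<close>

definition conv_poly :: "real poly \<Rightarrow> real \<Rightarrow> real \<Rightarrow> real" where
  "conv_poly q t x = (\<integral>u. poly_gauss q t (x - u) \<partial>\<mu>)"

definition dens :: "real \<Rightarrow> real \<Rightarrow> real" where
  "dens t x = (\<integral>u. gauss t (x - u) \<partial>\<mu>)"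

definition dens1 :: "real \<Rightarrow> real \<Rightarrow> real" where
  "dens1 t x = (\<integral>u. - ((x - u) / t) * gauss t (x - u) \<partial>\<mu>)"

definition dens2 :: "real \<Rightarrow> real \<Rightarrow> real" where
  "dens2 t x = (\<integral>u. ((x - u)\<^sup>2 / t\<^sup>2 - 1 / t) * gauss t (x - u) \<partial>\<mu>)"

lemma dens_eq: "dens t = conv_poly 1 t" "dens1 t = conv_poly (dpoly t 1) t"
    "dens2 t = conv_poly (dpoly t (dpoly t 1)) t"
  by (auto simp: fun_eq_iff dens_def dens1_def dens2_def conv_poly_def poly_gauss_def dpoly_def
    pderiv_pCons one_pCons power2_eq_square field_simps)

lemma integrable_poly_gauss: "t > 0 \<Longrightarrow> integrable \<mu> (\<lambda>u. poly_gauss q t (x - u))"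
proof -
  assume "t > 0"
  then obtain C where "\<And>x. \<bar>poly_gauss q t x\<bar> \<le> C" using poly_gauss_bounded by blast
  then show ?thesis by (intro integrable_const_bound[where B=C]) auto
qed

lemma conv_poly_DERIV:
  assumes "t > 0"
  shows "(conv_poly q t has_real_derivative conv_poly (dpoly t q) t x) (at x)"
proof -
  obtain C where C: "\<And>x. \<bar>poly_gauss (dpoly t q) t x\<bar> \<le> C" using poly_gauss_bounded[OF assms] by blast
  have "((\<lambda>y. \<integral>u. poly_gauss q t (y - u) \<partial>\<mu>) has_real_derivative (\<integral>u. poly_gauss (dpoly t q) t (x - u) \<partial>\<mu>)) (at x)"
  proof (rule has_derivative_integral_dominated[where S=UNIV and w="\<lambda>_. C"])
    fix y u
    show "((\<lambda>y. poly_gauss q t (y - u)) has_real_derivative poly_gauss (dpoly t q) t (y - u)) (at y)"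
      using poly_gauss_DERIV[OF assms, of q "y - u"] DERIV_shift[of "poly_gauss q t" _ y "- u"] by simp
  qed (use assms C integrable_poly_gauss in auto)
  then show ?thesis by (simp add: conv_poly_def[abs_def])
qed

lemma deriv_conv_poly: "t > 0 \<Longrightarrow> deriv (conv_poly q t) = conv_poly (dpoly t q) t"
  using conv_poly_DERIV by (auto intro!: DERIV_imp_deriv)

lemma dens_DERIV:
  assumes "t > 0"
  shows "(dens t has_real_derivative dens1 t x) (at x)" "(dens1 t has_real_derivative dens2 t x) (at x)"
  using conv_poly_DERIV[OF assms] by (simp_all add: dens_eq)

lemma continuous_conv_poly: "t > 0 \<Longrightarrow> continuous_on A (conv_poly q t)"
  using conv_poly_DERIV by (meson DERIV_continuous continuous_at_imp_continuous_on)

lemma smooth_dens: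
  assumes "t > 0"
  shows "smooth (dens t)"
proof -
  have "(deriv ^^ k) (conv_poly q t) = conv_poly ((dpoly t ^^ k) q) t" for k q
    by (induction k arbitrary: q) (auto simp: funpow_swap1 deriv_conv_poly[OF assms])
  then show ?thesis
    unfolding smooth_def dens_eq
    using conv_poly_DERIV[OF assms]
    by (auto simp: differentiable_on_def real_differentiable_def intro!: exI conv_poly_DERIV[OF assms])
qed

text \<open>Joint measurability in time and space serves to exchange the two integrals in the de
  Bruijn identity and to integrate \<open>fisher\<close> over time.\<close>

lemma conv_measurable2:
  fixes f :: "real \<Rightarrow> real \<Rightarrow> real \<Rightarrow> real"
  assumes [measurable]: "(\<lambda>x. f (fst x) (fst (snd x)) (snd (snd x))) \<in> borel_measurable (borel \<Otimes>\<^sub>M (borel \<Otimes>\<^sub>M borel))"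
  shows "(\<lambda>x. \<integral>u. f (fst x) (snd x) u \<partial>\<mu>) \<in> borel_measurable (borel \<Otimes>\<^sub>M borel)"
proof -
  have "(\<lambda>z. (fst (fst z), snd (fst z), snd z)) \<in> (borel \<Otimes>\<^sub>M borel) \<Otimes>\<^sub>M \<mu> \<rightarrow>\<^sub>M borel \<Otimes>\<^sub>M (borel \<Otimes>\<^sub>M (borel :: real measure))"
    by measurable
  from measurable_compose[OF this assms]
  have "(\<lambda>(x, y). f (fst x) (snd x) y) \<in> borel_measurable ((borel \<Otimes>\<^sub>M borel) \<Otimes>\<^sub>M \<mu>)"
    by (simp add: case_prod_beta')
  then show ?thesis by (rule borel_measurable_lebesgue_integral)
qed

lemma dens_measurable2:
  "(\<lambda>x. dens (fst x) (snd x)) \<in> borel_measurable (borel \<Otimes>\<^sub>M borel)"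
  "(\<lambda>x. dens1 (fst x) (snd x)) \<in> borel_measurable (borel \<Otimes>\<^sub>M borel)"
  "(\<lambda>x. dens2 (fst x) (snd x)) \<in> borel_measurable (borel \<Otimes>\<^sub>M borel)"
  unfolding dens_def dens1_def dens2_def by (rule conv_measurable2; measurable)+

lemma dens_measurable [measurable]:
  assumes "f \<in> borel_measurable N" "g \<in> borel_measurable N"
  shows "(\<lambda>x. dens (f x) (g x)) \<in> borel_measurable N"
    "(\<lambda>x. dens1 (f x) (g x)) \<in> borel_measurable N"
    "(\<lambda>x. dens2 (f x) (g x)) \<in> borel_measurable N"
  using measurable_compose[OF measurable_Pair[OF assms] dens_measurable2(1)]
    measurable_compose[OF measurable_Pair[OF assms] dens_measurable2(2)]
    measurable_compose[OF measurable_Pair[OF assms] dens_measurable2(3)] by simp_all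

lemma integrable_kernels:
  assumes "t > 0"
  shows "integrable \<mu> (\<lambda>u. gauss t (x - u))"
    "integrable \<mu> (\<lambda>u. - ((x - u) / t) * gauss t (x - u))"
    "integrable \<mu> (\<lambda>u. (x - u)\<^sup>2 * gauss t (x - u))"
    "integrable \<mu> (\<lambda>u. ((x - u)\<^sup>2 / t\<^sup>2 - 1 / t) * gauss t (x - u))"
  using integrable_poly_gauss[OF assms, of 1 x] integrable_poly_gauss[OF assms, of "[:0, - 1 / t:]" x]
    integrable_poly_gauss[OF assms, of "[:0, 0, 1:]" x] integrable_poly_gauss[OF assms, of "[:- 1 / t, 0, 1 / t\<^sup>2:]" x]
  by (simp_all add: poly_gauss_def power2_eq_square algebra_simps)

text \<open>Jensen's inequality for the logarithm, in the form \<open>exp y \<ge> exp m * (1 + y - m)\<close> with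
  \<open>m\<close> the mean of the exponent.\<close>

lemma dens_lower:
  assumes "t > 0"
  shows "exp (- ((x\<^sup>2 + second_moment) / t) - ln (2 * pi * t) / 2) \<le> dens t x"
proof -
  have i: "integrable \<mu> (\<lambda>u. (x - u)\<^sup>2)"
    unfolding power2_diff using integrable_id square_integrable by simp
  define e where "e u = - (x - u)\<^sup>2 / (2 * t) - ln (2 * pi * t) / 2" for u
  have g: "gauss t (x - u) = exp (e u)" for u
    unfolding e_def using ln_gauss[OF assms, of "x - u"] gauss_pos[OF assms, of "x - u"] by (metis exp_ln)
  define m where "m = (\<integral>u. e u \<partial>\<mu>)"
  have ie: "integrable \<mu> e" unfolding e_def using i by simp
  have "(\<integral>u. exp m * (1 + (e u - m)) \<partial>\<mu>) \<le> (\<integral>u. gauss t (x - u) \<partial>\<mu>)"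
  proof (rule integral_mono)
    fix u
    have "exp m * (1 + (e u - m)) \<le> exp m * exp (e u - m)"
      by (intro mult_left_mono exp_ge_add_one_self) simp
    then show "exp m * (1 + (e u - m)) \<le> gauss t (x - u)" by (simp add: g flip: exp_add)
  qed (use ie integrable_kernels[OF assms] in auto)
  then have "exp m \<le> dens t x"
    using ie by (simp add: m_def dens_def prob_UNIV)
  moreover have "- ((x\<^sup>2 + second_moment) / t) - ln (2 * pi * t) / 2 \<le> m"
  proof -
    have "(\<integral>u. (x - u)\<^sup>2 \<partial>\<mu>) \<le> (\<integral>u. 2 * x\<^sup>2 + 2 * u\<^sup>2 \<partial>\<mu>)"
    proof (rule integral_mono)
      fix u
      show "(x - u)\<^sup>2 \<le> 2 * x\<^sup>2 + 2 * u\<^sup>2"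
        using zero_le_power2[of "x + u"] by (simp add: power2_diff power2_sum)
    qed (use i square_integrable in auto)
    also have "\<dots> = 2 * (x\<^sup>2 + second_moment)"
      using square_integrable by (simp add: second_moment_def prob_UNIV)
    finally have "(\<integral>u. (x - u)\<^sup>2 \<partial>\<mu>) / (2 * t) \<le> (x\<^sup>2 + second_moment) / t"
      using assms by (simp add: field_simps)
    moreover have "m = - ((\<integral>u. (x - u)\<^sup>2 \<partial>\<mu>) / (2 * t)) - ln (2 * pi * t) / 2"
      unfolding m_def e_def using i by (simp add: prob_UNIV)
    ultimately show ?thesis by linarith
  qed
  ultimately show ?thesis by (meson exp_le_cancel_iff order_trans)
qed

lemma dens_pos: "t > 0 \<Longrightarrow> 0 < dens t x"
  using dens_lower[of t x] by (rule less_le_trans[OF exp_gt_zero])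

lemma dens_le:
  assumes "t > 0"
  shows "dens t x \<le> 1 / sqrt (2 * pi * t)"
  unfolding dens_def using assms by (intro integral_le_const integrable_kernels) (auto simp: gauss_le)

text \<open>The upper bound comes from the height of the kernel and the lower one from
  \<open>dens_lower\<close>; both are uniform for \<open>t\<close> between \<open>a\<close> and
  \<open>b\<close>.\<close>

lemma abs_ln_dens_le:
  assumes "0 < a"
  shows "\<exists>C\<ge>0. \<forall>t x. a \<le> t \<longrightarrow> t \<le> b \<longrightarrow> \<bar>ln (dens t x)\<bar> \<le> C * (1 + x\<^sup>2)"
proof -
  define L where "L = \<bar>ln (2 * pi * a)\<bar> + \<bar>ln (2 * pi * b)\<bar>"
  define C where "C = L + (1 + second_moment) / a"
  have C0: "0 \<le> C" unfolding C_def L_def using second_moment_nonneg assms by simp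
  have "\<bar>ln (dens t x)\<bar> \<le> C * (1 + x\<^sup>2)" if t: "a \<le> t" "t \<le> b" for t x
  proof -
    have t0: "t > 0" using assms t by simp
    have "ln (2 * pi * a) \<le> ln (2 * pi * t)" "ln (2 * pi * t) \<le> ln (2 * pi * b)"
      using assms t by auto
    then have l: "\<bar>ln (2 * pi * t)\<bar> \<le> L" unfolding L_def by linarith
    have "ln (dens t x) \<le> ln (1 / sqrt (2 * pi * t))"
      using dens_pos[OF t0] dens_le[OF t0] t0 by (intro ln_mono) auto
    also have "\<dots> = - ln (2 * pi * t) / 2" using t0 by (simp add: ln_div ln_sqrt)
    finally have u: "ln (dens t x) \<le> L" using l by linarith
    have "- ((x\<^sup>2 + second_moment) / t) - ln (2 * pi * t) / 2 \<le> ln (dens t x)"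
      using dens_lower[OF t0, of x] dens_pos[OF t0, of x] by (metis exp_gt_zero ln_exp ln_le_cancel_iff)
    moreover have "(x\<^sup>2 + second_moment) / t \<le> (x\<^sup>2 + second_moment) / a"
      using assms t second_moment_nonneg by (intro divide_left_mono) auto
    ultimately have "- ((x\<^sup>2 + second_moment) / a) - L \<le> ln (dens t x)" using l by linarith
    then have "\<bar>ln (dens t x)\<bar> \<le> L + (x\<^sup>2 + second_moment) / a"
      using u assms second_moment_nonneg by (auto simp: abs_le_iff intro: add_increasing2)
    also have "\<dots> \<le> C * (1 + x\<^sup>2)"
    proof -
      have "C * (1 + x\<^sup>2) - (L + (x\<^sup>2 + second_moment) / a) = L * x\<^sup>2 + (1 + second_moment * x\<^sup>2) / a"
        using assms by (simp add: C_def field_simps)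
      moreover have "0 \<le> L * x\<^sup>2 + (1 + second_moment * x\<^sup>2) / a"
        using assms second_moment_nonneg by (simp add: L_def)
      ultimately show ?thesis by linarith
    qed
    finally show ?thesis .
  qed
  with C0 show ?thesis by blast
qed

lemma dens_integral:
  assumes "t > 0"
  shows "integrable lborel (dens t)" "(\<integral>x. dens t x \<partial>lborel) = 1"
  using conv_integral[OF gauss_integral(1)[OF assms], of "\<lambda>_. 1"] gauss_integral(2)[OF assms]
  by (simp_all add: dens_def[abs_def] prob_UNIV)

text \<open>Writes \<open>x = u + (x - u)\<close> and expands the square. The mixed term integrates
  to 0 because the noise is centred, so second moments add.\<close>

lemma dens_second_moment:
  assumes "t > 0"
  shows "integrable lborel (\<lambda>x. x\<^sup>2 * dens t x)" "(\<integral>x. x\<^sup>2 * dens t x \<partial>lborel) = second_moment + t"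
proof -
  let ?A = "\<lambda>x. \<integral>u. u\<^sup>2 * gauss t (x - u) \<partial>\<mu>"
  let ?B = "\<lambda>x. \<integral>u. u * ((x - u) * gauss t (x - u)) \<partial>\<mu>"
  let ?C = "\<lambda>x. \<integral>u. 1 * ((x - u)\<^sup>2 * gauss t (x - u)) \<partial>\<mu>"
  note A = conv_integral[OF gauss_integral(1)[OF assms] square_integrable]
  note B = conv_integral[OF gauss_integral_first(1)[OF assms] integrable_id]
  have i1: "integrable \<mu> (\<lambda>_. 1 :: real)" by simp
  note C = conv_integral[OF gauss_integral_square(1)[OF assms] i1]
  have eq: "AE x in lborel. x\<^sup>2 * dens t x = ?A x + 2 * ?B x + ?C x"
    using A(4) B(4) C(4)
  proof eventually_elim
    case (elim x)
    have "x\<^sup>2 * dens t x = (\<integral>u. x\<^sup>2 * gauss t (x - u) \<partial>\<mu>)" by (simp add: dens_def)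
    also have "\<dots> = (\<integral>u. u\<^sup>2 * gauss t (x - u) + 2 * (u * ((x - u) * gauss t (x - u))) + 1 * ((x - u)\<^sup>2 * gauss t (x - u)) \<partial>\<mu>)"
      by (rule Bochner_Integration.integral_cong) (auto simp: power2_eq_square algebra_simps)
    also have "\<dots> = ?A x + 2 * ?B x + ?C x" using elim by simp
    finally show ?case .
  qed
  have i: "integrable lborel (\<lambda>x. ?A x + 2 * ?B x + ?C x)"
    using A(2) B(2) C(2) by (intro Bochner_Integration.integrable_add integrable_mult_right) auto
  have "(\<lambda>x. x\<^sup>2 * dens t x) \<in> borel_measurable lborel" by measurable
  note m = this borel_measurable_integrable[OF i]
  show "integrable lborel (\<lambda>x. x\<^sup>2 * dens t x)"
    using integrable_cong_AE[OF m eq] i by blast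
  have "(\<integral>x. x\<^sup>2 * dens t x \<partial>lborel) = (\<integral>x. ?A x + 2 * ?B x + ?C x \<partial>lborel)"
    by (rule integral_cong_AE[OF m eq])
  also have "\<dots> = (\<integral>x. ?A x \<partial>lborel) + 2 * (\<integral>x. ?B x \<partial>lborel) + (\<integral>x. ?C x \<partial>lborel)"
    using A(2) B(2) C(2) by simp
  also have "\<dots> = second_moment + t"
    unfolding A(3) B(3) C(3) gauss_integral(2)[OF assms] gauss_integral_first(2)[OF assms] gauss_integral_square(2)[OF assms]
    by (simp add: second_moment_def prob_UNIV)
  finally show "(\<integral>x. x\<^sup>2 * dens t x \<partial>lborel) = second_moment + t" .
qed

definition fisher :: "real \<Rightarrow> real" where
  "fisher t = (\<integral>x. (dens1 t x)\<^sup>2 / dens t x \<partial>lborel)"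

text \<open>The average over \<open>u\<close> of the squared score of the noise, weighted by the
  density of the noise. Its integral \<open>1 / t\<close> is the Fisher information of the noise
  alone.\<close>

definition fisher_majorant :: "real \<Rightarrow> real \<Rightarrow> real" where
  "fisher_majorant t x = (\<integral>u. ((x - u)\<^sup>2 * gauss t (x - u)) \<partial>\<mu>) / t\<^sup>2"

lemma fisher_majorant_integral:
  assumes "t > 0"
  shows "integrable lborel (fisher_majorant t)" "(\<integral>x. fisher_majorant t x \<partial>lborel) = 1 / t"
proof -
  have i1: "integrable \<mu> (\<lambda>_. 1 :: real)" by simp
  note C = conv_integral[OF gauss_integral_square(1)[OF assms] i1]
  show "integrable lborel (fisher_majorant t)" "(\<integral>x. fisher_majorant t x \<partial>lborel) = 1 / t"
    using C(2,3) assms gauss_integral_square(2)[OF assms]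
    by (simp_all add: fisher_majorant_def[abs_def] prob_UNIV power2_eq_square)
qed

text \<open>At a given \<open>x\<close>, the score \<open>c\<close> of the smoothed density is the
  mean of \<open>- (x - u) / t\<close> under the weights \<open>gauss t (x - u)\<close>. Expanding
  the weighted square of the deviation from \<open>c\<close> gives the Cauchy-Schwarz inequality in
  this form.\<close>

lemma score_le_majorant:
  assumes "t > 0"
  shows "(dens1 t x)\<^sup>2 / dens t x \<le> fisher_majorant t x"
proof -
  let ?p = "dens t x" and ?d = "dens1 t x"
  define c where "c = ?d / ?p"
  note k = integrable_kernels[OF assms, of x]
  have p: "?p > 0" by (rule dens_pos[OF assms])
  have k': "integrable \<mu> (\<lambda>u. 1 / t\<^sup>2 * ((x - u)\<^sup>2 * gauss t (x - u)))" "integrable \<mu> (\<lambda>u. c * (- ((x - u) / t) * gauss t (x - u)))"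
    "integrable \<mu> (\<lambda>u. c\<^sup>2 * gauss t (x - u))"
    using k by (intro integrable_mult_right; simp)+
  have "0 \<le> (\<integral>u. (- ((x - u) / t) - c)\<^sup>2 * gauss t (x - u) \<partial>\<mu>)"
    using gauss_pos[OF assms] by (intro integral_nonneg_AE AE_I2 mult_nonneg_nonneg less_imp_le[OF gauss_pos[OF assms]]) auto
  also have "(\<integral>u. (- ((x - u) / t) - c)\<^sup>2 * gauss t (x - u) \<partial>\<mu>)
     = (\<integral>u. 1 / t\<^sup>2 * ((x - u)\<^sup>2 * gauss t (x - u)) - 2 * (c * (- ((x - u) / t) * gauss t (x - u))) + c\<^sup>2 * gauss t (x - u) \<partial>\<mu>)"
    by (rule Bochner_Integration.integral_cong) (use assms in \<open>auto simp: power2_eq_square field_simps\<close>)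
  also have "\<dots> = fisher_majorant t x - 2 * (c * ?d) + c\<^sup>2 * ?p"
    using k' unfolding fisher_majorant_def dens_def dens1_def
    by (simp only: Bochner_Integration.integral_add Bochner_Integration.integral_diff Bochner_Integration.integrable_diff
      integrable_mult_right integral_mult_right_zero) simp
  also have "\<dots> = fisher_majorant t x - ?d\<^sup>2 / ?p"
    using p by (simp add: c_def power2_eq_square field_simps)
  finally show ?thesis by simp
qed

lemma fisher_integrable:
  assumes "t > 0"
  shows "integrable lborel (\<lambda>x. (dens1 t x)\<^sup>2 / dens t x)"
  by (rule Bochner_Integration.integrable_bound[OF fisher_majorant_integral(1)[OF assms]])
    (use score_le_majorant[OF assms] dens_pos[OF assms] in \<open>auto intro!: AE_I2 order_trans[OF _ abs_ge_self] simp: less_imp_le\<close>)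

lemma fisher_nonneg: "t > 0 \<Longrightarrow> 0 \<le> fisher t"
  unfolding fisher_def by (intro integral_nonneg_AE AE_I2 divide_nonneg_nonneg less_imp_le[OF dens_pos]) auto

lemma fisher_le:
  assumes "t > 0"
  shows "fisher t \<le> 1 / t"
  unfolding fisher_def fisher_majorant_integral(2)[OF assms, symmetric]
  by (rule integral_mono[OF fisher_integrable[OF assms] fisher_majorant_integral(1)[OF assms] score_le_majorant[OF assms]])

lemma fisher_measurable [measurable]: "fisher \<in> borel_measurable borel"
proof -
  have "(\<lambda>t. \<integral>x. (dens1 t x)\<^sup>2 / dens t x \<partial>lborel) \<in> borel_measurable borel"
    by (rule lborel.borel_measurable_lebesgue_integral) measurable
  then show ?thesis by (simp add: fisher_def[abs_def])
qed

end

section \<open>The de Bruijn identity\<close>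

lemma real_distribution_uniform: "real_distribution (uniform_measure lborel {- 1..0 :: real})"
proof -
  have "prob_space (uniform_measure lborel {- 1..0 :: real})"
    by (rule prob_space_uniform_measure) auto
  then show ?thesis by (simp add: real_distribution_def real_distribution_axioms_def)
qed

text \<open>The integral of \<open>F'\<close> equals that of the difference \<open>F (x + 1) - F x\<close>, which is a
  convolution of \<open>F'\<close> with a uniform distribution.\<close>

lemma integral_derivative_eq_0:
  fixes F F' :: "real \<Rightarrow> real"
  assumes deriv: "\<And>x. (F has_real_derivative F' x) (at x)" and cont: "\<And>x. isCont F' x"
    and iF: "integrable lborel F" and iF': "integrable lborel F'"
  shows "(\<integral>x. F' x \<partial>lborel) = 0"
proof -
  interpret U: real_distribution "uniform_measure lborel {- 1..0 :: real}"
    by (rule real_distribution_uniform)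
  have m: "F' \<in> borel_measurable borel" using iF' by (auto dest: borel_measurable_integrable)
  have inner: "(\<integral>u. 1 * F' (x - u) \<partial>uniform_measure lborel {- 1..0}) = F (x - (- 1)) - F x" for x
  proof -
    have "(\<integral>u. F' (x - u) \<partial>uniform_measure lborel {- 1..0}) = (\<integral>u. indicator {- 1..0} u * F' (x - u) \<partial>lborel)"
    proof -
      have "uniform_measure lborel {- 1..0 :: real} = density lborel (\<lambda>x. ennreal (indicator {- 1..0} x))"
        unfolding uniform_measure_def by (rule arg_cong[where f="density lborel"]) (auto simp: indicator_def)
      then show ?thesis using m by (simp add: integral_density)
    qed
    also have "\<dots> = (\<integral>u. F' (x - u) * indicator {- 1..0} u \<partial>lborel)" by (simp only: mult.commute)
    also have "\<dots> = - F (x - 0) - (- F (x - (- 1)))"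
    proof (rule integral_FTC_Icc_real)
      fix u :: real
      have "((\<lambda>u. - F (x - u)) has_real_derivative - (F' (x - u) * - 1)) (at u)"
        by (intro DERIV_minus DERIV_chain2[where f=F and g="\<lambda>u. x - u"] deriv) (auto intro!: derivative_eq_intros)
      then show "((\<lambda>u. - F (x - u)) has_real_derivative F' (x - u)) (at u)" by simp
      show "isCont (\<lambda>u. F' (x - u)) u" by (intro isCont_o2[OF _ cont] continuous_intros)
    qed simp
    finally show ?thesis by simp
  qed
  have "(\<integral>x. F' x \<partial>lborel) = (\<integral>x. (\<integral>u. 1 * F' (x - u) \<partial>uniform_measure lborel {- 1..0}) \<partial>lborel)"
    using U.conv_integral(3)[OF iF', of "\<lambda>_. 1"] U.prob_space by simp
  also have "\<dots> = (\<integral>x. F (x - (- 1)) - F x \<partial>lborel)" unfolding inner ..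
  also have "\<dots> = (\<integral>x. F (x - (- 1)) \<partial>lborel) - (\<integral>x. F x \<partial>lborel)"
    by (rule Bochner_Integration.integral_diff) (use iF lborel_integral_shift(1)[of F "- 1"] in auto)
  also have "\<dots> = 0" using lborel_integral_shift(2)[of F "- 1"] by simp
  finally show ?thesis .
qed

context gauss_smoothing
begin

text \<open>One integrable function dominates the density and both derivatives for all times in a
  compact interval. The weight is shared out by
  \<open>1 + x^2 \<le> 2 * (1 + u^2) * (1 + (x - u)^2)\<close>: the factor in \<open>u\<close> is
  integrable under the law, and the factor in \<open>x - u\<close> is absorbed by the
  kernel.\<close>

lemma dens_weight:
  assumes "0 < a" "a \<le> b"
  shows "\<exists>W. integrable lborel W \<and> (\<forall>t x. a \<le> t \<longrightarrow> t \<le> b \<longrightarrow>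
     (1 + x\<^sup>2) * \<bar>dens t x\<bar> \<le> W x \<and> (1 + x\<^sup>2) * \<bar>dens1 t x\<bar> \<le> W x \<and> (1 + x\<^sup>2) * \<bar>dens2 t x\<bar> \<le> W x)"
proof -
  have b: "2 * b > 0" using assms by simp
  obtain C where C: "C \<ge> 0" and
    k: "\<And>t y. a \<le> t \<Longrightarrow> t \<le> b \<Longrightarrow> (1 + y\<^sup>2) * gauss t y \<le> C * gauss (2 * b) y"
      "\<And>t y. a \<le> t \<Longrightarrow> t \<le> b \<Longrightarrow> (1 + y\<^sup>2) * (\<bar>y / t\<bar> * gauss t y) \<le> C * gauss (2 * b) y"
      "\<And>t y. a \<le> t \<Longrightarrow> t \<le> b \<Longrightarrow> (1 + y\<^sup>2) * (\<bar>y\<^sup>2 / t\<^sup>2 - 1 / t\<bar> * gauss t y) \<le> C * gauss (2 * b) y"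
    using gauss_kernels_le[OF assms] by blast
  define h where "h u = 2 * C * (1 + u\<^sup>2)" for u
  have ih: "integrable \<mu> h" unfolding h_def using square_integrable by simp
  define W where "W x = (\<integral>u. h u * gauss (2 * b) (x - u) \<partial>\<mu>)" for x
  have iW: "integrable lborel W"
    unfolding W_def by (rule conv_integral(2)[OF gauss_integral(1)[OF b] ih])
  have ihg: "integrable \<mu> (\<lambda>u. h u * gauss (2 * b) (x - u))" for x
  proof (rule Bochner_Integration.integrable_bound[OF integrable_mult_right[OF ih, of "1 / sqrt (2 * pi * (2 * b))"]])
    show "AE u in \<mu>. norm (h u * gauss (2 * b) (x - u)) \<le> norm (1 / sqrt (2 * pi * (2 * b)) * h u)"
    proof (rule AE_I2)
      fix u
      have "\<bar>gauss (2 * b) (x - u)\<bar> \<le> \<bar>1 / sqrt (2 * pi * (2 * b))\<bar>"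
        using gauss_le[OF b, of "x - u"] gauss_pos[OF b, of "x - u"] by linarith
      then have "\<bar>h u\<bar> * \<bar>gauss (2 * b) (x - u)\<bar> \<le> \<bar>h u\<bar> * \<bar>1 / sqrt (2 * pi * (2 * b))\<bar>"
        by (rule mult_left_mono) simp
      then show "norm (h u * gauss (2 * b) (x - u)) \<le> norm (1 / sqrt (2 * pi * (2 * b)) * h u)"
        by (simp only: real_norm_def abs_mult mult.commute)
    qed
  qed (simp add: h_def)
  have bound: "(1 + x\<^sup>2) * \<bar>\<integral>u. K (x - u) \<partial>\<mu>\<bar> \<le> W x"
    if K: "\<And>y. (1 + y\<^sup>2) * \<bar>K y\<bar> \<le> C * gauss (2 * b) y" and iK: "integrable \<mu> (\<lambda>u. K (x - u))" for K x
  proof -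
    have "(1 + x\<^sup>2) * \<bar>\<integral>u. K (x - u) \<partial>\<mu>\<bar> \<le> (1 + x\<^sup>2) * (\<integral>u. \<bar>K (x - u)\<bar> \<partial>\<mu>)"
      by (intro mult_left_mono integral_abs_bound) simp
    also have "\<dots> = (\<integral>u. (1 + x\<^sup>2) * \<bar>K (x - u)\<bar> \<partial>\<mu>)" by simp
    also have "\<dots> \<le> W x"
      unfolding W_def
    proof (rule integral_mono)
      show "integrable \<mu> (\<lambda>u. (1 + x\<^sup>2) * \<bar>K (x - u)\<bar>)" using iK by simp
      fix u
      have "1 + x\<^sup>2 \<le> 2 * (1 + u\<^sup>2) * (1 + (x - u)\<^sup>2)"
      proof -
        have "x\<^sup>2 \<le> 2 * u\<^sup>2 + 2 * (x - u)\<^sup>2"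
          using zero_le_power2[of "2 * u - x"] by (simp add: power2_eq_square algebra_simps)
        moreover have "0 \<le> u\<^sup>2 * (x - u)\<^sup>2" by simp
        moreover have "2 * (1 + u\<^sup>2) * (1 + (x - u)\<^sup>2) = 2 + 2 * u\<^sup>2 + 2 * (x - u)\<^sup>2 + 2 * (u\<^sup>2 * (x - u)\<^sup>2)"
          by (simp add: algebra_simps)
        ultimately show ?thesis by linarith
      qed
      then have "(1 + x\<^sup>2) * \<bar>K (x - u)\<bar> \<le> (2 * (1 + u\<^sup>2) * (1 + (x - u)\<^sup>2)) * \<bar>K (x - u)\<bar>"
        by (rule mult_right_mono) simp
      also have "\<dots> = 2 * (1 + u\<^sup>2) * ((1 + (x - u)\<^sup>2) * \<bar>K (x - u)\<bar>)" by (simp only: mult.assoc)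
      also have "\<dots> \<le> 2 * (1 + u\<^sup>2) * (C * gauss (2 * b) (x - u))"
        by (intro mult_left_mono K) simp
      finally show "(1 + x\<^sup>2) * \<bar>K (x - u)\<bar> \<le> h u * gauss (2 * b) (x - u)" by (simp add: h_def mult_ac)
    qed (rule ihg)
    finally show ?thesis .
  qed
  show ?thesis
  proof (intro exI[of _ W] conjI iW allI impI)
    fix t x assume t: "a \<le> t" "t \<le> b"
    have t0: "t > 0" using assms t by simp
    note g = gauss_pos[OF t0]
    show "(1 + x\<^sup>2) * \<bar>dens t x\<bar> \<le> W x"
      unfolding dens_def by (rule bound) (use k(1)[OF t] g integrable_kernels[OF t0] in \<open>auto simp: abs_of_pos\<close>)
    show "(1 + x\<^sup>2) * \<bar>dens1 t x\<bar> \<le> W x"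
      unfolding dens1_def
    proof (rule bound[of "\<lambda>y. - (y / t) * gauss t y"])
      fix y show "(1 + y\<^sup>2) * \<bar>- (y / t) * gauss t y\<bar> \<le> C * gauss (2 * b) y"
        using k(2)[OF t, of y] unfolding abs_mult abs_minus_cancel abs_of_pos[OF g[of y]] .
    qed (rule integrable_kernels[OF t0])
    show "(1 + x\<^sup>2) * \<bar>dens2 t x\<bar> \<le> W x"
      unfolding dens2_def
    proof (rule bound[of "\<lambda>y. (y\<^sup>2 / t\<^sup>2 - 1 / t) * gauss t y"])
      fix y show "(1 + y\<^sup>2) * \<bar>(y\<^sup>2 / t\<^sup>2 - 1 / t) * gauss t y\<bar> \<le> C * gauss (2 * b) y"
        using k(3)[OF t, of y] unfolding abs_mult abs_of_pos[OF g[of y]] .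
    qed (rule integrable_kernels[OF t0])
  qed
qed

text \<open>The heat equation passes from the kernel to the smoothed density. On the interval from
  \<open>t / 2\<close> to \<open>2 * t\<close> the time derivative of the kernel has a constant
  bound, which is integrable under a probability law.\<close>

lemma dens_DERIV_time:
  assumes "t > 0"
  shows "((\<lambda>t. dens t x) has_real_derivative 1 / 2 * dens2 t x) (at t)"
proof -
  obtain C where C: "C \<ge> 0" and
    k: "\<And>s y. t / 2 \<le> s \<Longrightarrow> s \<le> 2 * t \<Longrightarrow> (1 + y\<^sup>2) * (\<bar>y\<^sup>2 / s\<^sup>2 - 1 / s\<bar> * gauss s y) \<le> C * gauss (2 * (2 * t)) y"
    using gauss_kernels_le[of "t / 2" "2 * t"] assms by auto
  define w where "w = C * (1 / sqrt (2 * pi * (2 * (2 * t))))"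
  have "((\<lambda>t. \<integral>u. gauss t (x - u) \<partial>\<mu>) has_real_derivative (\<integral>u. 1 / 2 * (((x - u)\<^sup>2 / t\<^sup>2 - 1 / t) * gauss t (x - u)) \<partial>\<mu>)) (at t)"
  proof (rule has_derivative_integral_dominated[where S="{t / 2<..<2 * t}" and w="\<lambda>_. w"])
    fix s u assume s: "s \<in> {t / 2<..<2 * t}"
    then have s0: "s > 0" using assms by simp
    show "((\<lambda>s. gauss s (x - u)) has_real_derivative 1 / 2 * (((x - u)\<^sup>2 / s\<^sup>2 - 1 / s) * gauss s (x - u))) (at s)"
      by (rule gauss_DERIV_time[OF s0])
    let ?k = "((x - u)\<^sup>2 / s\<^sup>2 - 1 / s) * gauss s (x - u)"
    have "\<bar>?k\<bar> \<le> (1 + (x - u)\<^sup>2) * \<bar>?k\<bar>" by (simp add: mult_le_cancel_right1)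
    also have "\<dots> \<le> C * gauss (2 * (2 * t)) (x - u)"
      using k[of s "x - u"] s unfolding abs_mult abs_of_pos[OF gauss_pos[OF s0]] by simp
    also have "\<dots> \<le> w"
      unfolding w_def using C assms by (intro mult_left_mono gauss_le) auto
    finally show "\<bar>1 / 2 * ?k\<bar> \<le> w" by simp
  next
    fix s assume "s \<in> {t / 2<..<2 * t}"
    then have "s > 0" using assms by simp
    then show "integrable \<mu> (\<lambda>u. gauss s (x - u))" by (rule integrable_kernels)
  qed (use assms in auto)
  then show ?thesis by (simp add: dens_def dens2_def)
qed

definition neg_entropy :: "real \<Rightarrow> real" where
  "neg_entropy t = (\<integral>x. dens t x * ln (dens t x) \<partial>lborel)"

text \<open>The logarithm grows at most quadratically, so the weight \<open>1 + x^2\<close> of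
  \<open>dens_weight\<close> absorbs it. The uniformity in time serves Fubini's theorem in
  \<open>de_bruijn\<close>.\<close>

lemma log_dens_bounds:
  assumes "0 < a" "a \<le> b"
  shows "\<exists>W. integrable lborel W \<and> (\<forall>t x. a \<le> t \<longrightarrow> t \<le> b \<longrightarrow>
    \<bar>dens t x * ln (dens t x)\<bar> \<le> W x \<and> \<bar>(1 + ln (dens t x)) * dens1 t x\<bar> \<le> W x \<and>
    \<bar>(1 + ln (dens t x)) * dens2 t x\<bar> \<le> W x)"
proof -
  obtain W where W: "integrable lborel W" and
    w: "\<And>t x. a \<le> t \<Longrightarrow> t \<le> b \<Longrightarrow> (1 + x\<^sup>2) * \<bar>dens t x\<bar> \<le> W x"
    "\<And>t x. a \<le> t \<Longrightarrow> t \<le> b \<Longrightarrow> (1 + x\<^sup>2) * \<bar>dens1 t x\<bar> \<le> W x"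
    "\<And>t x. a \<le> t \<Longrightarrow> t \<le> b \<Longrightarrow> (1 + x\<^sup>2) * \<bar>dens2 t x\<bar> \<le> W x"
    using dens_weight[OF assms] by blast
  obtain C where C: "C \<ge> 0" and l: "\<And>t x. a \<le> t \<Longrightarrow> t \<le> b \<Longrightarrow> \<bar>ln (dens t x)\<bar> \<le> C * (1 + x\<^sup>2)"
    using abs_ln_dens_le[OF assms(1), of b] by blast
  have prod: "\<bar>L * d\<bar> \<le> (1 + C) * W x" if "\<bar>L\<bar> \<le> (1 + C) * (1 + x\<^sup>2)" "(1 + x\<^sup>2) * \<bar>d\<bar> \<le> W x" for L d x
  proof -
    have "\<bar>L * d\<bar> \<le> (1 + C) * (1 + x\<^sup>2) * \<bar>d\<bar>" unfolding abs_mult by (rule mult_right_mono[OF that(1)]) simp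
    also have "\<dots> \<le> (1 + C) * W x" unfolding mult.assoc using that(2) C by (intro mult_left_mono) auto
    finally show ?thesis .
  qed
  have L: "\<bar>ln (dens t x)\<bar> \<le> (1 + C) * (1 + x\<^sup>2)" "\<bar>1 + ln (dens t x)\<bar> \<le> (1 + C) * (1 + x\<^sup>2)"
    if "a \<le> t" "t \<le> b" for t x
  proof -
    have "1 + C * (1 + x\<^sup>2) \<le> (1 + C) * (1 + x\<^sup>2)" by (simp add: algebra_simps)
    then show "\<bar>ln (dens t x)\<bar> \<le> (1 + C) * (1 + x\<^sup>2)" "\<bar>1 + ln (dens t x)\<bar> \<le> (1 + C) * (1 + x\<^sup>2)"
      using l[OF that, of x] by linarith+
  qed
  show ?thesis
  proof (intro exI[of _ "\<lambda>x. (1 + C) * W x"] conjI allI impI)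
    show "integrable lborel (\<lambda>x. (1 + C) * W x)" using W by simp
    fix t x assume t: "a \<le> t" "t \<le> b"
    show "\<bar>dens t x * ln (dens t x)\<bar> \<le> (1 + C) * W x"
      using prod[OF L(1)[OF t] w(1)[OF t]] by (simp only: mult.commute)
    show "\<bar>(1 + ln (dens t x)) * dens1 t x\<bar> \<le> (1 + C) * W x" by (rule prod[OF L(2)[OF t] w(2)[OF t]])
    show "\<bar>(1 + ln (dens t x)) * dens2 t x\<bar> \<le> (1 + C) * W x" by (rule prod[OF L(2)[OF t] w(3)[OF t]])
  qed
qed

lemma integrable_dens_ln: "t > 0 \<Longrightarrow> integrable lborel (\<lambda>x. dens t x * ln (dens t x))"
proof -
  assume t: "t > 0"
  obtain W where W: "integrable lborel W"
    "\<And>s x. t \<le> s \<Longrightarrow> s \<le> t \<Longrightarrow> \<bar>dens s x * ln (dens s x)\<bar> \<le> W x"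
    "\<And>s x. t \<le> s \<Longrightarrow> s \<le> t \<Longrightarrow> \<bar>(1 + ln (dens s x)) * dens1 s x\<bar> \<le> W x"
    "\<And>s x. t \<le> s \<Longrightarrow> s \<le> t \<Longrightarrow> \<bar>(1 + ln (dens s x)) * dens2 s x\<bar> \<le> W x"
    using log_dens_bounds[OF t order_refl] by blast
  show ?thesis
    by (rule Bochner_Integration.integrable_bound[OF W(1)])
      (use W(2)[of t] in \<open>auto intro!: AE_I2 order_trans[OF _ abs_ge_self]\<close>)
qed

text \<open>Integration by parts with vanishing boundary terms: the derivative of
  \<open>(1 + ln p) * p'\<close> is \<open>p'^2 / p + (1 + ln p) * p''\<close>. Both functions are
  integrable, so the integral of the derivative is 0.\<close>

lemma integral_log_dens2:
  assumes t: "t > 0"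
  shows "integrable lborel (\<lambda>x. (1 + ln (dens t x)) * dens2 t x)"
    "(\<integral>x. (1 + ln (dens t x)) * dens2 t x \<partial>lborel) = - fisher t"
proof -
  obtain W where W: "integrable lborel W"
    "\<And>s x. t \<le> s \<Longrightarrow> s \<le> t \<Longrightarrow> \<bar>dens s x * ln (dens s x)\<bar> \<le> W x"
    "\<And>s x. t \<le> s \<Longrightarrow> s \<le> t \<Longrightarrow> \<bar>(1 + ln (dens s x)) * dens1 s x\<bar> \<le> W x"
    "\<And>s x. t \<le> s \<Longrightarrow> s \<le> t \<Longrightarrow> \<bar>(1 + ln (dens s x)) * dens2 s x\<bar> \<le> W x"
    using log_dens_bounds[OF t order_refl] by blast
  have i1: "integrable lborel (\<lambda>x. (1 + ln (dens t x)) * dens1 t x)"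
    by (rule Bochner_Integration.integrable_bound[OF W(1)])
      (use W(3)[of t] in \<open>auto intro!: AE_I2 order_trans[OF _ abs_ge_self]\<close>)
  show i2: "integrable lborel (\<lambda>x. (1 + ln (dens t x)) * dens2 t x)"
    by (rule Bochner_Integration.integrable_bound[OF W(1)])
      (use W(4)[of t] in \<open>auto intro!: AE_I2 order_trans[OF _ abs_ge_self]\<close>)
  have c: "isCont (dens t) x" "isCont (dens1 t) x" "isCont (dens2 t) x" for x
    using continuous_conv_poly[OF t, of UNIV] by (auto simp: dens_eq continuous_on_eq_continuous_at)
  have "(\<integral>x. (dens1 t x)\<^sup>2 / dens t x + (1 + ln (dens t x)) * dens2 t x \<partial>lborel) = 0"
  proof (rule integral_derivative_eq_0)
    fix x
    have p: "dens t x > 0" by (rule dens_pos[OF t])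
    show "((\<lambda>x. (1 + ln (dens t x)) * dens1 t x) has_real_derivative (dens1 t x)\<^sup>2 / dens t x + (1 + ln (dens t x)) * dens2 t x) (at x)"
      using p by (auto intro!: derivative_eq_intros dens_DERIV[OF t] simp: power2_eq_square field_simps)
    show "isCont (\<lambda>x. (dens1 t x)\<^sup>2 / dens t x + (1 + ln (dens t x)) * dens2 t x) x"
      using p by (intro continuous_intros c) auto
  qed (use i1 i2 fisher_integrable[OF t] in auto)
  then show "(\<integral>x. (1 + ln (dens t x)) * dens2 t x \<partial>lborel) = - fisher t"
    using i2 fisher_integrable[OF t] by (simp add: fisher_def)
qed

text \<open>The time derivative of \<open>p * ln p\<close> is \<open>(1 + ln p) * p'' / 2\<close> by
  the heat equation. It is integrated over time pointwise in \<open>x\<close>, the integrals are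
  exchanged, and integration by parts in space turns it into minus half the Fisher
  information.\<close>

lemma de_bruijn:
  assumes "0 < a" "a \<le> b"
  shows "neg_entropy a = neg_entropy b + (\<integral>t. indicator {a..b} t * (fisher t / 2) \<partial>lborel)"
proof -
  obtain W where W: "integrable lborel W"
    "\<And>s x. a \<le> s \<Longrightarrow> s \<le> b \<Longrightarrow> \<bar>dens s x * ln (dens s x)\<bar> \<le> W x"
    "\<And>s x. a \<le> s \<Longrightarrow> s \<le> b \<Longrightarrow> \<bar>(1 + ln (dens s x)) * dens1 s x\<bar> \<le> W x"
    "\<And>s x. a \<le> s \<Longrightarrow> s \<le> b \<Longrightarrow> \<bar>(1 + ln (dens s x)) * dens2 s x\<bar> \<le> W x"
    using log_dens_bounds[OF assms] by blast
  define G where "G t x = indicator {a..b} t * ((1 + ln (dens t x)) * dens2 t x / 2)" for t x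
  have G_meas: "(\<lambda>(t, x). G t x) \<in> borel_measurable (lborel \<Otimes>\<^sub>M lborel)"
    unfolding G_def by measurable
  have G_le: "\<bar>G t x\<bar> \<le> indicator {a..b} t * W x" for t x
  proof (cases "t \<in> {a..b}")
    case True
    then have "\<bar>(1 + ln (dens t x)) * dens2 t x\<bar> \<le> W x" using W(4) by auto
    then show ?thesis using True abs_ge_zero[of "(1 + ln (dens t x)) * dens2 t x"] unfolding G_def by simp
  qed (simp add: G_def)
  have Gx: "integrable lborel (G t)" for t
  proof (rule Bochner_Integration.integrable_bound[OF integrable_mult_right[OF W(1), of "indicator {a..b} t"]])
    show "G t \<in> borel_measurable lborel" unfolding G_def by measurable
    show "AE x in lborel. norm (G t x) \<le> norm (indicator {a..b} t * W x)"
      unfolding real_norm_def by (rule AE_I2, rule order_trans[OF G_le abs_ge_self])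
  qed
  have iI: "integrable lborel (\<lambda>t. indicator {a..b} t * c :: real)" for c
    by (rule integrable_mult_left) (use assms in \<open>simp add: integrable_indicator_iff\<close>)
  have Gp: "integrable (lborel \<Otimes>\<^sub>M lborel) (\<lambda>(t, x). G t x)"
  proof (rule lborel_pair.Fubini_integrable[OF G_meas])
    show "AE t in lborel. integrable lborel (\<lambda>x. case (t, x) of (t, x) \<Rightarrow> G t x)" using Gx by simp
    show "integrable lborel (\<lambda>t. \<integral>x. norm (case (t, x) of (t, x) \<Rightarrow> G t x) \<partial>lborel)"
    proof (rule Bochner_Integration.integrable_bound[OF iI[of "\<integral>x. W x \<partial>lborel"]])
      have "(\<lambda>(t, x). norm (G t x)) \<in> borel_measurable (lborel \<Otimes>\<^sub>M lborel)"
        unfolding G_def by measurable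
      then show "(\<lambda>t. \<integral>x. norm (case (t, x) of (t, x) \<Rightarrow> G t x) \<partial>lborel) \<in> borel_measurable lborel"
        using lborel.borel_measurable_lebesgue_integral[of "\<lambda>t x. norm (G t x)" lborel] by simp
      show "AE t in lborel. norm (\<integral>x. norm (case (t, x) of (t, x) \<Rightarrow> G t x) \<partial>lborel) \<le> norm (indicator {a..b} t * (\<integral>x. W x \<partial>lborel))"
      proof (rule AE_I2)
        fix t
        have "(\<integral>x. norm (G t x) \<partial>lborel) \<le> (\<integral>x. indicator {a..b} t * W x \<partial>lborel)"
          by (rule integral_mono) (use Gx[of t] W(1) G_le in auto)
        moreover have "0 \<le> (\<integral>x. norm (G t x) \<partial>lborel)" by (rule integral_nonneg_AE) simp
        ultimately show "norm (\<integral>x. norm (case (t, x) of (t, x) \<Rightarrow> G t x) \<partial>lborel) \<le> norm (indicator {a..b} t * (\<integral>x. W x \<partial>lborel))"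
          by simp
      qed
    qed
  qed
  have time: "(\<integral>t. G t x \<partial>lborel) = dens b x * ln (dens b x) - dens a x * ln (dens a x)" for x
  proof -
    let ?f = "\<lambda>t. (1 + ln (dens t x)) * dens2 t x / 2"
    have "(?f has_integral (dens b x * ln (dens b x) - dens a x * ln (dens a x))) {a..b}"
    proof (rule fundamental_theorem_of_calculus[OF assms(2)])
      fix t assume "t \<in> {a..b}"
      then have t: "t > 0" using assms by simp
      have "((\<lambda>t. dens t x * ln (dens t x)) has_real_derivative ?f t) (at t)"
        using dens_pos[OF t, of x]
        by (auto intro!: derivative_eq_intros dens_DERIV_time[OF t] simp: field_simps)
      then show "((\<lambda>t. dens t x * ln (dens t x)) has_vector_derivative ?f t) (at t within {a..b})"
        by (simp add: has_real_derivative_iff_has_vector_derivative has_vector_derivative_at_within)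
    qed
    moreover have "set_integrable lborel {a..b} ?f"
      unfolding set_integrable_def
    proof (rule Bochner_Integration.integrable_bound[OF iI[of "W x"]])
      show "AE t in lborel. norm (indicator {a..b} t *\<^sub>R ?f t) \<le> norm (indicator {a..b} t * W x)"
        using order_trans[OF G_le abs_ge_self, of _ x] unfolding G_def real_norm_def real_scaleR_def by (rule AE_I2)
    qed measurable
    ultimately have "(LINT t : {a..b} | lborel. ?f t) = dens b x * ln (dens b x) - dens a x * ln (dens a x)"
      using set_borel_integral_eq_integral(2) by (metis integral_unique)
    then show ?thesis by (simp add: set_lebesgue_integral_def G_def)
  qed
  have space: "(\<integral>x. G t x \<partial>lborel) = - (indicator {a..b} t * (fisher t / 2))" for t
  proof (cases "t \<in> {a..b}")
    case True
    then have "t > 0" using assms by simp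
    then show ?thesis using integral_log_dens2[of t] True by (simp add: G_def)
  qed (simp add: G_def)
  have b: "b > 0" using assms by simp
  have "neg_entropy b - neg_entropy a = (\<integral>x. dens b x * ln (dens b x) - dens a x * ln (dens a x) \<partial>lborel)"
    using integrable_dens_ln[OF b] integrable_dens_ln[OF assms(1)] by (simp add: neg_entropy_def)
  also have "\<dots> = (\<integral>x. (\<integral>t. G t x \<partial>lborel) \<partial>lborel)" by (simp add: time)
  also have "\<dots> = (\<integral>t. (\<integral>x. G t x \<partial>lborel) \<partial>lborel)"
    using lborel_pair.Fubini_integral[OF Gp] by simp
  also have "\<dots> = - (\<integral>t. indicator {a..b} t * (fisher t / 2) \<partial>lborel)" by (simp add: space)
  finally show ?thesis by simp
qed

text \<open>Smoothing averages translates of the Gaussian kernel over the law, and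
  \<open>y * ln y\<close> is convex, so the smoothed density has at least the entropy of the noise.
  The right side is the negative entropy of \<open>N(0, t)\<close>.\<close>

lemma neg_entropy_le:
  assumes t: "t > 0"
  shows "neg_entropy t \<le> - (1 / 2 + ln (2 * pi * t) / 2)"
proof -
  let ?g = "\<lambda>y. gauss t y * ln (gauss t y)"
  have geq: "?g = (\<lambda>y. - 1 / (2 * t) * (y\<^sup>2 * gauss t y) - ln (2 * pi * t) / 2 * gauss t y)"
    using t by (auto simp: ln_gauss field_simps)
  have ig: "integrable lborel ?g"
    unfolding geq using gauss_integral[OF t] gauss_integral_square[OF t]
    by (intro Bochner_Integration.integrable_diff integrable_mult_right)
  have vg: "(\<integral>y. ?g y \<partial>lborel) = - (1 / 2 + ln (2 * pi * t) / 2)"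
    unfolding geq using gauss_integral[OF t] gauss_integral_square[OF t] t by simp
  have i1: "integrable \<mu> (\<lambda>_. 1 :: real)" by simp
  note c = conv_integral[OF ig i1]
  have "neg_entropy t \<le> (\<integral>x. (\<integral>u. 1 * ?g (x - u) \<partial>\<mu>) \<partial>lborel)"
    unfolding neg_entropy_def
  proof (rule integral_mono_AE[OF integrable_dens_ln[OF t] c(2)])
    show "AE x in lborel. dens t x * ln (dens t x) \<le> (\<integral>u. 1 * ?g (x - u) \<partial>\<mu>)"
      using c(4)
    proof eventually_elim
      case (elim x)
      let ?p = "dens t x"
      have p: "?p > 0" by (rule dens_pos[OF t])
      \<comment> \<open>The left integrand is the tangent of \<open>y * ln y\<close> at the mean
        \<open>?p\<close>, evaluated at \<open>gauss t (x - u)\<close>; its linear part integrates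
        to 0.\<close>
      have "(\<integral>u. ?p * ln ?p + (1 + ln ?p) * (gauss t (x - u) - ?p) \<partial>\<mu>) \<le> (\<integral>u. 1 * ?g (x - u) \<partial>\<mu>)"
      proof (rule integral_mono)
        show "integrable \<mu> (\<lambda>u. ?p * ln ?p + (1 + ln ?p) * (gauss t (x - u) - ?p))"
          using integrable_kernels(1)[OF t, of x] by simp
        fix u
        let ?k = "gauss t (x - u)"
        have k: "?k > 0" by (rule gauss_pos[OF t])
        have "ln (?p / ?k) \<le> ?p / ?k - 1" using p k by (intro ln_le_minus_one) auto
        then have "?k * (ln ?p - ln ?k) \<le> ?k * (?p / ?k - 1)"
          using p k by (intro mult_left_mono) (auto simp: ln_div)
        also have "?k * (?p / ?k - 1) = ?p - ?k" using k by (simp add: right_diff_distrib)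
        finally show "?p * ln ?p + (1 + ln ?p) * (?k - ?p) \<le> 1 * ?g (x - u)"
          by (simp add: algebra_simps)
      qed (use elim in simp)
      also have "(\<integral>u. ?p * ln ?p + (1 + ln ?p) * (gauss t (x - u) - ?p) \<partial>\<mu>) = ?p * ln ?p"
        using integrable_kernels(1)[OF t, of x] by (simp add: prob_UNIV flip: dens_def)
      finally show ?case .
    qed
  qed
  also have "\<dots> = - (1 / 2 + ln (2 * pi * t) / 2)" unfolding c(3) vg by (simp add: prob_UNIV)
  finally show ?thesis .
qed

end

section \<open>From Fisher information to entropy and the variational inequality\<close>

context gauss_smoothing
begin

text \<open>The left side is the relative entropy of the smoothed law with respect to
  \<open>N(0, s + a)\<close>, where \<open>s\<close> is the second moment. The de Bruijn identity on
  \<open>[a, b]\<close> bounds it by \<open>B\<close> plus the corresponding quantity at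
  \<open>b\<close>. The latter is at most \<open>s / (2 * b)\<close>, since the entropy at
  \<open>b\<close> is at least that of the noise.\<close>

lemma entropy_bound:
  assumes a: "a > 0" and B: "0 \<le> B"
    and int: "(\<integral>\<^sup>+t\<in>{0<..}. ennreal (fisher t - 1 / (second_moment + t)) \<partial>lborel) \<le> ennreal (2 * B)"
  shows "neg_entropy a + 1 / 2 + ln (2 * pi * (second_moment + a)) / 2 \<le> B"
proof -
  define s where "s = second_moment"
  have s: "s \<ge> 0" unfolding s_def by (rule second_moment_nonneg)
  have main: "neg_entropy a + 1 / 2 + ln (2 * pi * (s + a)) / 2 \<le> B + s / (2 * b)" if b: "b \<ge> a" for b
  proof -
    have b0: "b > 0" using a b by simp
    let ?I = "\<lambda>t. indicator {a..b} t :: real"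
    have ii: "integrable lborel (\<lambda>t. ?I t * c)" for c :: real
      by (rule integrable_mult_left) (use b in \<open>simp add: integrable_indicator_iff\<close>)
    have i1: "integrable lborel (\<lambda>t. ?I t * fisher t)"
    proof (rule Bochner_Integration.integrable_bound[OF ii[of "1 / a"]])
      show "AE t in lborel. norm (?I t * fisher t) \<le> norm (?I t * (1 / a))"
      proof (rule AE_I2)
        fix t show "norm (?I t * fisher t) \<le> norm (?I t * (1 / a))"
        proof (cases "t \<in> {a..b}")
          case True
          then have t: "t > 0" "1 / t \<le> 1 / a" using a by (auto intro: divide_left_mono)
          then show ?thesis using fisher_le[OF t(1)] fisher_nonneg[OF t(1)] True a by simp
        qed simp
      qed
    qed measurable
    have i2: "has_bochner_integral lborel (\<lambda>t. ?I t *\<^sub>R (1 / (s + t))) (ln (s + b) - ln (s + a))"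
    proof (rule has_bochner_integral_FTC_Icc[OF b])
      fix t assume "a \<le> t" "t \<le> b"
      then show "((\<lambda>t. ln (s + t)) has_vector_derivative 1 / (s + t)) (at t within {a..b})"
        using a s unfolding has_real_derivative_iff_has_vector_derivative[symmetric]
        by (auto intro!: derivative_eq_intros)
    next
      show "continuous_on {a..b} (\<lambda>t. 1 / (s + t))" using a s by (intro continuous_intros) auto
    qed
    have i2': "integrable lborel (\<lambda>t. ?I t * (1 / (s + t)))" "(\<integral>t. ?I t * (1 / (s + t)) \<partial>lborel) = ln (s + b) - ln (s + a)"
      using i2 by (auto simp: has_bochner_integral_iff)
    define h where "h t = ?I t * (fisher t - 1 / (s + t))" for t
    have ih: "integrable lborel h"
      unfolding h_def right_diff_distrib using i1 i2'(1) by (rule Bochner_Integration.integrable_diff)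
    have "(\<integral>t. h t \<partial>lborel) \<le> 2 * B"
    proof -
      have im: "integrable lborel (\<lambda>t. max 0 (h t))" using ih by simp
      have "(\<integral>t. h t \<partial>lborel) \<le> (\<integral>t. max 0 (h t) \<partial>lborel)"
        by (rule integral_mono[OF ih im]) simp
      also have "ennreal \<dots> = (\<integral>\<^sup>+t. ennreal (max 0 (h t)) \<partial>lborel)"
        by (rule nn_integral_eq_integral[symmetric, OF im]) simp
      then have "ennreal (\<integral>t. max 0 (h t) \<partial>lborel) \<le> ennreal (2 * B)"
      proof (rule ord_eq_le_trans[OF _ order_trans[OF nn_integral_mono int]])
        fix t
        show "ennreal (max 0 (h t)) \<le> ennreal (fisher t - 1 / (second_moment + t)) * indicator {0<..} t"
          using a by (auto simp: h_def s_def indicator_def max_def ennreal_neg)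
      qed
      then have "(\<integral>t. max 0 (h t) \<partial>lborel) \<le> 2 * B" using B by (simp add: ennreal_le_iff)
      finally show ?thesis .
    qed
    moreover have "(\<integral>t. h t \<partial>lborel) = (\<integral>t. ?I t * fisher t \<partial>lborel) - (ln (s + b) - ln (s + a))"
      unfolding h_def right_diff_distrib Bochner_Integration.integral_diff[OF i1 i2'(1)] i2'(2) ..
    moreover have "(\<integral>t. ?I t * (fisher t / 2) \<partial>lborel) = (\<integral>t. ?I t * fisher t \<partial>lborel) / 2" by simp
    moreover have "x \<le> z + B + l / 2"
      if "h' \<le> 2 * B" "h' = X - l" "Y = X / 2" "x = y + Y" "y \<le> z" for x y z l h' X Y :: real
      using that by argo
    ultimately have "neg_entropy a \<le> - (1 / 2 + ln (2 * pi * b) / 2) + B + (ln (s + b) - ln (s + a)) / 2"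
      using de_bruijn[OF a b] neg_entropy_le[OF b0] by blast
    moreover have "ln (2 * pi * b) = ln (2 * pi) + ln b" using b0 by (simp add: ln_mult)
    moreover have "ln (2 * pi * (s + a)) = ln (2 * pi) + ln (s + a)" using a s by (simp add: ln_mult)
    moreover have "ln (s + b) - ln b \<le> s / b"
    proof -
      have "ln (s + b) - ln b = ln ((s + b) / b)" using b0 s by (simp add: ln_div)
      also have "\<dots> \<le> (s + b) / b - 1" using b0 s by (intro ln_le_minus_one) auto
      also have "\<dots> = s / b" using b0 by (simp add: field_simps)
      finally show ?thesis .
    qed
    moreover have "s / (2 * b) = s / b / 2" by simp
    moreover have "e + 1 / 2 + l2 / 2 \<le> B + z"
      if "e \<le> - (1 / 2 + l1 / 2) + B + (x - y) / 2" "l1 = p + l" "l2 = p + y" "x - l \<le> w" "z = w / 2"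
      for e l1 l2 x y p l w z :: real
      using that by argo
    ultimately show ?thesis by blast
  qed
  show ?thesis
    unfolding s_def[symmetric]
  proof (rule field_le_epsilon)
    fix e :: real assume e: "e > 0"
    let ?b = "max a (s / (2 * e))"
    have "s / (2 * ?b) \<le> e"
    proof -
      have "s / (2 * b) \<le> e" if "s / (2 * e) \<le> b" "b > 0" for b
        using that e by (simp add: field_simps)
      then show ?thesis using a by (simp add: less_max_iff_disj)
    qed
    then show "neg_entropy a + 1 / 2 + ln (2 * pi * (s + a)) / 2 \<le> B + e"
      using main[of ?b] by linarith
  qed
qed

text \<open>The noise is \<open>sqrt t\<close> times a standard normal variable, so after rescaling
  \<open>t\<close> occurs only inside \<open>\<psi>\<close>. Dominated convergence then applies in
  the normal variable and afterwards under the law.\<close>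

lemma integral_dens_tendsto:
  fixes \<psi> :: "real \<Rightarrow> real"
  assumes cont: "\<And>x. isCont \<psi> x" and bnd: "\<And>x. \<bar>\<psi> x\<bar> \<le> c"
    and a: "\<And>n. a n > 0" "a \<longlonglongrightarrow> 0"
  shows "(\<lambda>n. \<integral>x. \<psi> x * dens (a n) x \<partial>lborel) \<longlonglongrightarrow> (\<integral>u. \<psi> u \<partial>\<mu>)"
proof -
  have [measurable]: "\<psi> \<in> borel_measurable borel"
    using cont by (intro borel_measurable_continuous_onI continuous_at_imp_continuous_on) auto
  define I where "I t u = (\<integral>z. \<psi> (u + sqrt t * z) * std_normal_density z \<partial>lborel)" for t u
  have [measurable]: "I t \<in> borel_measurable borel" for t
    unfolding I_def by measurable
  have c0: "0 \<le> c" using bnd[of 0] by linarith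
  have in1: "integrable lborel (\<lambda>z. \<psi> (u + r * z) * std_normal_density z)" for u r
    by (rule Bochner_Integration.integrable_bound[of lborel "\<lambda>z. c * std_normal_density z"])
      (use bnd c0 in \<open>auto intro!: AE_I2 mult_right_mono simp: abs_mult\<close>)
  have I_le: "\<bar>I t u\<bar> \<le> c" for t u
  proof -
    have "\<bar>I t u\<bar> \<le> (\<integral>z. \<bar>\<psi> (u + sqrt t * z) * std_normal_density z\<bar> \<partial>lborel)"
      unfolding I_def by (rule integral_abs_bound)
    also have "\<dots> \<le> (\<integral>z. c * std_normal_density z \<partial>lborel)"
      by (rule integral_mono[OF integrable_abs[OF in1]]) (use bnd in \<open>auto intro: mult_right_mono simp: abs_mult\<close>)
    finally show ?thesis by simp
  qed
  have eq: "(\<integral>x. \<psi> x * dens t x \<partial>lborel) = (\<integral>u. I t u \<partial>\<mu>)" if t: "t > 0" for t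
  proof -
    interpret P: pair_sigma_finite \<mu> lborel ..
    have i1: "integrable \<mu> (\<lambda>_. 1 :: real)" by simp
    have pr: "integrable (\<mu> \<Otimes>\<^sub>M lborel) (\<lambda>(u, x). \<psi> x * gauss t (x - u))"
    proof (rule Bochner_Integration.integrable_bound[OF integrable_mult_right[OF conv_integral(1)[OF gauss_integral(1)[OF t] i1], of c]])
      show "AE z in \<mu> \<Otimes>\<^sub>M lborel. norm (case z of (u, x) \<Rightarrow> \<psi> x * gauss t (x - u)) \<le> norm (c * (case z of (u, x) \<Rightarrow> 1 * gauss t (x - u)))"
      proof (rule AE_I2)
        fix z :: "real \<times> real"
        have "\<bar>\<psi> (snd z)\<bar> * \<bar>gauss t (snd z - fst z)\<bar> \<le> \<bar>c\<bar> * \<bar>gauss t (snd z - fst z)\<bar>"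
          using bnd[of "snd z"] by (intro mult_right_mono) auto
        then show "norm (case z of (u, x) \<Rightarrow> \<psi> x * gauss t (x - u)) \<le> norm (c * (case z of (u, x) \<Rightarrow> 1 * gauss t (x - u)))"
          by (simp add: case_prod_beta' abs_mult)
      qed
    qed measurable
    have "(\<integral>x. \<psi> x * dens t x \<partial>lborel) = (\<integral>x. (\<integral>u. \<psi> x * gauss t (x - u) \<partial>\<mu>) \<partial>lborel)"
      by (simp add: dens_def)
    also have "\<dots> = (\<integral>u. (\<integral>x. \<psi> x * gauss t (x - u) \<partial>lborel) \<partial>\<mu>)"
      using P.Fubini_integral[OF pr] by simp
    also have "(\<lambda>u. \<integral>x. \<psi> x * gauss t (x - u) \<partial>lborel) = I t"
    proof
      fix u
      have g: "sqrt t * gauss t (u + sqrt t * z - u) = std_normal_density z" for z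
        using t by (simp add: gauss_def std_normal_density_def power_mult_distrib real_sqrt_mult field_simps)
      have "(\<integral>x. \<psi> x * gauss t (x - u) \<partial>lborel) = \<bar>sqrt t\<bar> *\<^sub>R (\<integral>z. \<psi> (u + sqrt t * z) * gauss t (u + sqrt t * z - u) \<partial>lborel)"
        by (rule lborel_integral_real_affine) (use t in simp)
      also have "\<dots> = (\<integral>z. sqrt t * (\<psi> (u + sqrt t * z) * gauss t (u + sqrt t * z - u)) \<partial>lborel)"
        using t by simp
      also have "\<dots> = I t u"
        unfolding I_def by (rule Bochner_Integration.integral_cong[OF refl]) (simp only: mult.left_commute[of "sqrt t"] g)
      finally show "(\<integral>x. \<psi> x * gauss t (x - u) \<partial>lborel) = I t u" .
    qed
    finally show ?thesis .
  qed
  have "(\<lambda>n. \<integral>u. I (a n) u \<partial>\<mu>) \<longlonglongrightarrow> (\<integral>u. \<psi> u \<partial>\<mu>)"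
  proof (rule integral_dominated_convergence[where w="\<lambda>_. c"])
    show "AE u in \<mu>. (\<lambda>n. I (a n) u) \<longlonglongrightarrow> \<psi> u"
    proof (rule AE_I2)
      fix u
      have "(\<lambda>n. I (a n) u) \<longlonglongrightarrow> (\<integral>z. \<psi> u * std_normal_density z \<partial>lborel)"
        unfolding I_def
      proof (rule integral_dominated_convergence[where w="\<lambda>z. c * std_normal_density z"])
        show "AE z in lborel. (\<lambda>n. \<psi> (u + sqrt (a n) * z) * std_normal_density z) \<longlonglongrightarrow> \<psi> u * std_normal_density z"
        proof (rule AE_I2)
          fix z
          have "(\<lambda>n. u + sqrt (a n) * z) \<longlonglongrightarrow> u + sqrt 0 * z"
            by (intro tendsto_intros a(2))
          then have "(\<lambda>n. \<psi> (u + sqrt (a n) * z)) \<longlonglongrightarrow> \<psi> u"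
            using isCont_tendsto_compose[OF cont] by simp
          then show "(\<lambda>n. \<psi> (u + sqrt (a n) * z) * std_normal_density z) \<longlonglongrightarrow> \<psi> u * std_normal_density z"
            by (intro tendsto_intros)
        qed
        show "AE z in lborel. norm (\<psi> (u + sqrt (a n) * z) * std_normal_density z) \<le> c * std_normal_density z" for n
          using bnd by (auto intro!: AE_I2 mult_right_mono simp: abs_mult)
      qed auto
      then show "(\<lambda>n. I (a n) u) \<longlonglongrightarrow> \<psi> u" by simp
    qed
  qed (use I_le in auto)
  then show ?thesis using eq[OF a(1)] by simp
qed

text \<open>The Donsker-Varadhan inequality for the smoothed law, obtained from
  \<open>c * y \<le> y * ln y - y + exp c\<close>; unlike the entropy itself, it passes to the weak limit.\<close>

lemma donsker_varadhan:
  fixes \<psi> :: "real \<Rightarrow> real"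
  assumes s: "second_moment > 0" and B: "0 \<le> B"
    and int: "(\<integral>\<^sup>+t\<in>{0<..}. ennreal (fisher t - 1 / (second_moment + t)) \<partial>lborel) \<le> ennreal (2 * B)"
    and cont: "\<And>x. isCont \<psi> x" and bnd: "\<And>x. \<bar>\<psi> x\<bar> \<le> c"
  shows "(\<integral>u. \<psi> u \<partial>\<mu>) \<le> B + (\<integral>x. exp (\<psi> x) * gauss second_moment x \<partial>lborel) - 1"
proof -
  define s where "s = second_moment"
  have s0: "s > 0" using s by (simp add: s_def)
  have [measurable]: "\<psi> \<in> borel_measurable borel"
    using cont by (intro borel_measurable_continuous_onI continuous_at_imp_continuous_on) auto
  have iE: "integrable lborel (\<lambda>x. exp (\<psi> x) * gauss s x)"
  proof (rule Bochner_Integration.integrable_bound[OF integrable_mult_right[OF gauss_integral(1)[OF s0], of "exp c"]])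
    show "AE x in lborel. norm (exp (\<psi> x) * gauss s x) \<le> norm (exp c * gauss s x)"
    proof (rule AE_I2)
      fix x
      have "\<psi> x \<le> c" using bnd[of x] by linarith
      then show "norm (exp (\<psi> x) * gauss s x) \<le> norm (exp c * gauss s x)"
        using gauss_pos[OF s0, of x] by (simp add: abs_mult)
    qed
  qed measurable
  \<comment> \<open>The reference Gaussian keeps the variance \<open>s\<close>, while the smoothed
    law has second moment \<open>s + a\<close>. The resulting mismatch terms cancel in the limit of
    vanishing \<open>a\<close> and leave \<open>B - 1\<close> next to the exponential
    integral.\<close>
  have step: "(\<integral>x. \<psi> x * dens a x \<partial>lborel) \<le> B - 1 / 2 - ln (2 * pi * (s + a)) / 2 + ln (2 * pi * s) / 2 + (s + a) / (2 * s) - 1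
       + (\<integral>x. exp (\<psi> x) * gauss s x \<partial>lborel)" if a: "a > 0" for a
  proof -
    note d = dens_integral[OF a] dens_second_moment[OF a]
    have "(\<integral>x. \<psi> x * dens a x \<partial>lborel) \<le> (\<integral>x. dens a x * ln (dens a x) + 1 / (2 * s) * (x\<^sup>2 * dens a x) + (ln (2 * pi * s) / 2 - 1) * dens a x + exp (\<psi> x) * gauss s x \<partial>lborel)"
    proof (rule integral_mono)
      show "integrable lborel (\<lambda>x. \<psi> x * dens a x)"
        by (rule Bochner_Integration.integrable_bound[OF integrable_mult_right[OF d(1), of c]])
          (use bnd in \<open>auto intro!: AE_I2 mult_right_mono order_trans[OF bnd abs_ge_self] simp: abs_mult\<close>)
      show "integrable lborel (\<lambda>x. dens a x * ln (dens a x) + 1 / (2 * s) * (x\<^sup>2 * dens a x) + (ln (2 * pi * s) / 2 - 1) * dens a x + exp (\<psi> x) * gauss s x)"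
        using d integrable_dens_ln[OF a] iE by (intro Bochner_Integration.integrable_add integrable_mult_right)
      fix x
      let ?p = "dens a x" and ?g = "gauss s x"
      have p: "?p > 0" and g: "?g > 0" using dens_pos[OF a] gauss_pos[OF s0] by auto
      have "1 + (\<psi> x + ln ?g - ln ?p) \<le> exp (\<psi> x + ln ?g - ln ?p)" by (rule exp_ge_add_one_self)
      also have "\<dots> = exp (\<psi> x) * ?g / ?p" using p g by (simp add: exp_add exp_diff)
      finally have "?p * (1 + (\<psi> x + ln ?g - ln ?p)) \<le> ?p * (exp (\<psi> x) * ?g / ?p)"
        using p by (intro mult_left_mono) auto
      also have "\<dots> = exp (\<psi> x) * ?g" using p by simp
      finally have *: "?p * (1 + (\<psi> x + ln ?g - ln ?p)) \<le> exp (\<psi> x) * ?g" .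
      have lg: "ln ?g = - (1 / (2 * s) * x\<^sup>2) - ln (2 * pi * s) / 2" using ln_gauss[OF s0, of x] by simp
      show "\<psi> x * ?p \<le> ?p * ln ?p + 1 / (2 * s) * (x\<^sup>2 * ?p) + (ln (2 * pi * s) / 2 - 1) * ?p + exp (\<psi> x) * ?g"
        using * unfolding lg by (simp add: algebra_simps)
    qed
    also have "\<dots> = neg_entropy a + 1 / (2 * s) * (s + a) + (ln (2 * pi * s) / 2 - 1) + (\<integral>x. exp (\<psi> x) * gauss s x \<partial>lborel)"
      using d integrable_dens_ln[OF a] iE by (simp add: neg_entropy_def s_def)
    finally show ?thesis using entropy_bound[OF a B int] unfolding s_def[symmetric] by simp
  qed
  define a where "a n = 1 / real (Suc n)" for n
  have a: "a n > 0" for n by (simp add: a_def)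
  have a0: "a \<longlonglongrightarrow> 0" unfolding a_def using LIMSEQ_inverse_real_of_nat by (simp add: inverse_eq_divide)
  let ?E = "\<integral>x. exp (\<psi> x) * gauss s x \<partial>lborel"
  have "(\<lambda>n. B - 1 / 2 - ln (2 * pi * (s + a n)) / 2 + ln (2 * pi * s) / 2 + (s + a n) / (2 * s) - 1 + ?E)
     \<longlonglongrightarrow> B - 1 / 2 - ln (2 * pi * (s + 0)) / 2 + ln (2 * pi * s) / 2 + (s + 0) / (2 * s) - 1 + ?E"
    using s0 by (intro tendsto_intros a0) auto
  from LIMSEQ_le[OF integral_dens_tendsto[OF cont bnd a a0] this]
  have "(\<integral>u. \<psi> u \<partial>\<mu>) \<le> B - 1 / 2 - ln (2 * pi * (s + 0)) / 2 + ln (2 * pi * s) / 2 + (s + 0) / (2 * s) - 1 + ?E"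
    using step[OF a] by blast
  then show ?thesis
    unfolding s_def[symmetric] using s0 by simp
qed

end

section \<open>Fisher information of a perturbed variable\<close>

lemma (in prob_space) gauss_smoothing_distr:
  assumes "U \<in> borel_measurable M" "integrable M (\<lambda>\<omega>. (U \<omega>)\<^sup>2)"
  shows "gauss_smoothing (distr M borel U)"
proof -
  interpret D: prob_space "distr M borel U" by (rule prob_space_distr) (rule assms)
  show ?thesis
    by unfold_locales (use assms in \<open>auto simp: integrable_distr_eq\<close>)
qed

lemma (in prob_space) distributed_add_gauss:
  assumes U[measurable]: "U \<in> borel_measurable M" and U2: "integrable M (\<lambda>\<omega>. (U \<omega>)\<^sup>2)"
    and G: "distributed M lborel G (\<lambda>x. ennreal (normal_density 0 (sqrt t) x))"
    and indep: "indep_var borel U borel G" and t: "t > 0"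
  shows "distributed M lborel (\<lambda>\<omega>. U \<omega> + G \<omega>) (\<lambda>x. ennreal (gauss_smoothing.dens (distr M borel U) t x))"
proof -
  let ?\<mu> = "distr M borel U"
  interpret g: gauss_smoothing ?\<mu> by (rule gauss_smoothing_distr[OF U U2])
  interpret P: pair_sigma_finite ?\<mu> lborel ..
  have G_meas[measurable]: "G \<in> borel_measurable M" using distributed_measurable[OF G] by simp
  have G_distr: "distr M borel G = density lborel (\<lambda>x. ennreal (gauss t x))"
    using distributed_distr_eq_density[OF G] t
    by (simp add: gauss_eq_normal_density cong: distr_cong)
  interpret N: prob_space "distr M borel G" by (rule prob_space_distr) simp
  have "distr M lborel (\<lambda>\<omega>. U \<omega> + G \<omega>) = density lborel (\<lambda>x. ennreal (g.dens t x))"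
  proof (rule measure_eqI)
    fix A assume "A \<in> sets (distr M lborel (\<lambda>\<omega>. U \<omega> + G \<omega>))"
    then have A[measurable]: "A \<in> sets borel" by simp
    have "emeasure (distr M lborel (\<lambda>\<omega>. U \<omega> + G \<omega>)) A = emeasure (distr M borel (\<lambda>\<omega>. U \<omega> + G \<omega>)) A"
      by (rule arg_cong[where f="\<lambda>N. emeasure N A"], rule distr_cong) auto
    also have "distr M borel (\<lambda>\<omega>. U \<omega> + G \<omega>) = convolution ?\<mu> (distr M borel G)"
      by (rule sum_indep_random_variable[OF indep]) auto
    also have "emeasure \<dots> A = (\<integral>\<^sup>+u. \<integral>\<^sup>+y. indicator A (u + y) \<partial>distr M borel G \<partial>?\<mu>)"
      by (rule convolution_emeasure') (auto intro: g.finite_measure_axioms N.finite_measure_axioms)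
    also have "\<dots> = (\<integral>\<^sup>+u. \<integral>\<^sup>+x. ennreal (gauss t (x - u)) * indicator A x \<partial>lborel \<partial>?\<mu>)"
    proof (rule nn_integral_cong)
      fix u
      have "(\<integral>\<^sup>+y. indicator A (u + y) \<partial>distr M borel G) = (\<integral>\<^sup>+y. ennreal (gauss t y) * indicator A (u + y) \<partial>lborel)"
        unfolding G_distr by (rule nn_integral_density) auto
      also have "(\<integral>\<^sup>+x. ennreal (gauss t (x - u)) * indicator A x \<partial>lborel) = \<dots>"
        using nn_integral_real_affine[of "\<lambda>x. ennreal (gauss t (x - u)) * indicator A x" 1 u] by simp
      finally show "(\<integral>\<^sup>+y. indicator A (u + y) \<partial>distr M borel G) = (\<integral>\<^sup>+x. ennreal (gauss t (x - u)) * indicator A x \<partial>lborel)"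
        by simp
    qed
    also have "\<dots> = (\<integral>\<^sup>+x. \<integral>\<^sup>+u. ennreal (gauss t (x - u)) * indicator A x \<partial>?\<mu> \<partial>lborel)"
      by (rule P.Fubini'[symmetric]) measurable
    also have "\<dots> = (\<integral>\<^sup>+x. ennreal (g.dens t x) * indicator A x \<partial>lborel)"
    proof (rule nn_integral_cong)
      fix x
      have "(\<integral>\<^sup>+u. ennreal (gauss t (x - u)) \<partial>?\<mu>) = ennreal (g.dens t x)"
        unfolding g.dens_def
        by (rule nn_integral_eq_integral[OF g.integrable_kernels(1)[OF t]]) (auto intro: less_imp_le gauss_pos[OF t])
      then show "(\<integral>\<^sup>+u. ennreal (gauss t (x - u)) * indicator A x \<partial>?\<mu>) = ennreal (g.dens t x) * indicator A x"
        by (simp add: nn_integral_multc)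
    qed
    also have "\<dots> = emeasure (density lborel (\<lambda>x. ennreal (g.dens t x))) A"
      by (rule emeasure_density[symmetric]) auto
    finally show "emeasure (distr M lborel (\<lambda>\<omega>. U \<omega> + G \<omega>)) A = emeasure (density lborel (\<lambda>x. ennreal (g.dens t x))) A" .
  qed simp
  then show ?thesis unfolding distributed_def by auto
qed

lemma (in prob_space) smooth_density_eq:
  assumes p: "is_density M V p" "smooth p"
  shows "smooth_density M V = p"
  unfolding smooth_density_def
proof (rule the_equality)
  show "is_density M V p \<and> smooth p" using p by simp
  fix q assume q: "is_density M V q \<and> smooth q"
  have cont: "continuous_on UNIV r" if "smooth r" for r
    using that unfolding smooth_def by (metis funpow_0 differentiable_imp_continuous_on)
  have "AE x in lborel. ennreal (q x) = ennreal (p x)"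
    using p q unfolding is_density_def by (intro distributed_unique) auto
  then have "AE x in lborel. q x = p x"
    by eventually_elim (use p q in \<open>auto simp: is_density_def\<close>)
  then show "q = p" by (intro continuous_AE_eq cont) (use p q in auto)
qed

text \<open>Replaces the Fisher information built from \<open>smooth_density\<close> and the score
  by the explicit integral \<open>fisher\<close>: the definite description evaluates to
  \<open>dens t\<close>, and its derivative to \<open>dens1 t\<close>.\<close>

lemma (in prob_space) fisher_info_add_gauss:
  assumes U[measurable]: "U \<in> borel_measurable M" and U2: "integrable M (\<lambda>\<omega>. (U \<omega>)\<^sup>2)"
    and G: "distributed M lborel G (\<lambda>x. ennreal (normal_density 0 (sqrt t) x))"
    and indep: "indep_var borel U borel G" and t: "t > 0"
  shows "fisher_info M (\<lambda>\<omega>. U \<omega> + G \<omega>) = ennreal (gauss_smoothing.fisher (distr M borel U) t)"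
proof -
  let ?\<mu> = "distr M borel U" and ?V = "\<lambda>\<omega>. U \<omega> + G \<omega>"
  interpret g: gauss_smoothing ?\<mu> by (rule gauss_smoothing_distr[OF U U2])
  note d = distributed_add_gauss[OF assms]
  have "smooth_density M ?V = g.dens t"
    using d g.dens_pos[OF t] by (intro smooth_density_eq g.smooth_dens[OF t]) (auto simp: is_density_def intro: less_imp_le)
  moreover have "deriv (g.dens t) = g.dens1 t"
    using g.dens_DERIV(1)[OF t] by (auto intro!: DERIV_imp_deriv)
  ultimately have "fisher_info M ?V = (\<integral>\<^sup>+\<omega>. ennreal ((g.dens1 t (?V \<omega>) / g.dens t (?V \<omega>))\<^sup>2) \<partial>M)"
    unfolding fisher_info_def score_def by simp
  also have "\<dots> = (\<integral>\<^sup>+x. ennreal (g.dens t x) * ennreal ((g.dens1 t x / g.dens t x)\<^sup>2) \<partial>lborel)"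
    by (rule distributed_nn_integral[OF d, symmetric]) measurable
  also have "\<dots> = (\<integral>\<^sup>+x. ennreal ((g.dens1 t x)\<^sup>2 / g.dens t x) \<partial>lborel)"
  proof (rule nn_integral_cong)
    fix x
    have "g.dens t x > 0" by (rule g.dens_pos[OF t])
    then show "ennreal (g.dens t x) * ennreal ((g.dens1 t x / g.dens t x)\<^sup>2) = ennreal ((g.dens1 t x)\<^sup>2 / g.dens t x)"
      by (simp add: power2_eq_square field_simps flip: ennreal_mult')
  qed
  also have "\<dots> = ennreal (g.fisher t)"
    unfolding g.fisher_def using g.dens_pos[OF t]
    by (intro nn_integral_eq_integral g.fisher_integrable[OF t]) (auto intro!: AE_I2 divide_nonneg_pos)
  finally show ?thesis .
qed

lemma gauss_conv_gauss:
  assumes "s > 0" "t > 0"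
  shows "(\<integral>u. gauss t (x - u) * gauss s u \<partial>lborel) = gauss (s + t) x"
proof -
  have "(\<integral>\<^sup>+u. ennreal (gauss t (x - u) * gauss s u) \<partial>lborel) = ennreal (gauss (s + t) x)"
    using fun_cong[OF conv_normal_density_zero_mean[of "sqrt t" "sqrt s"], of x] assms
    by (simp add: gauss_eq_normal_density add.commute)
  then show ?thesis
    using gauss_pos assms
    by (subst integral_eq_nn_integral) (auto intro!: AE_I2 mult_nonneg_nonneg less_imp_le[OF gauss_pos])
qed

text \<open>The score term is dominated by \<open>fisher_majorant\<close>, whose integral \<open>1 / t\<close> does not
  depend on the law, so Fatou's lemma applies to the difference.\<close>

lemma fisher_weak_limit:
  fixes \<nu> :: "nat \<Rightarrow> real measure"
  assumes \<nu>: "\<And>n. gauss_smoothing (\<nu> n)" and v: "v > 0" and t: "t > 0"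
    and weak: "weak_conv_m \<nu> (density lborel (\<lambda>x. ennreal (gauss v x)))"
    and e: "e > 0"
  shows "\<forall>\<^sub>F n in sequentially. gauss_smoothing.fisher (\<nu> n) t < 1 / (v + t) + e"
proof -
  interpret n: gauss_smoothing "\<nu> n" for n by (rule \<nu>)
  define \<gamma> where "\<gamma> = density lborel (\<lambda>x. ennreal (gauss v x))"
  have gm: "gauss v x \<ge> 0" for x using gauss_pos[OF v, of x] by simp
  interpret p: prob_space \<gamma>
    unfolding \<gamma>_def gauss_eq_normal_density[OF v] using v by (intro prob_space_normal_density) simp
  interpret r: real_distribution \<gamma> by unfold_locales (auto simp: \<gamma>_def)
  interpret g: gauss_smoothing \<gamma>
  proof
    show "integrable \<gamma> (\<lambda>u. u\<^sup>2)"
      unfolding \<gamma>_def using gm gauss_integral_square(1)[OF v]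
      by (subst integrable_density) (auto simp: mult.commute)
  qed
  have gd: "g.dens t = gauss (v + t)"
  proof
    fix x
    have "g.dens t x = (\<integral>u. gauss v u *\<^sub>R gauss t (x - u) \<partial>lborel)"
      unfolding g.dens_def unfolding \<gamma>_def by (rule integral_density) (use gm in auto)
    then show "g.dens t x = gauss (v + t) x"
      using gauss_conv_gauss[OF v t, of x] by (simp add: mult.commute)
  qed
  have vt: "v + t > 0" using v t by simp
  have gd1: "g.dens1 t x = - x / (v + t) * gauss (v + t) x" for x
    using DERIV_unique[OF g.dens_DERIV(1)[OF t, of x, unfolded gd] gauss_DERIV[OF vt]] .
  have gf: "g.fisher t = 1 / (v + t)"
  proof -
    have "(g.dens1 t x)\<^sup>2 / g.dens t x = 1 / (v + t)\<^sup>2 * (x\<^sup>2 * gauss (v + t) x)" for x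
    proof -
      have "(y * G)\<^sup>2 / G = y\<^sup>2 * G" if "G > 0" for y G :: real
        using that by (simp add: power2_eq_square)
      from this[OF gauss_pos[OF vt], of "- x / (v + t)" x]
      have "(g.dens1 t x)\<^sup>2 / g.dens t x = (- x / (v + t))\<^sup>2 * gauss (v + t) x"
        unfolding gd gd1 .
      then show ?thesis by (simp add: power_divide)
    qed
    then show ?thesis
      unfolding g.fisher_def using gauss_integral_square(2)[OF vt] vt by (simp add: power2_eq_square)
  qed
  \<comment> \<open>For fixed \<open>x\<close> the kernels are bounded continuous functions of
    \<open>u\<close>, so weak convergence gives convergence at every \<open>x\<close> of the
    density, its derivative and the majorant.\<close>
  have lim: "(\<lambda>n. \<integral>u. poly_gauss q t (x - u) \<partial>\<nu> n) \<longlonglongrightarrow> (\<integral>u. poly_gauss q t (x - u) \<partial>\<gamma>)" for q x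
  proof -
    obtain C where C: "\<And>x. \<bar>poly_gauss q t x\<bar> \<le> C" using poly_gauss_bounded[OF t] by blast
    show ?thesis
    proof (rule weak_conv_imp_integral_bdd_continuous_conv)
      show "weak_conv_m \<nu> \<gamma>" using weak by (simp add: \<gamma>_def)
      show "isCont (\<lambda>u. poly_gauss q t (x - u)) u" for u
        by (intro isCont_o2[OF _ DERIV_isCont[OF poly_gauss_DERIV[OF t]]] continuous_intros)
      show "norm (poly_gauss q t (x - u)) \<le> C" for u using C by simp
    qed (unfold_locales)
  qed
  have l0: "(\<lambda>n. n.dens n t x) \<longlonglongrightarrow> g.dens t x" for x
    using lim[of 1 x] unfolding n.dens_eq g.dens_eq n.conv_poly_def g.conv_poly_def .
  have l1: "(\<lambda>n. n.dens1 n t x) \<longlonglongrightarrow> g.dens1 t x" for x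
    using lim[of "dpoly t 1" x] unfolding n.dens_eq g.dens_eq n.conv_poly_def g.conv_poly_def .
  have l2: "(\<lambda>n. n.fisher_majorant n t x) \<longlonglongrightarrow> g.fisher_majorant t x" for x
    using tendsto_divide[OF lim[of "[:0, 0, 1:]" x] tendsto_const[of "t\<^sup>2"]] t
    unfolding n.fisher_majorant_def g.fisher_majorant_def by (simp add: poly_gauss_def power2_eq_square)
  define F where "F n x = n.fisher_majorant n t x - (n.dens1 n t x)\<^sup>2 / n.dens n t x" for n x
  define Fg where "Fg x = g.fisher_majorant t x - (g.dens1 t x)\<^sup>2 / g.dens t x" for x
  have F0: "0 \<le> F n x" "0 \<le> Fg x" for n x
    using n.score_le_majorant[OF t, of n x] g.score_le_majorant[OF t, of x] by (auto simp: F_def Fg_def)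
  have Fi: "(\<integral>\<^sup>+x. ennreal (F n x) \<partial>lborel) = ennreal (1 / t - n.fisher n t)" for n
  proof -
    have "integrable lborel (F n)" unfolding F_def
      using n.fisher_majorant_integral(1)[OF t] n.fisher_integrable[OF t] by (intro Bochner_Integration.integrable_diff)
    then have "(\<integral>\<^sup>+x. ennreal (F n x) \<partial>lborel) = ennreal (\<integral>x. F n x \<partial>lborel)"
      by (rule nn_integral_eq_integral) (use F0 in auto)
    also have "(\<integral>x. F n x \<partial>lborel) = 1 / t - n.fisher n t"
      unfolding F_def n.fisher_def n.fisher_majorant_integral(2)[OF t, symmetric, of n]
      by (rule Bochner_Integration.integral_diff[OF n.fisher_majorant_integral(1)[OF t] n.fisher_integrable[OF t]])
    finally show ?thesis .
  qed
  have Fgi: "(\<integral>\<^sup>+x. ennreal (Fg x) \<partial>lborel) = ennreal (1 / t - g.fisher t)"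
  proof -
    have "integrable lborel Fg" unfolding Fg_def
      using g.fisher_majorant_integral(1)[OF t] g.fisher_integrable[OF t] by (intro Bochner_Integration.integrable_diff)
    then have "(\<integral>\<^sup>+x. ennreal (Fg x) \<partial>lborel) = ennreal (\<integral>x. Fg x \<partial>lborel)"
      by (rule nn_integral_eq_integral) (use F0 in auto)
    also have "(\<integral>x. Fg x \<partial>lborel) = 1 / t - g.fisher t"
      unfolding Fg_def g.fisher_def g.fisher_majorant_integral(2)[OF t, symmetric]
      by (rule Bochner_Integration.integral_diff[OF g.fisher_majorant_integral(1)[OF t] g.fisher_integrable[OF t]])
    finally show ?thesis .
  qed
  have Fm[measurable]: "F n \<in> borel_measurable borel" for n
    unfolding F_def n.fisher_majorant_def by measurable
  have Flim: "liminf (\<lambda>n. ennreal (F n x)) = ennreal (Fg x)" for x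
  proof (rule lim_imp_Liminf)
    have "(\<lambda>n. F n x) \<longlonglongrightarrow> Fg x"
      unfolding F_def Fg_def using g.dens_pos[OF t, of x]
      by (intro tendsto_intros l0 l1 l2) auto
    then show "(\<lambda>n. ennreal (F n x)) \<longlonglongrightarrow> ennreal (Fg x)" by (rule tendsto_ennrealI)
  qed simp
  have "ennreal (1 / t - 1 / (v + t)) \<le> liminf (\<lambda>n. ennreal (1 / t - n.fisher n t))"
    using nn_integral_liminf[of "\<lambda>n x. ennreal (F n x)" lborel] by (simp add: Flim Fgi Fi gf)
  note fatou = this
  show ?thesis
  \<comment> \<open>If this number is negative, \<open>ennreal\<close> would truncate it to 0 and
    the comparison would lose its meaning; in that case the bound \<open>1 / t\<close> is already
    strong enough.\<close>
  proof (cases "1 / t - 1 / (v + t) - e < 0")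
    case True
    have "n.fisher n t < 1 / (v + t) + e" for n
      using n.fisher_le[OF t, of n] True by linarith
    then show ?thesis by simp
  next
    case False
    then have "ennreal (1 / t - 1 / (v + t) - e) < ennreal (1 / t - 1 / (v + t))"
      using e by (intro ennreal_lessI) auto
    then have "\<forall>\<^sub>F n in sequentially. ennreal (1 / t - 1 / (v + t) - e) < ennreal (1 / t - n.fisher n t)"
      using less_LiminfD[OF less_le_trans[OF _ fatou]] by blast
    then show ?thesis
    proof eventually_elim
      case (elim n)
      then have "1 / t - 1 / (v + t) - e < 1 / t - n.fisher n t"
        using False by (simp add: ennreal_less_iff)
      then show ?case by linarith
    qed
  qed
qed

section \<open>Relative entropy and the variational inequality\<close>

lemma integrable_exp_bounded_normal:
  fixes \<psi> :: "real \<Rightarrow> real"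
  assumes [measurable]: "\<psi> \<in> borel_measurable borel" and bnd: "\<And>x. \<psi> x \<le> c"
  shows "integrable lborel (\<lambda>x. exp (\<psi> x) * std_normal_density x)"
proof (rule Bochner_Integration.integrable_bound[of lborel "\<lambda>x. exp c * std_normal_density x"])
  show "AE x in lborel. norm (exp (\<psi> x) * std_normal_density x) \<le> norm (exp c * std_normal_density x)"
    using bnd by (auto intro!: AE_I2 mult_right_mono simp: abs_mult)
qed auto

lemma std_normal_density_le_1: "std_normal_density x \<le> 1"
proof -
  have "1 \<le> sqrt (2 * pi)" using pi_ge_two by simp
  then have "1 / sqrt (2 * pi) * exp (- x\<^sup>2 / 2) \<le> 1 * 1"
    by (intro mult_mono) auto
  then show ?thesis by (simp add: std_normal_density_def)
qed

text \<open>Multiples of the distance to the complement, cut off at 1. The complement has to be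
  nonempty, since the distance to the empty set is 0 by convention.\<close>

lemma indicator_open_approx_continuous:
  fixes G :: "real set"
  assumes "open G" "G \<noteq> UNIV"
  shows "\<exists>\<psi>. (\<forall>k x. isCont (\<psi> k) x) \<and> (\<forall>k x. 0 \<le> \<psi> k x \<and> \<psi> k x \<le> indicator G x) \<and>
    (\<forall>x. (\<lambda>k::nat. \<psi> k x) \<longlonglongrightarrow> (indicator G x :: real))"
proof (intro exI conjI allI)
  let ?\<psi> = "\<lambda>k x. min 1 (real k * infdist x (- G))"
  have cl: "closed (- G)" "- G \<noteq> {}" using assms by (auto simp: closed_def)
  fix k :: nat and x :: real
  show "isCont (?\<psi> k) x" by (intro continuous_intros)
  show "0 \<le> ?\<psi> k x" by (simp add: infdist_nonneg)
  show "?\<psi> k x \<le> indicator G x" by (auto simp: indicator_def)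
  show "(\<lambda>k. ?\<psi> k x) \<longlonglongrightarrow> indicator G x"
  proof (cases "x \<in> G")
    case True
    then have d: "infdist x (- G) > 0" using infdist_pos_not_in_closed[OF cl] by auto
    obtain K :: nat where K: "1 / infdist x (- G) < real K" using reals_Archimedean2 by blast
    have "\<forall>\<^sub>F k in sequentially. ?\<psi> k x = 1"
      using eventually_ge_at_top[of K]
    proof eventually_elim
      case (elim k)
      then have "1 / infdist x (- G) \<le> real k" using K by linarith
      then show ?case using d by (simp add: divide_le_eq)
    qed
    then show ?thesis using True by (simp add: tendsto_eventually)
  qed simp
qed

section \<open>Existence of a density from the variational inequality\<close>

context prob_space
begin

context
  fixes W :: "'a \<Rightarrow> real" and B :: real
  assumes W[measurable]: "W \<in> borel_measurable M" and B: "0 \<le> B"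
    and dv: "\<And>\<psi> c. (\<And>x. isCont \<psi> x) \<Longrightarrow> (\<And>x. \<bar>\<psi> x\<bar> \<le> c) \<Longrightarrow>
      expectation (\<lambda>\<omega>. \<psi> (W \<omega>)) \<le> B + (\<integral>x. exp (\<psi> x) * std_normal_density x \<partial>lborel) - 1"
begin

text \<open>The test function is \<open>c\<close> times an approximation of the indicator of
  \<open>G\<close> from below. Since the normal density is at most 1, the exponential integral
  exceeds 1 by no more than \<open>exp c - 1\<close> times the Lebesgue measure of
  \<open>G\<close>.\<close>

lemma dv_open:
  assumes G: "open G" "G \<noteq> UNIV" and c: "c \<ge> 0"
    and Gm: "emeasure lborel G \<le> ennreal e" "e \<ge> 0"
  shows "c * prob (W -` G \<inter> space M) \<le> B + (exp c - 1) * e"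
proof -
  obtain \<psi> where \<psi>: "\<And>k x. isCont (\<psi> k) x" "\<And>k x. 0 \<le> \<psi> k x" "\<And>k x. \<psi> k x \<le> indicator G x"
    "\<And>x. (\<lambda>k::nat. \<psi> k x) \<longlonglongrightarrow> (indicator G x :: real)"
    using indicator_open_approx_continuous[OF G] by blast
  have [measurable]: "G \<in> sets borel" using G by simp
  have [measurable]: "\<psi> k \<in> borel_measurable borel" for k
    using \<psi>(1) by (intro borel_measurable_continuous_onI continuous_at_imp_continuous_on) auto
  have \<psi>1: "\<psi> k x \<le> 1" for k x using \<psi>(3)[of k x] by (cases "x \<in> G") auto
  have iO: "integrable lborel (indicat_real G)"
    using Gm(1) by (auto simp: integrable_indicator_iff intro: le_less_trans)
  have mO: "measure lborel G \<le> e" using Gm by (simp add: measure_def enn2real_leI)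
  have bound: "c * expectation (\<lambda>\<omega>. \<psi> k (W \<omega>)) \<le> B + (exp c - 1) * e" for k
  proof -
    have "expectation (\<lambda>\<omega>. c * \<psi> k (W \<omega>)) \<le> B + (\<integral>x. exp (c * \<psi> k x) * std_normal_density x \<partial>lborel) - 1"
      by (rule dv[of "\<lambda>x. c * \<psi> k x" c]) (use \<psi> \<psi>1 c in \<open>auto intro!: continuous_intros mult_left_le simp: abs_mult\<close>)
    also have "(\<integral>x. exp (c * \<psi> k x) * std_normal_density x \<partial>lborel) \<le> (\<integral>x. std_normal_density x + (exp c - 1) * indicator G x \<partial>lborel)"
    proof (rule integral_mono)
      show "integrable lborel (\<lambda>x. exp (c * \<psi> k x) * std_normal_density x)"
        by (rule integrable_exp_bounded_normal[where c=c]) (use \<psi>1 c in \<open>auto intro: mult_left_le\<close>)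
      show "integrable lborel (\<lambda>x. std_normal_density x + (exp c - 1) * indicator G x)" using iO by simp
      fix x
      have n: "0 \<le> std_normal_density x" by simp
      show "exp (c * \<psi> k x) * std_normal_density x \<le> std_normal_density x + (exp c - 1) * indicator G x"
      proof (cases "x \<in> G")
        case True
        have "c * \<psi> k x \<le> c" using \<psi>1[of k x] c by (rule mult_left_le)
        then have "exp (c * \<psi> k x) * std_normal_density x \<le> exp c * std_normal_density x" by (simp add: mult_right_mono)
        also have "\<dots> = std_normal_density x + (exp c - 1) * std_normal_density x" by (simp add: algebra_simps)
        also have "\<dots> \<le> std_normal_density x + (exp c - 1) * 1"
          using c std_normal_density_le_1[of x] by (intro add_left_mono mult_left_mono) auto
        finally show ?thesis using True by simp
      next
        case False
        then have "\<psi> k x = 0" using \<psi>(2,3)[of k x] by simp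
        then show ?thesis using False by simp
      qed
    qed
    also have "\<dots> = 1 + (exp c - 1) * measure lborel G" using iO by simp
    also have "\<dots> \<le> 1 + (exp c - 1) * e" using c mO by (intro add_left_mono mult_left_mono) auto
    finally show ?thesis by simp
  qed
  have "(\<lambda>k. expectation (\<lambda>\<omega>. \<psi> k (W \<omega>))) \<longlonglongrightarrow> expectation (\<lambda>\<omega>. indicator G (W \<omega>))"
    by (rule integral_dominated_convergence[where w="\<lambda>_. 1"]) (use \<psi> \<psi>1 in auto)
  also have "expectation (\<lambda>\<omega>. indicator G (W \<omega>)) = expectation (indicator (W -` G \<inter> space M))"
    by (rule Bochner_Integration.integral_cong) (auto simp: indicator_def)
  also have "\<dots> = prob (W -` G \<inter> space M)" by simp
  finally have "(\<lambda>k. c * expectation (\<lambda>\<omega>. \<psi> k (W \<omega>))) \<longlonglongrightarrow> c * prob (W -` G \<inter> space M)"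
    by (intro tendsto_intros)
  then show ?thesis by (rule LIMSEQ_le_const2) (use bound in auto)
qed

text \<open>A null set lies in open sets of arbitrarily small measure \<open>e\<close>. For each
  \<open>c\<close> this measure can be chosen small against \<open>exp c - 1\<close>, so
  \<open>c * ?P \<le> B\<close> for all \<open>c > 0\<close>, and the probability vanishes.\<close>

lemma dv_absolutely_continuous: "absolutely_continuous lborel (distr M borel W)"
  unfolding absolutely_continuous_def
proof
  fix A :: "real set" assume A: "A \<in> null_sets lborel"
  then have [measurable]: "A \<in> sets borel" and A0: "emeasure lborel A = 0" by auto
  let ?P = "prob (W -` A \<inter> space M)"
  have *: "c * ?P \<le> B + (exp c - 1) * e" if c: "c \<ge> 0" and e: "e > 0" for c e
  proof -
    obtain U where U: "open U" "A \<subseteq> U" "emeasure lborel (U - A) < ennreal e"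
      using outer_regular_lborel[of A e] e by auto
    have [measurable]: "U \<in> sets borel" using U by simp
    have "emeasure lborel U \<le> emeasure lborel A + emeasure lborel (U - A)"
      using emeasure_subadditive[of A lborel "U - A"] U by (simp add: Un_absorb1)
    then have Ue: "emeasure lborel U \<le> ennreal e" using U(3) A0 by simp
    have "U \<noteq> UNIV" using Ue by (auto simp: top_unique)
    from dv_open[OF U(1) this c Ue] e
    have "c * prob (W -` U \<inter> space M) \<le> B + (exp c - 1) * e" by simp
    moreover have "?P \<le> prob (W -` U \<inter> space M)" using U by (intro finite_measure_mono) auto
    ultimately show ?thesis using mult_left_mono[OF _ c, of ?P "prob (W -` U \<inter> space M)"] by linarith
  qed
  have cB: "c * ?P \<le> B" if c: "c > 0" for c
  proof (rule field_le_epsilon)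
    fix e :: real assume e: "e > 0"
    have "exp c - 1 > 0" using c by simp
    then show "c * ?P \<le> B + e" using *[of c "e / (exp c - 1)"] c e by simp
  qed
  have "?P = 0"
  proof (rule ccontr)
    assume "?P \<noteq> 0"
    then have "?P > 0" by (simp add: zero_less_measure_iff)
    then show False using cB[of "(B + 1) / ?P"] B by simp
  qed
  then have "emeasure M (W -` A \<inter> space M) = 0" by (simp add: emeasure_eq_measure)
  then show "A \<in> null_sets (distr M borel W)"
    by (auto simp: null_sets_def emeasure_distr)
qed

lemma dv_has_density: "\<exists>g. is_density M W g"
proof -
  interpret D: prob_space "distr M borel W" by (rule prob_space_distr) simp
  have "\<exists>d. d \<in> borel_measurable lborel \<and> (AE x in lborel. RN_deriv lborel (distr M borel W) x = ennreal (d x)) \<and> (\<forall>x. 0 \<le> d x)"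
    by (rule sigma_finite_measure.real_RN_deriv[OF lborel.sigma_finite_measure_axioms D.finite_measure_axioms dv_absolutely_continuous]) auto
  then obtain d where d: "d \<in> borel_measurable lborel" "AE x in lborel. RN_deriv lborel (distr M borel W) x = ennreal (d x)"
      "\<And>x. 0 \<le> d x"
    by blast
  have "density lborel (RN_deriv lborel (distr M borel W)) = distr M borel W"
    by (rule sigma_finite_measure.density_RN_deriv[OF lborel.sigma_finite_measure_axioms dv_absolutely_continuous]) simp
  moreover have "density lborel (RN_deriv lborel (distr M borel W)) = density lborel (\<lambda>x. ennreal (d x))"
    by (rule density_cong) (use d in auto)
  moreover have "distr M borel W = distr M lborel W" by (rule distr_cong) auto
  ultimately have "distributed M lborel W (\<lambda>x. ennreal (d x))"
    using d(1) unfolding distributed_def by auto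
  then show ?thesis using d(3) unfolding is_density_def by blast
qed

text \<open>A measurable function is a limit of continuous ones off a negligible set, and this set
  has no weight now that the law has a density. The approximations are clipped to
  \<open>[- c, c]\<close> so that dominated convergence applies.\<close>

lemma dv_measurable:
  assumes g: "is_density M W g" and [measurable]: "\<psi> \<in> borel_measurable borel" and bnd: "\<And>x. \<bar>\<psi> x\<bar> \<le> c"
  shows "(\<integral>x. g x * \<psi> x \<partial>lborel) \<le> B + (\<integral>x. exp (\<psi> x) * std_normal_density x \<partial>lborel) - 1"
proof -
  have gd: "distributed M lborel W (\<lambda>x. ennreal (g x))" and g0: "\<And>x. 0 \<le> g x"
    using g by (auto simp: is_density_def)
  have [measurable]: "g \<in> borel_measurable borel"
    using distributed_real_measurable[OF _ gd] g0 by simp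
  have gi: "integrable lborel g"
    using distributed_integrable[OF gd, of "\<lambda>_. 1 :: real"] g0 by simp
  have c0: "0 \<le> c" using bnd[of 0] by linarith
  have "\<psi> measurable_on UNIV"
    by (rule lebesgue_measurable_imp_measurable_on_real) (auto intro: measurable_completion)
  then obtain N h where N: "negligible N" and h: "\<And>n. continuous_on UNIV (h n)" "\<And>x. x \<notin> N \<Longrightarrow> (\<lambda>n. h n x) \<longlonglongrightarrow> \<psi> x"
    unfolding measurable_on_def by auto
  define k where "k n x = max (- c) (min c (h n x))" for n :: nat and x
  have kb: "\<bar>k n x\<bar> \<le> c" for n x using c0 unfolding k_def by auto
  have kc: "isCont (k n) x" for n x
    unfolding k_def[abs_def] using h(1)[of n] by (intro continuous_intros) (simp add: continuous_on_eq_continuous_at)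
  have [measurable]: "k n \<in> borel_measurable borel" for n
    using kc by (intro borel_measurable_continuous_onI continuous_at_imp_continuous_on) auto
  have "AE x in lebesgue. x \<notin> N"
    using N by (simp add: negligible_iff_null_sets AE_not_in)
  then have AEN: "AE x in lborel. x \<notin> N" by (simp add: AE_completion_iff)
  have kl: "AE x in lborel. (\<lambda>n. k n x) \<longlonglongrightarrow> \<psi> x"
    using AEN
  proof eventually_elim
    case (elim x)
    have "(\<lambda>n. max (- c) (min c (h n x))) \<longlonglongrightarrow> max (- c) (min c (\<psi> x))"
      by (intro tendsto_intros h(2) elim)
    moreover have "max (- c) (min c (\<psi> x)) = \<psi> x" using bnd[of x] by auto
    ultimately show ?case by (simp add: k_def)
  qed
  have "(\<lambda>n. \<integral>x. g x * k n x \<partial>lborel) \<longlonglongrightarrow> (\<integral>x. g x * \<psi> x \<partial>lborel)"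
  proof (rule integral_dominated_convergence[where w="\<lambda>x. g x * c"])
    show "AE x in lborel. (\<lambda>n. g x * k n x) \<longlonglongrightarrow> g x * \<psi> x"
      using kl by eventually_elim (intro tendsto_intros)
    show "AE x in lborel. norm (g x * k n x) \<le> g x * c" for n
      using kb g0 by (auto intro!: AE_I2 mult_left_mono simp: abs_mult)
  qed (use gi in auto)
  moreover have "(\<lambda>n. \<integral>x. exp (k n x) * std_normal_density x \<partial>lborel) \<longlonglongrightarrow> (\<integral>x. exp (\<psi> x) * std_normal_density x \<partial>lborel)"
  proof (rule integral_dominated_convergence[where w="\<lambda>x. exp c * std_normal_density x"])
    show "AE x in lborel. (\<lambda>n. exp (k n x) * std_normal_density x) \<longlonglongrightarrow> exp (\<psi> x) * std_normal_density x"
      using kl by eventually_elim (intro tendsto_intros)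
    have "k n x \<le> c" for n x using kb[of n x] by linarith
    then show "AE x in lborel. norm (exp (k n x) * std_normal_density x) \<le> exp c * std_normal_density x" for n
      by (auto intro!: AE_I2 mult_right_mono simp: abs_mult)
  qed auto
  then have "(\<lambda>n. B + (\<integral>x. exp (k n x) * std_normal_density x \<partial>lborel) - 1) \<longlonglongrightarrow> B + (\<integral>x. exp (\<psi> x) * std_normal_density x \<partial>lborel) - 1"
    by (intro tendsto_intros)
  ultimately show ?thesis
  proof (rule LIMSEQ_le)
    have "(\<integral>x. g x * k n x \<partial>lborel) \<le> B + (\<integral>x. exp (k n x) * std_normal_density x \<partial>lborel) - 1" for n
      using dv[OF kc kb, of n] distributed_integral[OF gd, of "k n"] g0 by simp
    then show "\<exists>N. \<forall>n\<ge>N. (\<integral>x. g x * k n x \<partial>lborel) \<le> B + (\<integral>x. exp (k n x) * std_normal_density x \<partial>lborel) - 1" by blast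
  qed
qed

end

section \<open>Bounds on the relative entropy\<close>

lemma density_facts:
  assumes "is_density M W g"
  shows "0 \<le> g x" "g \<in> borel_measurable borel" "integrable lborel g" "(\<integral>\<^sup>+x. ennreal (g x) \<partial>lborel) = 1"
proof -
  have gd: "distributed M lborel W (\<lambda>x. ennreal (g x))" and g0: "\<And>x. 0 \<le> g x"
    using assms by (auto simp: is_density_def)
  show "0 \<le> g x" by (rule g0)
  show "g \<in> borel_measurable borel"
    using distributed_real_measurable[OF _ gd] g0 by simp
  show "integrable lborel g"
    using distributed_integrable[OF gd, of "\<lambda>_. 1 :: real"] g0 by simp
  show "(\<integral>\<^sup>+x. ennreal (g x) \<partial>lborel) = 1"
    using distributed_nn_integral[OF gd, of "\<lambda>_. 1"] by (simp add: emeasure_space_1)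
qed

lemma rel_entropy_integrand_le:
  assumes "0 \<le> (y::real)" "0 < z"
  shows "- (y * ln (y / z)) \<le> z - y"
proof (cases "y = 0")
  case False
  then have y: "y > 0" using assms by simp
  have "ln (z / y) \<le> z / y - 1" using y assms by (intro ln_le_minus_one) auto
  then have "y * ln (z / y) \<le> y * (z / y - 1)" using y by (intro mult_left_mono) auto
  also have "y * (z / y - 1) = z - y" using y by (simp add: right_diff_distrib)
  also have "y * ln (z / y) = - (y * ln (y / z))" using y assms by (simp add: ln_div algebra_simps)
  finally show ?thesis .
qed (use assms in simp)

text \<open>Both claims integrate the pointwise inequality
  \<open>- F x \<le> std_normal_density x - g x\<close>. The first makes the difference in
  \<open>rel_entropy\<close> well defined; the second is Gibbs' inequality, written without
  subtraction because the positive part may have infinite integral.\<close>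

lemma rel_entropy_parts:
  assumes g: "is_density M W g"
  defines "F \<equiv> \<lambda>x. g x * ln (g x / std_normal_density x)"
  shows "(\<integral>\<^sup>+x. ennreal (- F x) \<partial>lborel) \<le> 1"
    and "(\<integral>\<^sup>+x. ennreal (- F x) \<partial>lborel) \<le> (\<integral>\<^sup>+x. ennreal (F x) \<partial>lborel)"
proof -
  note [measurable] = density_facts(2)[OF g]
  have [measurable]: "F \<in> borel_measurable borel" unfolding F_def by measurable
  have n: "std_normal_density x > 0" for x by (rule normal_density_pos) simp
  have Fg: "- F x \<le> std_normal_density x - g x" for x
    unfolding F_def by (rule rel_entropy_integrand_le[OF density_facts(1)[OF g] n])
  have one: "(\<integral>\<^sup>+x. ennreal (std_normal_density x) \<partial>lborel) = 1"
    by (subst nn_integral_eq_integral) (auto simp: one_ennreal_def)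
  have "(\<integral>\<^sup>+x. ennreal (- F x) \<partial>lborel) \<le> (\<integral>\<^sup>+x. ennreal (std_normal_density x) \<partial>lborel)"
  proof (rule nn_integral_mono, rule ennreal_leI)
    fix x show "- F x \<le> std_normal_density x" using Fg[of x] density_facts(1)[OF g, of x] by linarith
  qed
  then show le1: "(\<integral>\<^sup>+x. ennreal (- F x) \<partial>lborel) \<le> 1" using one by simp
  have "(\<integral>\<^sup>+x. ennreal (- F x) \<partial>lborel) + 1 = (\<integral>\<^sup>+x. ennreal (- F x) + ennreal (g x) \<partial>lborel)"
    by (subst nn_integral_add) (auto simp: density_facts(4)[OF g])
  also have "\<dots> \<le> (\<integral>\<^sup>+x. ennreal (F x) + ennreal (std_normal_density x) \<partial>lborel)"
  proof (rule nn_integral_mono)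
    fix x
    show "ennreal (- F x) + ennreal (g x) \<le> ennreal (F x) + ennreal (std_normal_density x)"
    proof (cases "F x \<ge> 0")
      case True
      then have "ennreal (- F x) + ennreal (g x) = ennreal (g x)" by (simp add: ennreal_neg)
      also have "\<dots> \<le> ennreal (F x + std_normal_density x)" using Fg[of x] by (intro ennreal_leI) linarith
      finally show ?thesis using True by simp
    next
      case False
      then have "ennreal (- F x) + ennreal (g x) = ennreal (- F x + g x)"
        using density_facts(1)[OF g, of x] by (intro ennreal_plus[symmetric]) auto
      also have "\<dots> \<le> ennreal (std_normal_density x)" using Fg[of x] by (intro ennreal_leI) linarith
      finally show ?thesis by (simp add: add_increasing)
    qed
  qed
  also have "\<dots> = (\<integral>\<^sup>+x. ennreal (F x) \<partial>lborel) + 1"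
    by (subst nn_integral_add) (auto simp: one)
  finally show "(\<integral>\<^sup>+x. ennreal (- F x) \<partial>lborel) \<le> (\<integral>\<^sup>+x. ennreal (F x) \<partial>lborel)"
    by (simp add: ennreal_add_left_cancel_le add.commute)
qed

lemma rel_entropy_nonneg:
  assumes g: "is_density M W g"
  shows "0 \<le> rel_entropy g std_normal_density"
proof -
  note p = rel_entropy_parts[OF g]
  let ?n = "\<integral>\<^sup>+x. ennreal (- (g x * ln (g x / std_normal_density x))) \<partial>lborel"
  have "?n < \<infinity>" using p(1) by (rule le_less_trans) simp
  then have "\<bar>enn2ereal ?n\<bar> \<noteq> \<infinity>" by (cases ?n) auto
  moreover have "enn2ereal ?n \<le> enn2ereal (\<integral>\<^sup>+x. ennreal (g x * ln (g x / std_normal_density x)) \<partial>lborel)"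
    using p(2) by (simp add: less_eq_ennreal.rep_eq)
  ultimately show ?thesis unfolding rel_entropy_def by (simp add: ereal_diff_positive)
qed

text \<open>The test function is the logarithm of the likelihood ratio clipped to
  \<open>[- k, k]\<close>. Its exponential integral is at most \<open>1 + exp (- k)\<close>, so the
  constant \<open>- 1\<close> in the variational inequality cancels the 1, and Fatou's lemma removes
  the clipping.\<close>

lemma rel_entropy_le:
  assumes g: "is_density M W g" and B: "0 \<le> B"
    and dv: "\<And>\<psi> c. \<psi> \<in> borel_measurable borel \<Longrightarrow> (\<And>x. \<bar>\<psi> x\<bar> \<le> c) \<Longrightarrow>
      (\<integral>x. g x * \<psi> x \<partial>lborel) \<le> B + (\<integral>x. exp (\<psi> x) * std_normal_density x \<partial>lborel) - 1"
  shows "rel_entropy g std_normal_density \<le> ereal B"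
proof -
  let ?\<phi> = std_normal_density
  define F where "F x = g x * ln (g x / ?\<phi> x)" for x
  note [measurable] = density_facts(2)[OF g]
  note g0 = density_facts(1)[OF g] and gi = density_facts(3)[OF g]
  have [measurable]: "F \<in> borel_measurable borel" unfolding F_def by measurable
  have ph: "?\<phi> x > 0" for x by (rule normal_density_pos) simp
  \<comment> \<open>Where \<open>g\<close> vanishes the logarithm of the ratio stands for minus
    infinity, so the clipped value is set to \<open>- k\<close>. There \<open>exp (L k x)\<close>
    equals \<open>exp (- k)\<close>, which keeps the exponential integral near 1.\<close>
  define L where "L k x = (if g x = 0 then - real k else max (- real k) (min (real k) (ln (g x / ?\<phi> x))))" for k x
  have Lm[measurable]: "L k \<in> borel_measurable borel" for k unfolding L_def by measurable
  have Lb: "\<bar>L k x\<bar> \<le> real k" for k x unfolding L_def by auto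
  have iL: "integrable lborel (\<lambda>x. g x * L k x)" for k
    by (rule Bochner_Integration.integrable_bound[of lborel "\<lambda>x. real k * g x"])
      (use gi Lb g0 in \<open>auto intro!: AE_I2 mult_right_mono simp: abs_mult mult.commute[of "g _"]\<close>)
  have iLp: "integrable lborel (\<lambda>x. g x * max 0 (L k x))" "integrable lborel (\<lambda>x. g x * max 0 (- L k x))" for k
    by (rule Bochner_Integration.integrable_bound[OF iL[of k]];
      use g0 in \<open>auto intro!: AE_I2 mult_left_mono simp: abs_mult\<close>)+
  \<comment> \<open>The integral \<open>n\<close> of the negative part is finite. It is added to the
    bound so that Fatou's lemma deals with nonnegative functions, and subtracted again at the
    end.\<close>
  define n where "n = enn2real (\<integral>\<^sup>+x. ennreal (- F x) \<partial>lborel)"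
  have neg: "(\<integral>\<^sup>+x. ennreal (- F x) \<partial>lborel) = ennreal n"
    using rel_entropy_parts(1)[OF g] unfolding n_def F_def by (simp add: ennreal_enn2real le_less_trans[OF _ ennreal_one_less_top])
  have n0: "0 \<le> n" unfolding n_def by simp
  have Ln: "(\<integral>x. g x * max 0 (- L k x) \<partial>lborel) \<le> n" for k
  proof -
    have "ennreal (\<integral>x. g x * max 0 (- L k x) \<partial>lborel) = (\<integral>\<^sup>+x. ennreal (g x * max 0 (- L k x)) \<partial>lborel)"
      by (rule nn_integral_eq_integral[symmetric, OF iLp(2)]) (use g0 in auto)
    also have "\<dots> \<le> (\<integral>\<^sup>+x. ennreal (- F x) \<partial>lborel)"
    proof (rule nn_integral_mono)
      fix x
      show "ennreal (g x * max 0 (- L k x)) \<le> ennreal (- F x)"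
      proof (cases "g x = 0 \<or> L k x \<ge> 0")
        case False
        then have l: "- L k x \<le> - ln (g x / ?\<phi> x)" and m: "max 0 (- L k x) = - L k x"
          by (auto simp: L_def max_def min_def split: if_splits)
        have "g x * max 0 (- L k x) \<le> g x * - ln (g x / ?\<phi> x)"
          unfolding m by (rule mult_left_mono[OF l g0])
        also have "\<dots> = - F x" unfolding F_def by (rule mult_minus_right)
        finally show ?thesis by (rule ennreal_leI)
      qed (auto simp: max_def)
    qed
    finally show ?thesis using neg n0 by (simp add: ennreal_le_iff)
  qed
  have E: "(\<integral>x. exp (L k x) * ?\<phi> x \<partial>lborel) \<le> 1 + exp (- real k)" for k
  proof -
    have "(\<integral>x. exp (L k x) * ?\<phi> x \<partial>lborel) \<le> (\<integral>x. g x + exp (- real k) * ?\<phi> x \<partial>lborel)"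
    proof (rule integral_mono)
      show "integrable lborel (\<lambda>x. exp (L k x) * ?\<phi> x)"
        by (rule integrable_exp_bounded_normal[where c="real k"]) (use Lb abs_le_D1 in auto)
      show "integrable lborel (\<lambda>x. g x + exp (- real k) * ?\<phi> x)" using gi by simp
      fix x
      show "exp (L k x) * ?\<phi> x \<le> g x + exp (- real k) * ?\<phi> x"
      proof (cases "g x = 0 \<or> L k x = - real k")
        case True then show ?thesis using g0[of x] by (auto simp: L_def)
      next
        case False
        then have gp: "g x > 0" and "L k x \<le> ln (g x / ?\<phi> x)" using g0[of x] by (auto simp: L_def max_def min_def split: if_splits)
        then have "exp (L k x) \<le> g x / ?\<phi> x" using ph[of x] by (metis divide_pos_pos exp_le_cancel_iff exp_ln)
        then have "exp (L k x) * ?\<phi> x \<le> g x" using ph[of x] by (simp add: le_divide_eq)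
        then show ?thesis using ph[of x] by (simp add: add_increasing2)
      qed
    qed
    also have "\<dots> = 1 + exp (- real k)"
    proof -
      have "ennreal (\<integral>x. g x \<partial>lborel) = 1"
        using nn_integral_eq_integral[OF gi] g0 density_facts(4)[OF g] by simp
      then have "(\<integral>x. g x \<partial>lborel) = 1" by (simp add: ennreal_eq_1)
      then show ?thesis using gi by simp
    qed
    finally show ?thesis .
  qed
  have P: "(\<integral>\<^sup>+x. ennreal (g x * max 0 (L k x)) \<partial>lborel) \<le> ennreal (B + n + exp (- real k))" for k
  proof -
    have "(\<integral>x. g x * max 0 (L k x) \<partial>lborel) = (\<integral>x. g x * L k x + g x * max 0 (- L k x) \<partial>lborel)"
      by (rule Bochner_Integration.integral_cong) (auto simp: max_def algebra_simps)
    also have "\<dots> = (\<integral>x. g x * L k x \<partial>lborel) + (\<integral>x. g x * max 0 (- L k x) \<partial>lborel)"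
      using iL iLp by simp
    also have "\<dots> \<le> B + n + exp (- real k)"
      using dv[OF Lm Lb, of k] E[of k] Ln[of k] by linarith
    finally have "(\<integral>x. g x * max 0 (L k x) \<partial>lborel) \<le> B + n + exp (- real k)" .
    moreover have "(\<integral>\<^sup>+x. ennreal (g x * max 0 (L k x)) \<partial>lborel) = ennreal (\<integral>x. g x * max 0 (L k x) \<partial>lborel)"
      by (rule nn_integral_eq_integral[OF iLp(1)]) (use g0 in auto)
    ultimately show ?thesis by (simp add: ennreal_leI)
  qed
  have pt: "liminf (\<lambda>k. ennreal (g x * max 0 (L k x))) = ennreal (F x)" for x
  proof (rule lim_imp_Liminf)
    have "\<forall>\<^sub>F k in sequentially. ennreal (g x * max 0 (L k x)) = ennreal (F x)"
      using eventually_ge_at_top[of "nat \<lceil>\<bar>ln (g x / ?\<phi> x)\<bar>\<rceil>"]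
    proof eventually_elim
      case (elim k)
      then have k: "\<bar>ln (g x / ?\<phi> x)\<bar> \<le> real k" by linarith
      show ?case
      proof (cases "g x = 0")
        case False
        then have "L k x = ln (g x / ?\<phi> x)" using k by (auto simp: L_def)
        then show ?thesis using g0[of x] unfolding F_def
          by (cases "ln (g x / ?\<phi> x) \<ge> 0") (auto simp: max_def ennreal_neg mult_nonneg_nonpos)
      qed (simp add: F_def)
    qed
    then show "(\<lambda>k. ennreal (g x * max 0 (L k x))) \<longlonglongrightarrow> ennreal (F x)" by (rule tendsto_eventually)
  qed simp
  have "(\<integral>\<^sup>+x. ennreal (F x) \<partial>lborel) \<le> liminf (\<lambda>k. \<integral>\<^sup>+x. ennreal (g x * max 0 (L k x)) \<partial>lborel)"
    using nn_integral_liminf[of "\<lambda>k x. ennreal (g x * max 0 (L k x))" lborel] by (simp add: pt)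
  also have "\<dots> \<le> liminf (\<lambda>k. ennreal (B + n + exp (- real k)))"
    by (rule Liminf_mono) (use P in simp)
  also have "\<dots> = ennreal (B + n)"
  proof (rule lim_imp_Liminf)
    have "(\<lambda>k. exp (- real k)) \<longlonglongrightarrow> 0"
      by (rule filterlim_compose[OF exp_at_bot]) (simp add: filterlim_uminus_at_bot filterlim_real_sequentially)
    then have "(\<lambda>k. B + n + exp (- real k)) \<longlonglongrightarrow> B + n + 0" by (intro tendsto_intros)
    then show "(\<lambda>k. ennreal (B + n + exp (- real k))) \<longlonglongrightarrow> ennreal (B + n)" by (intro tendsto_ennrealI) simp
  qed simp
  finally have "enn2ereal (\<integral>\<^sup>+x. ennreal (F x) \<partial>lborel) \<le> ereal (B + n)"
    using B n0 by (metis add_nonneg_nonneg enn2ereal_ennreal less_eq_ennreal.rep_eq)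
  then have "enn2ereal (\<integral>\<^sup>+x. ennreal (F x) \<partial>lborel) - ereal n \<le> ereal B"
    by (simp add: ereal_minus_le_iff)
  then show ?thesis
    unfolding rel_entropy_def F_def[symmetric] neg using n0 by simp
qed

end

section \<open>Convergence in relative entropy\<close>

lemma gauss_integral_rescale:
  fixes f :: "real \<Rightarrow> 'b :: {banach, second_countable_topology}"
  assumes s: "s > 0"
  shows "(\<integral>x. gauss s x *\<^sub>R f x \<partial>lborel) = (\<integral>z. std_normal_density z *\<^sub>R f (sqrt s * z) \<partial>lborel)"
proof -
  have g: "sqrt s * gauss s (sqrt s * z) = std_normal_density z" for z
    using s by (simp add: gauss_def std_normal_density_def power_mult_distrib real_sqrt_mult field_simps)
  have "(\<integral>x. gauss s x *\<^sub>R f x \<partial>lborel) = \<bar>sqrt s\<bar> *\<^sub>R (\<integral>z. gauss s (0 + sqrt s * z) *\<^sub>R f (0 + sqrt s * z) \<partial>lborel)"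
    by (rule lborel_integral_real_affine) (use s in simp)
  also have "\<dots> = (\<integral>z. sqrt s *\<^sub>R (gauss s (sqrt s * z) *\<^sub>R f (sqrt s * z)) \<partial>lborel)"
  proof -
    let ?h = "\<lambda>z. gauss s (sqrt s * z) *\<^sub>R f (sqrt s * z)"
    \<comment> \<open>If the function is not integrable, neither is its nonzero multiple, and both
      integrals are 0; the scalar can be moved inside in either case.\<close>
    have "integrable lborel ?h" if "integrable lborel (\<lambda>z. sqrt s *\<^sub>R ?h z)"
      using integrable_scaleR_right[OF that, of "1 / sqrt s"] s by simp
    then show ?thesis
      using s by (cases "integrable lborel ?h") (auto simp: not_integrable_integral_eq simp del: scaleR_scaleR)
  qed
  also have "\<dots> = (\<integral>z. std_normal_density z *\<^sub>R f (sqrt s * z) \<partial>lborel)"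
    unfolding scaleR_scaleR g ..
  finally show ?thesis .
qed

lemma gauss_distribution:
  assumes s: "s > 0"
  defines "\<gamma> \<equiv> density lborel (\<lambda>x. ennreal (gauss s x))"
  shows "real_distribution \<gamma>" "char \<gamma> \<theta> = of_real (exp (- (\<theta>\<^sup>2 * s / 2)))"
proof -
  have "prob_space \<gamma>"
    unfolding \<gamma>_def gauss_eq_normal_density[OF s] using s by (intro prob_space_normal_density) simp
  then show "real_distribution \<gamma>"
    by (auto simp: real_distribution_def real_distribution_axioms_def \<gamma>_def)
  have g0: "0 \<le> gauss s x" for x using gauss_pos[OF s, of x] by simp
  have "char \<gamma> \<theta> = (\<integral>x. gauss s x *\<^sub>R iexp (\<theta> * x) \<partial>lborel)"
    unfolding char_def \<gamma>_def using g0 by (intro integral_density) auto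
  also have "\<dots> = (\<integral>z. std_normal_density z *\<^sub>R iexp (\<theta> * sqrt s * z) \<partial>lborel)"
    unfolding gauss_integral_rescale[OF s] by (simp add: mult.assoc)
  also have "\<dots> = char std_normal_distribution (\<theta> * sqrt s)"
    unfolding char_def by (rule integral_density[symmetric]) auto
  also have "\<dots> = of_real (exp (- (\<theta>\<^sup>2 * s / 2)))"
    using s by (simp add: char_std_normal_distribution power_mult_distrib)
  finally show "char \<gamma> \<theta> = of_real (exp (- (\<theta>\<^sup>2 * s / 2)))" .
qed

lemma (in mixing_space) weak_clt:
  assumes mom: "moment_le (\<lambda>x. x) m" and mean: "expectation (X 0) = 0"
    and v: "long_run_var (\<lambda>x. x) > 0"
  shows "weak_conv_m (\<lambda>n. distr M borel (\<lambda>\<omega>. (\<Sum>i\<in>{1..int n}. X i \<omega>) / sqrt (real n)))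
    (density lborel (\<lambda>x. ennreal (gauss (long_run_var (\<lambda>x. x)) x)))"
proof (rule levy_continuity)
  show "real_distribution (distr M borel (\<lambda>\<omega>. (\<Sum>i\<in>{1..int n}. X i \<omega>) / sqrt (real n)))" for n
    by (rule real_distribution_distr) measurable
  show "real_distribution (density lborel (\<lambda>x. ennreal (gauss (long_run_var (\<lambda>x. x)) x)))"
    by (rule gauss_distribution[OF v])
  fix \<theta>
  have "char (distr M borel (\<lambda>\<omega>. (\<Sum>i\<in>{1..int n}. X i \<omega>) / sqrt (real n))) \<theta>
     = expectation (\<lambda>\<omega>. iexp (\<theta> / sqrt (real n) * (\<Sum>i\<in>{1..int n}. X i \<omega>)))" for n
    unfolding char_def by (subst integral_distr) auto
  then show "(\<lambda>n. char (distr M borel (\<lambda>\<omega>. (\<Sum>i\<in>{1..int n}. X i \<omega>) / sqrt (real n))) \<theta>)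
     \<longlonglongrightarrow> char (density lborel (\<lambda>x. ennreal (gauss (long_run_var (\<lambda>x. x)) x))) \<theta>"
    using mixing_clt[OF mom mean, of \<theta>] unfolding gauss_distribution(2)[OF v] by simp
qed

text \<open>The unscaled inequality is applied to \<open>\<psi> (x / sqrt s)\<close>, so that the
  reference law of variance \<open>s\<close> becomes standard normal after rescaling.\<close>

lemma (in prob_space) donsker_varadhan_rescaled:
  fixes \<psi> :: "real \<Rightarrow> real"
  assumes U[measurable]: "U \<in> borel_measurable M" and U2: "integrable M (\<lambda>\<omega>. (U \<omega>)\<^sup>2)"
    and s: "s = expectation (\<lambda>\<omega>. (U \<omega>)\<^sup>2)" "s > 0" and B: "0 \<le> B"
    and int: "(\<integral>\<^sup>+t\<in>{0<..}. ennreal (gauss_smoothing.fisher (distr M borel U) t - 1 / (s + t)) \<partial>lborel) \<le> ennreal (2 * B)"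
    and cont: "\<And>x. isCont \<psi> x" and bnd: "\<And>x. \<bar>\<psi> x\<bar> \<le> c"
  shows "expectation (\<lambda>\<omega>. \<psi> (U \<omega> / sqrt s)) \<le> B + (\<integral>x. exp (\<psi> x) * std_normal_density x \<partial>lborel) - 1"
proof -
  interpret g: gauss_smoothing "distr M borel U" by (rule gauss_smoothing_distr[OF U U2])
  have sm: "g.second_moment = s"
    unfolding g.second_moment_def s by (subst integral_distr) auto
  have [measurable]: "\<psi> \<in> borel_measurable borel"
    using cont by (intro borel_measurable_continuous_onI continuous_at_imp_continuous_on) auto
  have "(\<integral>u. \<psi> (u / sqrt s) \<partial>distr M borel U) \<le> B + (\<integral>x. exp (\<psi> (x / sqrt s)) * gauss g.second_moment x \<partial>lborel) - 1"
    by (rule g.donsker_varadhan[where c=c])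
      (use s B int bnd in \<open>auto simp: sm intro!: isCont_o2[OF _ cont] continuous_intros\<close>)
  also have "(\<integral>x. exp (\<psi> (x / sqrt s)) * gauss g.second_moment x \<partial>lborel) = (\<integral>x. gauss s x *\<^sub>R exp (\<psi> (x / sqrt s)) \<partial>lborel)"
    by (simp add: sm mult.commute)
  also have "\<dots> = (\<integral>z. exp (\<psi> z) * std_normal_density z \<partial>lborel)"
    unfolding gauss_integral_rescale[OF s(2)] using s(2) by (simp add: mult.commute)
  also have "(\<integral>u. \<psi> (u / sqrt s) \<partial>distr M borel U) = expectation (\<lambda>\<omega>. \<psi> (U \<omega> / sqrt s))"
    by (subst integral_distr) auto
  finally show ?thesis .
qed

lemma (in prob_space) entropy_bound_imp:
  assumes U: "U \<in> borel_measurable M" "integrable M (\<lambda>\<omega>. (U \<omega>)\<^sup>2)"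
    "s = expectation (\<lambda>\<omega>. (U \<omega>)\<^sup>2)" "s > 0" and B: "0 \<le> B"
    and int: "(\<integral>\<^sup>+t\<in>{0<..}. ennreal (gauss_smoothing.fisher (distr M borel U) t - 1 / (s + t)) \<partial>lborel) \<le> ennreal (2 * B)"
  shows "\<exists>g. is_density M (\<lambda>\<omega>. U \<omega> / sqrt s) g"
    and "is_density M (\<lambda>\<omega>. U \<omega> / sqrt s) g \<Longrightarrow> rel_entropy g std_normal_density \<le> ereal B"
proof -
  let ?W = "\<lambda>\<omega>. U \<omega> / sqrt s"
  have W: "?W \<in> borel_measurable M" using U(1) by measurable
  note dv = donsker_varadhan_rescaled[OF U B int]
  show "\<exists>g. is_density M ?W g" by (rule dv_has_density[OF W B dv])
  show "rel_entropy g std_normal_density \<le> ereal B" if g: "is_density M ?W g"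
    by (rule rel_entropy_le[OF g B dv_measurable[OF W B dv g]])
qed

text \<open>The normalised noise sum \<open>G\<close> is again \<open>N(0, t)\<close> and
  independent of \<open>U\<close>. The perturbed sum is therefore \<open>U\<close> smoothed at time
  \<open>t\<close>, and the terms in the third hypothesis of the theorem become explicit.\<close>

lemma (in prob_space) fisher_info_st_perturbed_sum:
  assumes X[measurable]: "\<And>i. X i \<in> borel_measurable M" and mean: "\<And>i. expectation (X i) = 0"
    and X2: "\<And>i. integrable M (\<lambda>\<omega>. (X i \<omega>)\<^sup>2)" and n: "n \<ge> 1" and t: "t > 0"
    and Z: "gaussian_noise M X t Z"
  defines "U \<equiv> \<lambda>\<omega>. partial_sum X n \<omega> / sqrt (real n)"
  shows "fisher_info_st M (perturbed_sum X Z n)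
    = ereal ((expectation (\<lambda>\<omega>. (U \<omega>)\<^sup>2) + t) * gauss_smoothing.fisher (distr M borel U) t - 1)"
proof -
  define G where "G \<omega> = (\<Sum>i=1..n. Z (int i) \<omega>) / sqrt (real n)" for \<omega>
  let ?P = "\<Pi>\<^sub>M i\<in>(UNIV::int set). (borel :: real measure)"
  have Zd: "\<And>i. distributed M lborel (Z i) (\<lambda>x. ennreal (normal_density 0 (sqrt t) x))"
    and Zi: "indep_vars (\<lambda>_. borel) Z UNIV"
    and XZ: "indep_var ?P (\<lambda>\<omega> i. X i \<omega>) ?P (\<lambda>\<omega> i. Z i \<omega>)"
    using Z by (auto simp: gaussian_noise_def)
  have Um[measurable]: "U \<in> borel_measurable M" unfolding U_def partial_sum_def by measurable
  have U2: "integrable M (\<lambda>\<omega>. (U \<omega>)\<^sup>2)"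
  proof -
    have "integrable M (\<lambda>\<omega>. X i \<omega> * X j \<omega>)" for i j
      by (rule integrable_mult_of_squares[OF X X X2 X2])
    then show ?thesis
      unfolding U_def partial_sum_def power_divide power2_eq_square[of "sum _ _"] sum_product by simp
  qed
  have f: "(\<lambda>x. (\<Sum>i=1..n. x (int i)) / sqrt (real n)) \<in> borel_measurable ?P" by measurable
  have indep: "indep_var borel U borel G"
    using indep_var_compose[OF XZ f f] by (simp add: o_def U_def[abs_def] G_def[abs_def] partial_sum_def[abs_def])
  have Gd: "distributed M lborel G (\<lambda>x. ennreal (normal_density 0 (sqrt t) x))"
  proof -
    have "indep_vars (\<lambda>_. borel) Z (int ` {1..n})" using Zi by (rule indep_vars_subset) simp
    then have "distributed M lborel (\<lambda>\<omega>. \<Sum>i\<in>int ` {1..n}. Z i \<omega>)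
        (normal_density (\<Sum>i\<in>int ` {1..n}. 0) (sqrt (\<Sum>i\<in>int ` {1..n}. (sqrt t)\<^sup>2)))"
      by (intro sum_indep_normal[where \<sigma>="\<lambda>_. sqrt t" and \<mu>="\<lambda>_. 0"]) (use n t Zd in auto)
    then have S: "distributed M lborel (\<lambda>\<omega>. \<Sum>i=1..n. Z (int i) \<omega>) (normal_density 0 (sqrt (real n * t)))"
      using t by (simp add: sum.reindex card_image)
    have "distributed M lborel (\<lambda>\<omega>. 0 + 1 / sqrt (real n) * (\<Sum>i=1..n. Z (int i) \<omega>))
        (normal_density (0 + 1 / sqrt (real n) * 0) (\<bar>1 / sqrt (real n)\<bar> * sqrt (real n * t)))"
      by (rule normal_density_affine[OF S]) (use n t in auto)
    then show ?thesis using n by (simp add: G_def[abs_def] real_sqrt_mult)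
  qed
  have V: "perturbed_sum X Z n = (\<lambda>\<omega>. U \<omega> + G \<omega>)"
    by (auto simp: perturbed_sum_def U_def G_def partial_sum_def sum.distrib add_divide_distrib)
  interpret g: gauss_smoothing "distr M borel U" by (rule gauss_smoothing_distr[OF Um U2])
  note d = distributed_add_gauss[OF Um U2 Gd indep t]
  have EX: "integrable M (X i)" for i by (rule square_integrable_imp_integrable[OF X X2])
  have EU: "integrable M U" "expectation U = 0"
    unfolding U_def partial_sum_def using EX mean by simp_all
  have EG: "expectation G = 0" using normal_distributed_expectation[OF _ Gd] t by simp
  have iG: "integrable M G"
    using distributed_integrable[OF Gd, of "\<lambda>x. x"] integrable_normal_moment_nz_1[of "sqrt t" 0] t by simp
  have EV: "expectation (\<lambda>\<omega>. U \<omega> + G \<omega>) = 0" using EU EG iG by simp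
  have "variance (\<lambda>\<omega>. U \<omega> + G \<omega>) = expectation (\<lambda>\<omega>. (U \<omega> + G \<omega>)\<^sup>2)" unfolding EV by simp
  also have "\<dots> = (\<integral>x. g.dens t x * x\<^sup>2 \<partial>lborel)"
    by (rule distributed_integral[OF d, symmetric]) (use g.dens_pos[OF t] in \<open>auto intro: less_imp_le\<close>)
  also have "\<dots> = g.second_moment + t"
    using g.dens_second_moment(2)[OF t] by (simp add: mult.commute)
  also have "g.second_moment = expectation (\<lambda>\<omega>. (U \<omega>)\<^sup>2)"
    unfolding g.second_moment_def by (subst integral_distr) auto
  finally have var: "variance (\<lambda>\<omega>. U \<omega> + G \<omega>) = expectation (\<lambda>\<omega>. (U \<omega>)\<^sup>2) + t" .
  show ?thesis
    unfolding fisher_info_st_def V var fisher_info_add_gauss[OF Um U2 Gd indep t]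
    using g.fisher_nonneg[OF t] by (simp add: one_ereal_def)
qed

text \<open>The mixing coefficients are replaced by a majorant that is strictly positive, as Davydov's
  truncation level divides by it.\<close>

lemma mixing_space_majorant:
  assumes "stationary_space M X" and \<delta>: "\<delta> > (0::real)"
    and sm: "summable (\<lambda>j. alpha_mixing M X (Suc j) powr (\<delta> / (2 + \<delta>)))"
  shows "\<exists>\<beta>. mixing_space M X \<beta> (2 + \<delta>)"
proof -
  interpret stationary_space M X by fact
  \<comment> \<open>The term \<open>(1 / 2) ^ t\<close> is positive and decreasing and its powers
    form a geometric series, so neither monotonicity nor summability is lost. The value 1 at
    \<open>t = 0\<close> is the convention of the locale.\<close>
  define \<beta> where "\<beta> t = (if t = 0 then 1 else max (alpha_mixing M X t) ((1 / 2) ^ t))" for t :: nat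
  define g where "g = \<delta> / (2 + \<delta>)"
  \<comment> \<open>With \<open>p = 2 + \<delta>\<close>, the exponent \<open>1 - 2 / p\<close> of
    the locale is the exponent of the first hypothesis.\<close>
  have g: "g > 0" "1 - 2 / (2 + \<delta>) = g" using \<delta> by (auto simp: g_def field_simps)
  have "mixing_space M X \<beta> (2 + \<delta>)"
  proof
    show "2 < 2 + \<delta>" using \<delta> by simp
    show pos: "0 < \<beta> t" for t by (auto simp: \<beta>_def less_max_iff_disj)
    show le1: "\<beta> t \<le> 1" for t by (auto simp: \<beta>_def alpha_mixing_le_1 power_le_one)
    show "\<beta> 0 = 1" by (simp add: \<beta>_def)
    show "\<beta> t \<le> \<beta> s" if "s \<le> t" for s t
    proof (cases "s = 0")
      case True then show ?thesis using le1[of t] by (simp add: \<beta>_def)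
    next
      case False
      have "((1::real) / 2) ^ t \<le> (1 / 2) ^ s" by (rule power_decreasing) (use that in auto)
      then show ?thesis
        using False that max.mono[OF alpha_mixing_mono[OF that], of "(1 / 2) ^ t" "(1 / 2) ^ s"] by (simp add: \<beta>_def)
    qed
    show "alpha_mixing M X t \<le> \<beta> t" if "t \<ge> 1" for t using that by (simp add: \<beta>_def)
    have "summable (\<lambda>j. \<beta> (Suc j) powr g)"
    proof (rule summable_comparison_test'[where N=0])
      have "((1::real) / 2) powr g < 1" using powr_less_mono2[of g "1 / 2" 1] g by simp
      then have "summable (\<lambda>j. ((1 / 2) powr g) ^ Suc j :: real)"
        by (subst summable_Suc_iff) (rule summable_geometric, simp)
      then show "summable (\<lambda>j. alpha_mixing M X (Suc j) powr g + ((1 / 2) powr g) ^ Suc j)"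
        using sm by (intro summable_add) (simp_all add: g_def)
      fix j :: nat
      have "((1 / 2 :: real) ^ Suc j) powr g = ((1 / 2) powr real (Suc j)) powr g"
        by (subst powr_realpow) auto
      also have "\<dots> = ((1 / 2) powr g) powr real (Suc j)" by (simp only: powr_powr mult.commute)
      also have "\<dots> = ((1 / 2) powr g) ^ Suc j" by (rule powr_realpow) simp
      finally have "((1 / 2 :: real) ^ Suc j) powr g = ((1 / 2) powr g) ^ Suc j" .
      then show "norm (\<beta> (Suc j) powr g) \<le> alpha_mixing M X (Suc j) powr g + ((1 / 2) powr g) ^ Suc j"
        by (cases "alpha_mixing M X (Suc j) \<le> (1 / 2) ^ Suc j") (auto simp: \<beta>_def max_def simp del: power_Suc)
    qed
    then show "summable (\<lambda>j. \<beta> j powr (1 - 2 / (2 + \<delta>)))"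
      unfolding g(2) using summable_Suc_iff[of "\<lambda>j. \<beta> j powr g"] by blast
  qed
  then show ?thesis by blast
qed

text \<open>A density is determined only almost everywhere and is not assumed to exist, so its
  existence is part of the conclusion and the limit is asserted for every choice of densities. Both
  refer to large \<open>n\<close>, since the variance of a short sum may vanish. The condition
  \<open>N \<ge> 1\<close> keeps the degenerate index 0 out of the supremum.\<close>

theorem theorem1p5:
  fixes M :: "'a measure"
    and X :: "int \<Rightarrow> 'a \<Rightarrow> real"
    and Z :: "real \<Rightarrow> int \<Rightarrow> 'a \<Rightarrow> real"
    and \<delta> :: real
  assumes "prob_space M"
    and "\<And>i. X i \<in> borel_measurable M"
    and "stationary_process M X"
    and "\<And>i. (\<integral>\<omega>. X i \<omega> \<partial>M) = 0"
    and "\<And>i. integrable M (\<lambda>\<omega>. (X i \<omega>)\<^sup>2)"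
    and "\<delta> > 0"
    and "integrable M (\<lambda>\<omega>. \<bar>X 0 \<omega>\<bar> powr (2 + \<delta>))"
    and "\<And>\<tau>. \<tau> > 0 \<Longrightarrow> gaussian_noise M X \<tau> (Z \<tau>)"
    and "summable (\<lambda>j. alpha_mixing M X (Suc j) powr (\<delta> / (2 + \<delta>)))"
    and "(\<Sum>\<^sub>\<infinity>j\<in>(UNIV :: int set). covariance M (X 0) (X j)) > 0"
    and "\<exists>N\<ge>1. (\<integral>\<^sup>+\<tau>\<in>{0<..}. e2ennreal (fisher_sup M X Z N \<tau>) \<partial>lborel) < \<infinity>"
  shows "(\<forall>\<^sub>F n in sequentially.
            \<exists>p. is_density M (\<lambda>\<omega>. partial_sum X n \<omega> / sqrt (variance_of M (partial_sum X n))) p) \<and>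
         (\<forall>g. (\<forall>\<^sub>F n in sequentially.
                 is_density M (\<lambda>\<omega>. partial_sum X n \<omega> / sqrt (variance_of M (partial_sum X n))) (g n))
              \<longrightarrow> (\<lambda>n. rel_entropy (g n) std_normal_density) \<longlonglongrightarrow> 0)"
proof -
  have ss: "stationary_space M X"
    using assms(1-3) by (simp add: stationary_space_def stationary_space_axioms_def)
  obtain \<beta> where "mixing_space M X \<beta> (2 + \<delta>)"
    using mixing_space_majorant[OF ss assms(6) assms(9)] by blast
  then interpret mixing_space M X \<beta> "2 + \<delta>" .
  note mean = assms(4) and X2 = assms(5)
  let ?id = "\<lambda>x :: real. x"
  define m where "m = expectation (\<lambda>\<omega>. \<bar>X 0 \<omega>\<bar> powr (2 + \<delta>)) + 1"
  have "0 < m" unfolding m_def by (intro add_nonneg_pos integral_nonneg_AE) auto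
  then have mom: "moment_le ?id m" using assms(7) by (simp add: moment_le_def m_def)
  have cX: "centred ?id i = X i" for i unfolding centred_def using mean[of 0] by simp
  define v where "v = long_run_var ?id"
  have v: "v > 0"
    using assms(10) infsum_autocov[OF mom] unfolding v_def covariance_def cX mean by simp
  have S_eq: "partial_sum X n \<omega> = (\<Sum>i\<in>{1..int n}. X i \<omega>)" for n \<omega>
    unfolding partial_sum_def by (rule sum.reindex_bij_witness[of _ nat int]) auto
  have Sm[measurable]: "partial_sum X n \<in> borel_measurable M" for n
    unfolding partial_sum_def by measurable
  have S2: "integrable M (\<lambda>\<omega>. (partial_sum X n \<omega>)\<^sup>2)" for n
    using integrable_sum_square(1)[OF mom, of "{1..int n}"] unfolding cX S_eq by simp
  have ES: "expectation (partial_sum X n) = 0" for n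
    unfolding partial_sum_def using mean square_integrable_imp_integrable[OF assms(2) X2] by simp
  define V where "V n = variance (partial_sum X n)" for n
  have V_eq: "V n = expectation (\<lambda>\<omega>. (partial_sum X n \<omega>)\<^sup>2)" for n unfolding V_def ES by simp
  define s where "s n = V n / real n" for n
  have s_lim: "s \<longlonglongrightarrow> v"
    using var_sum_asymptotics[OF mom] unfolding s_def V_eq S_eq v_def cX .
  have s_pos: "\<forall>\<^sub>F n in sequentially. s n > 0" using order_tendstoD(1)[OF s_lim v] .
  define U where "U n \<omega> = partial_sum X n \<omega> / sqrt (real n)" for n \<omega>
  have Um[measurable]: "U n \<in> borel_measurable M" for n unfolding U_def by measurable
  have U2: "integrable M (\<lambda>\<omega>. (U n \<omega>)\<^sup>2)" for n unfolding U_def power_divide using S2 by simp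
  have U2s: "expectation (\<lambda>\<omega>. (U n \<omega>)\<^sup>2) = s n" for n unfolding U_def power_divide s_def V_eq by simp
  define \<mu> where "\<mu> n = distr M borel (U n)" for n
  have gs: "gauss_smoothing (\<mu> n)" for n unfolding \<mu>_def by (rule gauss_smoothing_distr[OF Um U2])
  define J where "J n = gauss_smoothing.fisher (\<mu> n)" for n
  have [measurable]: "J n \<in> borel_measurable borel" for n
    unfolding J_def by (rule gauss_smoothing.fisher_measurable[OF gs])
  define h where "h n t = J n t - 1 / (s n + t)" for n t
  have s0: "0 \<le> s n" for n unfolding s_def V_eq by (intro divide_nonneg_nonneg integral_nonneg_AE) auto
  obtain N where N: "N \<ge> 1" and fin: "(\<integral>\<^sup>+\<tau>\<in>{0<..}. e2ennreal (fisher_sup M X Z N \<tau>) \<partial>lborel) < \<infinity>"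
    using assms(11) by blast
  \<comment> \<open>The perturbed variable has variance \<open>s n + t\<close> and
    \<open>V n = n * s n\<close>, so the factor \<open>n\<close> and the variance cancel and the
    term of the supremum is exactly \<open>h n t\<close>.\<close>
  have h_le: "ennreal (h n t) \<le> e2ennreal (fisher_sup M X Z N t)" if n: "n \<ge> N" and t: "t > 0" for n t
  proof -
    have n1: "n \<ge> 1" using n N by simp
    have st: "s n + t > 0" using s0[of n] t by simp
    have Vn: "V n + real n * t = real n * (s n + t)" using n1 by (simp add: s_def distrib_left)
    have "fisher_info_st M (perturbed_sum X (Z t) n) = ereal ((s n + t) * J n t - 1)"
      using fisher_info_st_perturbed_sum[OF assms(2) mean X2 n1 t assms(8)[OF t]]
      unfolding U_def[symmetric] U2s J_def \<mu>_def .
    then have "ereal (real n) * fisher_info_st M (perturbed_sum X (Z t) n) / ereal (V n + real n * t)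
       = ereal (real n * ((s n + t) * J n t - 1) / (real n * (s n + t)))"
      unfolding Vn using n1 st by simp
    also have "real n * ((s n + t) * J n t - 1) / (real n * (s n + t)) = h n t"
      using n1 st by (simp add: h_def diff_divide_distrib)
    finally have eq: "ereal (h n t) = ereal (real n) * fisher_info_st M (perturbed_sum X (Z t) n) / ereal (V n + real n * t)" ..
    have "ereal (h n t) \<le> fisher_sup M X Z N t"
      unfolding eq fisher_sup_def V_def using n by (intro SUP_upper) simp
    from e2ennreal_mono[OF this] show ?thesis by simp
  qed
  define H where "H n t = ennreal (h n t) * indicator {0<..} t" for n t
  have [measurable]: "H n \<in> borel_measurable borel" for n unfolding H_def h_def by measurable
  \<comment> \<open>A countable supremum of measurable functions, hence a measurable dominating
    function. The integrand of the third hypothesis lies above it on the positive axis, and only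
    monotonicity of the integral is applied to that integrand.\<close>
  define w where "w t = (SUP n\<in>{N..}. H n t)" for t
  have [measurable]: "w \<in> borel_measurable borel" unfolding w_def by measurable
  have "(\<integral>\<^sup>+t. w t \<partial>lborel) \<le> (\<integral>\<^sup>+\<tau>\<in>{0<..}. e2ennreal (fisher_sup M X Z N \<tau>) \<partial>lborel)"
    unfolding w_def H_def by (intro nn_integral_mono SUP_least) (auto simp: indicator_def h_le)
  then have w_fin: "(\<integral>\<^sup>+t. w t \<partial>lborel) < \<infinity>" using fin by (rule le_less_trans)
  have weak: "weak_conv_m \<mu> (density lborel (\<lambda>x. ennreal (gauss v x)))"
    using weak_clt[OF mom mean v[unfolded v_def]] unfolding \<mu>_def U_def S_eq v_def .
  \<comment> \<open>In \<open>H\<close> negative values of \<open>h n t\<close> are cut off by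
    \<open>ennreal\<close>, so an upper bound for the limit superior of \<open>J n t\<close>
    suffices.\<close>
  have h_lim: "(\<lambda>n. H n t) \<longlonglongrightarrow> 0" for t
  proof (cases "t > 0")
    case True
    have vt: "v + t > 0" using v True by simp
    have is_lim: "(\<lambda>n. 1 / (s n + t)) \<longlonglongrightarrow> 1 / (v + t)"
      using vt by (intro tendsto_intros s_lim) auto
    have "(\<lambda>n. max 0 (h n t)) \<longlonglongrightarrow> 0"
    proof (rule tendstoI)
      fix e :: real assume e: "e > 0"
      have "\<forall>\<^sub>F n in sequentially. J n t < 1 / (v + t) + e / 2"
        unfolding J_def by (rule fisher_weak_limit[OF gs v True weak]) (use e in simp)
      moreover have "\<forall>\<^sub>F n in sequentially. 1 / (v + t) - e / 2 < 1 / (s n + t)"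
        using order_tendstoD(1)[OF is_lim, of "1 / (v + t) - e / 2"] e by simp
      ultimately show "\<forall>\<^sub>F n in sequentially. dist (max 0 (h n t)) 0 < e"
      proof eventually_elim
        case (elim n)
        then have "h n t < e" unfolding h_def by linarith
        then show ?case using e by (simp add: dist_real_def)
      qed
    qed
    from tendsto_ennrealI[OF this] show ?thesis using True by (simp add: H_def ennreal_max_0)
  qed (simp add: H_def)
  \<comment> \<open>\<open>enn2real\<close> returns 0 at infinity, so \<open>B n\<close> carries
    information only where \<open>H_fin\<close> applies, that is for
    \<open>n \<ge> N\<close>.\<close>
  define B where "B n = enn2real (\<integral>\<^sup>+t. H n t \<partial>lborel) / 2" for n
  have H_fin: "(\<integral>\<^sup>+t. H n t \<partial>lborel) < \<infinity>" if "n \<ge> N" for n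
    by (rule le_less_trans[OF nn_integral_mono w_fin]) (use that in \<open>auto simp: w_def intro: SUP_upper\<close>)
  \<comment> \<open>The index is shifted by \<open>N\<close> because \<open>w\<close> is the
    supremum over \<open>n \<ge> N\<close> and dominates \<open>H n\<close> from there on.\<close>
  have "(\<lambda>n. \<integral>\<^sup>+t. H (n + N) t \<partial>lborel) \<longlonglongrightarrow> (\<integral>\<^sup>+t. 0 \<partial>(lborel :: real measure))"
  proof (rule nn_integral_dominated_convergence[where w=w])
    show "AE t in lborel. H (n + N) t \<le> w t" for n
      unfolding w_def by (rule AE_I2, rule SUP_upper) simp
    show "AE t in lborel. (\<lambda>n. H (n + N) t) \<longlonglongrightarrow> 0"
      using LIMSEQ_ignore_initial_segment[OF h_lim] by simp
  qed (use w_fin in auto)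
  then have "(\<lambda>n. \<integral>\<^sup>+t. H n t \<partial>lborel) \<longlonglongrightarrow> ennreal 0"
    using LIMSEQ_offset[of "\<lambda>n. \<integral>\<^sup>+t. H n t \<partial>lborel" N] by simp
  then have "(\<lambda>n. enn2real (\<integral>\<^sup>+t. H n t \<partial>lborel) / 2) \<longlonglongrightarrow> 0 / 2"
    by (intro tendsto_divide tendsto_const tendsto_enn2real) auto
  then have B_lim: "B \<longlonglongrightarrow> 0" by (simp add: B_def[abs_def])
  have Wn: "(\<lambda>\<omega>. partial_sum X n \<omega> / sqrt (variance (partial_sum X n))) = (\<lambda>\<omega>. U n \<omega> / sqrt (s n))" if "n \<ge> 1" for n
    using that unfolding U_def s_def V_def[symmetric] by (auto simp: real_sqrt_divide)
  have key: "(\<exists>g. is_density M (\<lambda>\<omega>. partial_sum X n \<omega> / sqrt (variance (partial_sum X n))) g) \<and>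
      (\<forall>g. is_density M (\<lambda>\<omega>. partial_sum X n \<omega> / sqrt (variance (partial_sum X n))) g \<longrightarrow> rel_entropy g std_normal_density \<le> ereal (B n))"
    if n: "n \<ge> N" "s n > 0" for n
  proof -
    have "(\<integral>\<^sup>+t\<in>{0<..}. ennreal (gauss_smoothing.fisher (distr M borel (U n)) t - 1 / (s n + t)) \<partial>lborel) \<le> ennreal (2 * B n)"
      using H_fin[OF n(1)] unfolding B_def H_def h_def J_def \<mu>_def by (simp add: ennreal_enn2real)
    note b = entropy_bound_imp[OF Um U2 U2s[symmetric] n(2) _ this]
    have "0 \<le> B n" by (simp add: B_def)
    then show ?thesis unfolding Wn[OF order_trans[OF N n(1)]] using b by blast
  qed
  have ev: "\<forall>\<^sub>F n in sequentially. n \<ge> N \<and> s n > 0"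
    using s_pos by (intro eventually_conj eventually_ge_at_top)
  show ?thesis
  proof (intro conjI allI impI)
    show "\<forall>\<^sub>F n in sequentially. \<exists>p. is_density M (\<lambda>\<omega>. partial_sum X n \<omega> / sqrt (variance (partial_sum X n))) p"
      using ev by eventually_elim (use key in blast)
    fix g
    assume g: "\<forall>\<^sub>F n in sequentially. is_density M (\<lambda>\<omega>. partial_sum X n \<omega> / sqrt (variance (partial_sum X n))) (g n)"
    show "(\<lambda>n. rel_entropy (g n) std_normal_density) \<longlonglongrightarrow> 0"
    proof (rule tendsto_sandwich[where f="\<lambda>_. 0" and h="\<lambda>n. ereal (B n)"])
      show "\<forall>\<^sub>F n in sequentially. 0 \<le> rel_entropy (g n) std_normal_density"
        using g by eventually_elim (rule rel_entropy_nonneg)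
      show "\<forall>\<^sub>F n in sequentially. rel_entropy (g n) std_normal_density \<le> ereal (B n)"
        using g ev by eventually_elim (use key in blast)
      show "(\<lambda>n. ereal (B n)) \<longlonglongrightarrow> 0" using tendsto_ereal[OF B_lim] by (simp add: zero_ereal_def)
    qed simp
  qed
qed

end
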